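(* Let $p$ be a uniformly bounded probability density on $\mathbb{R}_+$ of the form $p(x)=c\exp\big(-(g(x)-q(x))\big)$ satisfying the standing assumptions given in the context, with $h:=g'\in\mathfrak{R}$, and let $X_1,\dots,X_n$ be independent random variables with common density $p$, $S_1^n=X_1+\dots+X_n$. Fix an integer $k\ge1$ and $y_1^k=(y_1,\dots,y_k)\in\mathbb{R}^k$. Assume $a_n\to\infty$ as $n\to\infty$, let $t=t_n$ be defined by $m(t)=a_n$, and assume $$\lim_{n\to\infty}\frac{\psi(t)^2}{\sqrt n\,\psi'(t)}=0 .$$ For $0\le i\le k-1$ let $t_i$ be defined by $$m_i:=m(t_i)=\frac{na_n-(y_1+\dots+y_i)}{n-i}$$ (the sum being $0$ for $i=0$). Let $p_{a_n}(y_1^k)=p(X_1^k=y_1^k\mid S_1^n=na_n)$ denote the conditional density of $(X_1,\dots,X_k)$ at the point $y_1^k$ given $S_1^n=na_n$. Then, as $n\to\infty$, $$p_{a_n}(y_1^k)=g_m(y_1^k)\Big(1+o\big(\tfrac{1}{\sqrt n}\big)\Big),\qquad g_m(y_1^k)=\prod_{i=0}^{k-1}\pi^{m_i}(y_{i+1}),$$ where $\pi^{a}(x)=\frac{e^{\tau x}p(x)}{\Phi(\tau)}$ with $\tau$ the unique solution of $m(\tau)=a$.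
   Context: Standing assumptions on $p$: $p(x)=c\exp(-(g(x)-q(x)))$ for $x\in\mathbb{R}_+$ (and $p=0$ on $(-\infty,0)$), $p$ is uniformly bounded, and $c>0$ is a normalizing constant. Put $h:=g'$. The function $g$ is positive with $g(x)/x\to\infty$ as $x\to\infty$. There is a constant $\vartheta>0$ such that, for all large $x$, $\sup_{|v-x|<\vartheta x}|q(v)|\le \frac{1}{x\sqrt{h(x)}}$. Class $R_0$: functions $l$ representable as $l(x)=\exp\big(\int_1^x\frac{\epsilon(u)}{u}du\big)$, $x\ge1$, with $\epsilon$ twice differentiable and $\epsilon(x)\to0$ as $x\to\infty$. Class $R_\beta$ ($\beta>0$): $h\in R_\beta$ if for $x$ large enough $h(x)=x^\beta l(x)$ with $l\in R_0$ whose $\epsilon$ satisfies $\limsup_{x\to\infty}x|\epsilon'(x)|<\infty$ and $\limsup_{x\to\infty}x^2|\epsilon''(x)|<\infty$. Class $\widetilde{R_0}$: functions $l\in R_0$ with $l(x)\to\infty$ as $x\to\infty$, $\lim_{x\to\infty}\frac{x\epsilon'(x)}{\epsilon(x)}=0$, $\lim_{x\to\infty}\frac{x^2\epsilon''(x)}{\epsilon(x)}=0$, and $\liminf_{x\to\infty}x^{\eta}\epsilon(x)>0$ for some $\eta\in(0,1/8)$. Class $R_\infty$: $h\in R_\infty$ if $h$ is increasing and strictly monotone and its inverse function belongs to $\widetilde{R_0}$. In all cases $\psi(u):=h^{\leftarrow}(u):=\inf\{x:h(x)\ge u\}$ denotes the inverse of $h$. $\mathfrak{R}:=R_\beta\cup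 R_\infty$ (i.e. $h\in R_\beta$ for some $\beta>0$, or $h\in R_\infty$). Notation: $\Phi(t)=\int_0^\infty e^{tx}p(x)\,dx$ and $m(t)=\frac{d}{dt}\log\Phi(t)$. The conditional density is $p_{a_n}(y_1^k)=\Big(\prod_{i=1}^k p(y_i)\Big)\,\frac{p^{*(n-k)}(na_n-y_1-\dots-y_k)}{p^{*n}(na_n)}$, where $p^{*j}$ is the $j$-fold convolution of $p$. *)

theory Defs
  imports "HOL-Probability.Probability" "HOL-Library.Landau_Symbols"
begin

(* At the endpoint 1 the derivatives are one-sided. The representing function e is determined
   by l on [1, oo), so conditions on e are conditions on l. *)
definition R0_rep ::
  "(real \<Rightarrow> real) \<Rightarrow> (real \<Rightarrow> real) \<Rightarrow> (real \<Rightarrow> real) \<Rightarrow> (real \<Rightarrow> real) \<Rightarrow> bool" where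
  "R0_rep l e e' e'' \<longleftrightarrow>
     (\<forall>x\<ge>1. (e has_real_derivative e' x) (at x within {1..})) \<and>
     (\<forall>x\<ge>1. (e' has_real_derivative e'' x) (at x within {1..})) \<and>
     (e \<longlongrightarrow> 0) at_top \<and>
     (\<forall>x\<ge>1. l x = exp (integral {1..x} (\<lambda>u. e u / u)))"

definition R_beta :: "real \<Rightarrow> (real \<Rightarrow> real) set" where
  "R_beta \<beta> = {h. \<exists>l e e' e''. R0_rep l e e' e'' \<and>
     (\<forall>\<^sub>F x in at_top. h x = x powr \<beta> * l x) \<and>
     Limsup at_top (\<lambda>x. ereal (x * \<bar>e' x\<bar>)) < \<infinity> \<and>
     Limsup at_top (\<lambda>x. ereal (x\<^sup>2 * \<bar>e'' x\<bar>)) < \<infinity>}"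

definition R0_tilde :: "(real \<Rightarrow> real) set" where
  "R0_tilde = {l. \<exists>e e' e''. R0_rep l e e' e'' \<and>
     filterlim l at_top at_top \<and>
     ((\<lambda>x. x * e' x / e x) \<longlongrightarrow> 0) at_top \<and>
     ((\<lambda>x. x\<^sup>2 * e'' x / e x) \<longlongrightarrow> 0) at_top \<and>
     (\<exists>\<eta>. 0 < \<eta> \<and> \<eta> < 1/8 \<and> Liminf at_top (\<lambda>x. ereal (x powr \<eta> * e x)) > 0)}"

(* h is the derivative of a function on the half-line, so only its values on (0, oo) matter.
   If h is unbounded above near 0 (or on some other bounded set), this infimum does not invert h
   near infinity; that it does must then be assumed separately. *)
definition gen_inverse :: "(real \<Rightarrow> real) \<Rightarrow> real \<Rightarrow> real" where
  "gen_inverse h u = Inf {x. 0 < x \<and> h x \<ge> u}"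

definition R_infty :: "(real \<Rightarrow> real) set" where
  "R_infty = {h. strict_mono_on {0<..} h \<and> gen_inverse h \<in> R0_tilde}"

definition R_frak :: "(real \<Rightarrow> real) set" where
  "R_frak = (\<Union>\<beta>\<in>{0<..}. R_beta \<beta>) \<union> R_infty"

definition mgf :: "(real \<Rightarrow> real) \<Rightarrow> real \<Rightarrow> real" where
  "mgf p t = (LINT x:{0..}|lborel. exp (t * x) * p x)"

definition tilt_mean :: "(real \<Rightarrow> real) \<Rightarrow> real \<Rightarrow> real" where
  "tilt_mean p t = deriv (\<lambda>s. ln (mgf p s)) t"

definition tilted_density :: "(real \<Rightarrow> real) \<Rightarrow> real \<Rightarrow> real \<Rightarrow> real" where
  "tilted_density p a x = (let \<tau> = (THE \<tau>. tilt_mean p \<tau> = a) in exp (\<tau> * x) * p x / mgf p \<tau>)"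

definition conv :: "(real \<Rightarrow> real) \<Rightarrow> (real \<Rightarrow> real) \<Rightarrow> real \<Rightarrow> real" where
  "conv f g x = (LINT y|lborel. f (x - y) * g y)"

(* For bounded integrable p the integrals exist at every point, so this is a pointwise version
   and not just an almost-everywhere class. conv_power p j is the j-fold convolution for j \<ge> 1
   (conv_power p 1 = p); the value at j = 0 is irrelevant. *)
definition conv_power :: "(real \<Rightarrow> real) \<Rightarrow> nat \<Rightarrow> real \<Rightarrow> real" where
  "conv_power p j = (conv p ^^ (j - 1)) p"

(* Density at (y 1, ..., y k) of the first k of n i.i.d. variables with density p,
   given that all n of them sum to s. *)
definition cond_density :: "(real \<Rightarrow> real) \<Rightarrow> nat \<Rightarrow> real \<Rightarrow> nat \<Rightarrow> (nat \<Rightarrow> real) \<Rightarrow> real" where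
  "cond_density p n s k y =
     (\<Prod>i=1..k. p (y i)) * conv_power p (n - k) (s - (\<Sum>i=1..k. y i)) / conv_power p n s"

end

theory Submission
  imports Defs "HOL-Real_Asymp.Real_Asymp"
begin

text \<open>
  The conditional density telescopes into k factors, the i-th being the density at y (i + 1) tilted
  to mean m_i times the ratio of the densities of a sum of n - i - 1 and of a sum of n - i
  independent variables with that tilted density, both taken near their means. In the Fourier integral of the
  difference of these two densities the terms of order one cancel and the linear term
  is odd up to an error of smaller order, so the ratio is 1 + O((1 + w^2) / n), where w is the distance
  of y (i + 1) from m_i in units of the standard deviation. This is uniform over all centred densities
  dominated by one fixed two-sided exponential.
  Both growth classes give psi' (u) of the order of psi' (t) for u between t / 2 and 2 t, and t^2 psi' (t)
  tending to infinity; by monotonicity of h this dominates the density tilted by t, centred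
  at psi (t) and scaled by sqrt (psi' (t)), by such an exponential. Hence w^2 = O(psi(t)^2 / psi' (t)),
  and the growth assumption makes the error o(1 / sqrt n).
\<close>

section \<open>Characteristic functions and convolution powers\<close>

text \<open>A plain local limit theorem controls numerator and denominator of a factor each only up
  to a relative error O(1 / sqrt N), which is too coarse for the claim. So it is their difference
  that is expanded, and the denominator merely needs a lower bound of order 1 / sqrt N. The tilted
  densities vary with n, hence every constant has to come from the envelope
  \<open>A * exp (- \<kappa> * \<bar>z\<bar>)\<close>: it supplies upper bounds for moments, while
  its maximum \<open>A\<close> forces a lower bound for the variance and keeps the characteristic
  function away from modulus 1 outside a neighbourhood of 0. The conditional density is evaluated at
  given points, so Fourier inversion is needed everywhere and not just almost everywhere. The scale
  \<open>sqrt (\<psi>' t)\<close> arises as follows: the slope t - h x of t x - g x vanishes at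
  \<psi> t, and a displacement of x by \<sigma> changes it by about \<sigma> / \<psi>' t. For
  \<sigma> = sqrt (\<psi>' t) this is 1 / \<sigma>, so the exponent changes by a constant. Since
  psi' is controlled only between t / 2 and 2 t, each t_i has to be confined to that range; this is
  deduced from the means, which differ from a_n by at most \<sigma>.\<close>

definition prob_dens :: "(real \<Rightarrow> real) \<Rightarrow> bool" where
  "prob_dens f \<longleftrightarrow> f \<in> borel_measurable borel \<and> (\<forall>x. 0 \<le> f x) \<and> integrable lborel f \<and>
     (LINT x|lborel. f x) = 1"

definition cf :: "(real \<Rightarrow> real) \<Rightarrow> real \<Rightarrow> complex" where
  "cf f = char (density lborel (\<lambda>x. ennreal (f x)))"

lemma prob_densD:
  assumes "prob_dens f"
  shows "f \<in> borel_measurable borel" "0 \<le> f x" "integrable lborel f" "(LINT x|lborel. f x) = 1"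
  using assms by (auto simp: prob_dens_def)

lemma real_distribution_prob_dens:
  assumes "prob_dens f"
  shows "real_distribution (density lborel (\<lambda>x. ennreal (f x)))"
proof -
  note f = prob_densD[OF assms]
  have "(\<integral>\<^sup>+x. ennreal (f x) \<partial>lborel) = 1"
    using nn_integral_eq_integral[OF f(3)] f(2,4) by simp
  then have "prob_space (density lborel (\<lambda>x. ennreal (f x)))"
    using f(1) by (intro prob_spaceI) (simp add: emeasure_density)
  then show ?thesis
    by (simp add: real_distribution_def real_distribution_axioms_def)
qed

lemma cf_eq: "prob_dens f \<Longrightarrow> cf f s = (LINT x|lborel. f x *\<^sub>R iexp (s * x))"
  by (auto simp: cf_def char_def prob_dens_def intro!: integral_density)

lemma integrable_cf_integrand:
  assumes "prob_dens f" shows "integrable lborel (\<lambda>x. f x *\<^sub>R iexp (s * x))"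
proof -
  note f = prob_densD[OF assms]
  note [measurable] = f(1)
  show ?thesis using f by (intro Bochner_Integration.integrable_bound[OF f(3)]) auto
qed

lemma cf_measurable [measurable]: "prob_dens f \<Longrightarrow> cf f \<in> borel_measurable borel"
  unfolding cf_def by (rule real_distribution.char_measurable[OF real_distribution_prob_dens])

lemma norm_cf_le_1: "prob_dens f \<Longrightarrow> norm (cf f s) \<le> 1"
  unfolding cf_def by (rule real_distribution.cmod_char_le_1[OF real_distribution_prob_dens])

section \<open>Translations, reflections and convolutions\<close>

lemma translation_integral:
  fixes f :: "real \<Rightarrow> 'a :: {banach, second_countable_topology}"
  shows "(LINT x|lborel. f (x - y)) = (LINT x|lborel. f x)"
  using lborel_integral_real_affine[of 1 f "-y"] by simp

lemma translation_integrable: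
  fixes f :: "real \<Rightarrow> 'a :: {banach, second_countable_topology}"
  shows "integrable lborel f \<Longrightarrow> integrable lborel (\<lambda>x. f (x - y))"
  using lborel_integrable_real_affine[of f 1 "-y"] by simp

lemma reflection_integral:
  fixes f :: "real \<Rightarrow> 'a :: {banach, second_countable_topology}"
  shows "(LINT y|lborel. f (x - y)) = (LINT y|lborel. f y)"
  using lborel_integral_real_affine[of "-1" f x] by simp

lemma reflection_integrable:
  fixes f :: "real \<Rightarrow> 'a :: {banach, second_countable_topology}"
  shows "integrable lborel f \<Longrightarrow> integrable lborel (\<lambda>y. f (x - y))"
  using lborel_integrable_real_affine[of f "-1" x] by simp

lemma conv_integrable_pair:
  assumes "prob_dens f" "prob_dens g"
  shows "integrable (lborel \<Otimes>\<^sub>M lborel) (\<lambda>(y, x). f (x - y) * g y)"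
proof -
  note f = prob_densD[OF assms(1)] and g = prob_densD[OF assms(2)]
  note [measurable] = f(1) g(1)
  show ?thesis
  proof (rule lborel_pair.Fubini_integrable)
    have "(LINT x|lborel. norm (f (x - y) * g y)) = g y" for y
      using f g translation_integral[of f y] by (simp add: abs_mult)
    then show "integrable lborel (\<lambda>y. LINT x|lborel. norm (case (y, x) of (y, x) \<Rightarrow> f (x - y) * g y))"
      using g by simp
  qed (use translation_integrable[OF f(3)] in auto)
qed

text \<open>Boundedness of one factor makes the convolution integral exist at every point; where
  integrability failed, the Bochner integral in \<open>conv\<close> would just be 0.\<close>

lemma conv_integrable_at:
  assumes "prob_dens f" "\<And>x. f x \<le> K" "prob_dens g"
  shows "integrable lborel (\<lambda>y. f (x - y) * g y)"
proof -
  note f = prob_densD[OF assms(1)] and g = prob_densD[OF assms(3)]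
  note [measurable] = f(1) g(1)
  have "\<bar>f z\<bar> \<le> \<bar>K\<bar>" for z using f(2)[of z] assms(2)[of z] by auto
  then show ?thesis
    using g(2) by (intro Bochner_Integration.integrable_bound[OF integrable_mult_right[OF g(3), of "\<bar>K\<bar>"]])
       (auto simp: abs_mult intro!: mult_right_mono)
qed

lemma conv_prob_dens:
  assumes "prob_dens f" "prob_dens g"
  shows "prob_dens (conv f g)"
proof -
  note f = prob_densD[OF assms(1)] and g = prob_densD[OF assms(2)]
  note [measurable] = f(1) g(1)
  note P = conv_integrable_pair[OF assms]
  have "(LINT x|lborel. conv f g x) = (LINT y|lborel. LINT x|lborel. f (x - y) * g y)"
    unfolding conv_def using lborel_pair.Fubini_integral[OF P] by simp
  also have "\<dots> = 1" using translation_integral[of f] f(4) g(4) by simp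
  finally show ?thesis
    unfolding prob_dens_def using lborel_pair.integrable_snd[OF P] f(2) g(2)
    by (auto simp: conv_def[abs_def])
qed

lemma conv_bounded:
  assumes "prob_dens f" "\<And>x. f x \<le> K" "prob_dens g"
  shows "conv f g x \<le> K"
proof -
  note g = prob_densD[OF assms(3)]
  have "conv f g x \<le> (LINT y|lborel. K * g y)"
    unfolding conv_def using g assms(2)
    by (intro integral_mono conv_integrable_at[OF assms]) (auto intro!: mult_right_mono)
  then show ?thesis using g by simp
qed

lemma cf_conv:
  assumes "prob_dens f" "prob_dens g"
  shows "cf (conv f g) s = cf f s * cf g s"
proof -
  note f = prob_densD[OF assms(1)] and g = prob_densD[OF assms(2)]
  note [measurable] = f(1) g(1)
  have P: "integrable (lborel \<Otimes>\<^sub>M lborel) (\<lambda>(y, x). (f (x - y) * g y) *\<^sub>R iexp (s * x))"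
    by (rule Bochner_Integration.integrable_bound[OF conv_integrable_pair[OF assms]]) auto
  have "cf (conv f g) s = (LINT x|lborel. LINT y|lborel. (f (x - y) * g y) *\<^sub>R iexp (s * x))"
    unfolding cf_eq[OF conv_prob_dens[OF assms]] conv_def
    by (intro Bochner_Integration.integral_cong refl)
      (simp del: of_real_mult add: scaleR_conv_of_real flip: integral_complex_of_real)
  also have "\<dots> = (LINT y|lborel. LINT x|lborel. (f (x - y) * g y) *\<^sub>R iexp (s * x))"
    using lborel_pair.Fubini_integral[OF P] by simp
  also have "\<dots> = (LINT y|lborel. cf f s * (g y *\<^sub>R iexp (s * y)))"
  proof (intro Bochner_Integration.integral_cong refl)
    fix y :: real
    have "(LINT x|lborel. (f (x - y) * g y) *\<^sub>R iexp (s * x)) =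
      (LINT x|lborel. (f (x - y) *\<^sub>R iexp (s * (x - y))) * (g y *\<^sub>R iexp (s * y)))"
      by (intro Bochner_Integration.integral_cong refl)
        (simp add: scaleR_conv_of_real algebra_simps flip: exp_add)
    also have "\<dots> = cf f s * (g y *\<^sub>R iexp (s * y))"
      by (simp only: integral_mult_left_zero cf_eq[OF assms(1)]
          translation_integral[of "\<lambda>x. f x *\<^sub>R iexp (s * x)" y])
    finally show "(LINT x|lborel. (f (x - y) * g y) *\<^sub>R iexp (s * x)) = cf f s * (g y *\<^sub>R iexp (s * y))" .
  qed
  also have "\<dots> = cf f s * cf g s"
    by (simp only: integral_mult_right_zero cf_eq[OF assms(2)])
  finally show ?thesis .
qed

lemma conv_power_1 [simp]: "conv_power f (Suc 0) = f"
  by (simp add: conv_power_def)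

lemma conv_power_Suc: "j \<ge> 1 \<Longrightarrow> conv_power f (Suc j) = conv f (conv_power f j)"
  by (cases j) (auto simp: conv_power_def)

lemma conv_power_prob_dens:
  assumes "prob_dens f" "j \<ge> 1" shows "prob_dens (conv_power f j)"
  using assms(2) by (induction j rule: dec_induct)
    (simp_all add: assms(1) conv_power_Suc conv_prob_dens)

lemma cf_conv_power:
  assumes "prob_dens f" "j \<ge> 1" shows "cf (conv_power f j) s = cf f s ^ j"
  using assms(2) by (induction j rule: dec_induct)
    (simp_all add: assms(1) conv_power_Suc cf_conv conv_power_prob_dens)

section \<open>Gaussian regularisation and Fourier inversion\<close>

lemma normal_ft:
  assumes e: "e > 0"
  shows "(LINT s|lborel. exp (- (e * s)\<^sup>2 / 2) *\<^sub>R iexp (u * s)) =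
    complex_of_real (2 * pi * normal_density 0 e u)"
    and "integrable lborel (\<lambda>s. exp (- (e * s)\<^sup>2 / 2))"
proof -
  let ?c = "sqrt (2 * pi)"
  have *: "exp (- (e * s)\<^sup>2 / 2) = ?c * std_normal_density (0 + e * s)" for s
    by (simp add: std_normal_density_def)
  show "integrable lborel (\<lambda>s. exp (- (e * s)\<^sup>2 / 2))"
    unfolding * using e
    by (intro integrable_mult_right lborel_integrable_real_affine integrable_normal_density) auto
  have "(LINT s|lborel. exp (- (e * s)\<^sup>2 / 2) *\<^sub>R iexp (u * s)) =
    ?c *\<^sub>R (LINT s|lborel. std_normal_density (0 + e * s) *\<^sub>R iexp ((u/e) * (0 + e * s)))"
    unfolding * using e by (simp flip: integral_scaleR_right add: mult.commute)
  also have "(LINT s|lborel. std_normal_density (0 + e * s) *\<^sub>R iexp ((u/e) * (0 + e * s))) =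
    (1/e) *\<^sub>R (LINT s|lborel. std_normal_density s *\<^sub>R iexp ((u/e) * s))"
    by (subst (2) lborel_integral_real_affine[of e _ 0]) (use e in auto)
  also have "(LINT s|lborel. std_normal_density s *\<^sub>R iexp ((u/e) * s)) = char std_normal_distribution (u/e)"
    unfolding char_def by (rule integral_density[symmetric]) auto
  also have "\<dots> = complex_of_real (exp (- (u/e)\<^sup>2 / 2))"
    by (simp add: char_std_normal_distribution)
  also have "?c *\<^sub>R (1/e) *\<^sub>R complex_of_real (exp (- (u/e)\<^sup>2 / 2)) = complex_of_real (2 * pi * normal_density 0 e u)"
    using e by (simp add: scaleR_conv_of_real normal_density_def power_divide real_sqrt_mult field_simps
        flip: of_real_mult of_real_divide)
  finally show "(LINT s|lborel. exp (- (e * s)\<^sup>2 / 2) *\<^sub>R iexp (u * s)) =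
    complex_of_real (2 * pi * normal_density 0 e u)" .
qed

text \<open>The Gaussian factor makes the double integral absolutely convergent for every density,
  so Fubini applies although \<open>cf g\<close> may fail to be integrable. Its own transform is a
  normal kernel, which mollifies \<open>g\<close> with standard deviation \<open>e\<close>.\<close>

lemma gauss_smoothing:
  assumes g: "prob_dens g" and e: "e > 0"
  shows "(LINT s|lborel. exp (- (e * s)\<^sup>2 / 2) *\<^sub>R (cf g s * iexp (- (s * x)))) =
    complex_of_real (2 * pi * (LINT y|lborel. g y * normal_density 0 e (x - y)))"
proof -
  note G = prob_densD[OF g]
  note [measurable] = G(1)
  let ?h = "\<lambda>s y. (exp (- (e * s)\<^sup>2 / 2) * g y) *\<^sub>R iexp ((y - x) * s)"
  have P0: "integrable (lborel \<Otimes>\<^sub>M lborel) (\<lambda>(s, y). exp (- (e * s)\<^sup>2 / 2) * g y)"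
    by (rule lborel_pair.Fubini_integrable) (use normal_ft[OF e] G in \<open>auto simp: abs_mult\<close>)
  have P: "integrable (lborel \<Otimes>\<^sub>M lborel) (\<lambda>(s, y). ?h s y)"
    by (rule Bochner_Integration.integrable_bound[OF P0]) (auto simp flip: of_real_diff of_real_mult)
  have "(LINT s|lborel. exp (- (e * s)\<^sup>2 / 2) *\<^sub>R (cf g s * iexp (- (s * x)))) =
    (LINT s|lborel. LINT y|lborel. ?h s y)"
  proof (intro Bochner_Integration.integral_cong refl)
    fix s :: real
    have "(LINT y|lborel. ?h s y) =
      (LINT y|lborel. (g y *\<^sub>R iexp (s * y)) * (exp (- (e * s)\<^sup>2 / 2) *\<^sub>R iexp (- (s * x))))"
      by (intro Bochner_Integration.integral_cong refl)
        (simp add: scaleR_conv_of_real algebra_simps flip: exp_add)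
    also have "\<dots> = exp (- (e * s)\<^sup>2 / 2) *\<^sub>R (cf g s * iexp (- (s * x)))"
      unfolding integral_mult_left_zero cf_eq[OF g] by (simp only: mult_scaleR_right)
    finally show "exp (- (e * s)\<^sup>2 / 2) *\<^sub>R (cf g s * iexp (- (s * x))) = (LINT y|lborel. ?h s y)" ..
  qed
  also have "\<dots> = (LINT y|lborel. LINT s|lborel. ?h s y)"
    using lborel_pair.Fubini_integral[OF P] by simp
  also have "\<dots> = (LINT y|lborel. complex_of_real (2 * pi * (g y * normal_density 0 e (x - y))))"
  proof (intro Bochner_Integration.integral_cong refl)
    fix y :: real
    have "(LINT s|lborel. ?h s y) = g y *\<^sub>R (LINT s|lborel. exp (- (e * s)\<^sup>2 / 2) *\<^sub>R iexp ((y - x) * s))"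
      by (simp flip: integral_scaleR_right add: mult.commute)
    also have "\<dots> = complex_of_real (2 * pi * (g y * normal_density 0 e (x - y)))"
      unfolding normal_ft(1)[OF e]
      by (simp add: normal_density_def scaleR_conv_of_real power2_commute)
    finally show "(LINT s|lborel. ?h s y) = complex_of_real (2 * pi * (g y * normal_density 0 e (x - y)))" .
  qed
  also have "\<dots> = complex_of_real (2 * pi * (LINT y|lborel. g y * normal_density 0 e (x - y)))"
    by (subst integral_complex_of_real) simp
  finally show ?thesis .
qed

lemma reflected_prob_dens:
  assumes "prob_dens f" shows "prob_dens (\<lambda>x. f (- x))"
proof -
  note F = prob_densD[OF assms]
  note [measurable] = F(1)
  show ?thesis
    unfolding prob_dens_def
    using F reflection_integral[of f 0] reflection_integrable[OF F(3), of 0] by auto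
qed

lemma cf_reflected:
  assumes "prob_dens f" shows "cf (\<lambda>x. f (- x)) s = cnj (cf f s)"
proof -
  have "cf (\<lambda>x. f (- x)) s = (LINT x|lborel. f (0 - x) *\<^sub>R iexp (- (s * (0 - x))))"
    unfolding cf_eq[OF reflected_prob_dens[OF assms]] by simp
  also have "\<dots> = (LINT x|lborel. f x *\<^sub>R iexp (- (s * x)))"
    by (rule reflection_integral[of "\<lambda>x. f x *\<^sub>R iexp (- (s * x))"])
  also have "\<dots> = (LINT x|lborel. cnj (f x *\<^sub>R iexp (s * x)))"
    by (simp add: exp_cnj)
  also have "\<dots> = cnj (cf f s)"
    unfolding cf_eq[OF assms] by (rule Bochner_Integration.integral_cnj)
  finally show ?thesis .
qed

text \<open>The squared modulus of \<open>cf f\<close> is the characteristic function of the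
  symmetrised density \<open>conv f (\<lambda>x. f (- x))\<close>, which is again bounded by
  \<open>K\<close>. Its Gaussian-damped integral is 2 pi times a mollification at 0, hence at most 2
  pi K, and Fatou's lemma removes the damping.\<close>

lemma cf_square_integrable:
  assumes f: "prob_dens f" and K: "\<And>x. f x \<le> K"
  shows "integrable lborel (\<lambda>s. (norm (cf f s))\<^sup>2)"
    and "(LINT s|lborel. (norm (cf f s))\<^sup>2) \<le> 2 * pi * K"
proof -
  note [measurable] = cf_measurable[OF f]
  define g where "g = conv f (\<lambda>x. f (- x))"
  have g: "prob_dens g" unfolding g_def by (intro conv_prob_dens f reflected_prob_dens)
  have gK: "g x \<le> K" for x unfolding g_def by (intro conv_bounded f K reflected_prob_dens)
  have K0: "K \<ge> 0" using K[of 0] prob_densD(2)[OF f, of 0] by simp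
  have cg: "cf g s = complex_of_real ((norm (cf f s))\<^sup>2)" for s
    unfolding g_def cf_conv[OF f reflected_prob_dens[OF f]] cf_reflected[OF f]
    by (simp only: complex_norm_square)
  define e :: "nat \<Rightarrow> real" where "e n = 1 / real (Suc n)" for n
  have e: "e n > 0" for n by (simp add: e_def)
  let ?u = "\<lambda>n s. exp (- (e n * s)\<^sup>2 / 2) * (norm (cf f s))\<^sup>2"
  have int: "integrable lborel (?u n)" for n
    using norm_cf_le_1[OF f]
    by (intro Bochner_Integration.integrable_bound[OF normal_ft(2)[OF e[of n]]])
       (auto simp: abs_mult power_le_one)
  have "complex_of_real (LINT s|lborel. ?u n s) =
     complex_of_real (2 * pi * (LINT y|lborel. g y * normal_density 0 (e n) (0 - y)))" for n
  proof -
    have "complex_of_real (LINT s|lborel. ?u n s) = (LINT s|lborel. complex_of_real (?u n s))"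
      by (rule integral_complex_of_real[symmetric])
    also have "\<dots> = (LINT s|lborel. exp (- (e n * s)\<^sup>2 / 2) *\<^sub>R (cf g s * iexp (- (s * 0))))"
      unfolding cg by (simp add: scaleR_conv_of_real)
    finally show ?thesis unfolding gauss_smoothing[OF g e] .
  qed
  then have "(LINT s|lborel. ?u n s) = 2 * pi * (LINT y|lborel. g y * normal_density 0 (e n) (0 - y))" for n
    by (simp only: of_real_eq_iff)
  moreover have "(LINT y|lborel. g y * normal_density 0 (e n) (0 - y)) \<le> K" for n
  proof -
    have "(LINT y|lborel. g y * normal_density 0 (e n) (0 - y)) \<le> (LINT y|lborel. K * normal_density 0 (e n) (0 - y))"
      using prob_densD[OF g] gK K0 reflection_integrable[OF integrable_normal_density[OF e[of n]], of 0 0]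
      by (intro integral_mono' integrable_mult_right) (auto intro!: mult_right_mono)
    also have "\<dots> = K"
      using reflection_integral[of "normal_density 0 (e n)" 0] e[of n] by simp
    finally show ?thesis .
  qed
  ultimately have le: "(LINT s|lborel. ?u n s) \<le> 2 * pi * K" for n by simp
  have "(\<lambda>n. e n) \<longlonglongrightarrow> 0" unfolding e_def by real_asymp
  then have lim: "(\<lambda>n. ?u n s) \<longlonglongrightarrow> exp (- (0 * s)\<^sup>2 / 2) * (norm (cf f s))\<^sup>2" for s
    by (intro tendsto_intros) auto
  have "(\<integral>\<^sup>+s. ennreal ((norm (cf f s))\<^sup>2) \<partial>lborel) = (\<integral>\<^sup>+s. liminf (\<lambda>n. ennreal (?u n s)) \<partial>lborel)"
    using lim by (intro nn_integral_cong lim_imp_Liminf[symmetric]) (auto intro!: tendsto_ennrealI)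
  also have "\<dots> \<le> liminf (\<lambda>n. \<integral>\<^sup>+s. ennreal (?u n s) \<partial>lborel)"
    by (rule nn_integral_liminf) auto
  also have "\<dots> \<le> ennreal (2 * pi * K)"
  proof -
    have "(\<integral>\<^sup>+s. ennreal (?u n s) \<partial>lborel) \<le> ennreal (2 * pi * K)" for n
      using le[of n] by (subst nn_integral_eq_integral[OF int]) (auto intro!: ennreal_leI)
    then show ?thesis by (intro Liminf_le) auto
  qed
  finally have fin: "(\<integral>\<^sup>+s. ennreal ((norm (cf f s))\<^sup>2) \<partial>lborel) \<le> ennreal (2 * pi * K)" .
  then show I: "integrable lborel (\<lambda>s. (norm (cf f s))\<^sup>2)"
    by (intro integrableI_bounded) (auto intro: le_less_trans)
  show "(LINT s|lborel. (norm (cf f s))\<^sup>2) \<le> 2 * pi * K"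
    using fin K0 by (subst (asm) nn_integral_eq_integral[OF I]) auto
qed

lemma density_eqI_intervals:
  fixes M N :: "real measure"
  assumes sets: "sets M = sets borel" "sets N = sets borel"
  assumes fin: "\<And>a b. emeasure M {a<..<b} < \<infinity>"
  assumes eq: "\<And>a b. a < b \<Longrightarrow> emeasure M {a<..<b} = emeasure N {a<..<b}"
  shows "M = N"
proof (rule measure_eqI_generator_eq)
  let ?E = "range (\<lambda>(a, b). box a b :: real set)"
  show "Int_stable ?E"
    by (auto simp: Int_stable_def box_Int_box)
  show "?E \<subseteq> Pow UNIV" "sets M = sigma_sets UNIV ?E" "sets N = sigma_sets UNIV ?E"
    by (simp_all add: borel_eq_box sets)
  let ?A = "\<lambda>n::nat. box (- (real n *\<^sub>R One)) (real n *\<^sub>R One) :: real set"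
  show "range ?A \<subseteq> ?E" "(\<Union>i. ?A i) = UNIV"
    unfolding UN_box_eq_UNIV by auto
  show "emeasure M (?A i) \<noteq> \<infinity>" for i
    using fin[of "- real i" "real i"] by (simp add: less_top)
  show "emeasure M X = emeasure N X" if "X \<in> ?E" for X
  proof -
    obtain a b where X: "X = {a<..<b}" using \<open>X \<in> ?E\<close> by (auto simp: box_real)
    show ?thesis unfolding X by (cases "a < b") (use eq in auto)
  qed
qed

text \<open>As the width of the kernel shrinks, the mollified densities \<open>S n\<close> tend to
  the inversion integral, which is therefore real and nonnegative and can itself be the density of a
  measure. The uniform bound on \<open>S n\<close> is the majorant for the dominated convergence
  over intervals that follows.\<close>

lemma inversion_nonneg:
  assumes F: "prob_dens F" and I: "integrable lborel (cf F)"
  defines "G \<equiv> \<lambda>x. (1 / (2 * pi)) *\<^sub>R (LINT s|lborel. cf F s * iexp (- (s * x)))"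
  defines "S \<equiv> \<lambda>n x. LINT y|lborel. F y * normal_density 0 (1 / real (Suc n)) (x - y)"
  shows "(\<lambda>n. S n x) \<longlonglongrightarrow> Re (G x)" "G x = complex_of_real (Re (G x))" "0 \<le> Re (G x)"
    "0 \<le> S n x" "S n x \<le> (LINT s|lborel. norm (cf F s))"
proof -
  note [measurable] = cf_measurable[OF F]
  define e :: "nat \<Rightarrow> real" where "e n = 1 / real (Suc n)" for n
  have e: "e n > 0" for n by (simp add: e_def)
  define f where "f n x s = exp (- (e n * s)\<^sup>2 / 2) *\<^sub>R (cf F s * iexp (- (s * x)))" for n x s
  have [measurable]: "f n x \<in> borel_measurable borel" for n x unfolding f_def by measurable
  have fle: "norm (f n x s) \<le> norm (cf F s)" for n x s
    by (auto simp: f_def norm_mult intro!: mult_left_le_one_le)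
  have S: "S n x = (LINT y|lborel. F y * normal_density 0 (e n) (x - y))" for n x
    by (simp add: S_def e_def)
  have eq: "complex_of_real (S n x) = (1 / (2 * pi)) *\<^sub>R (LINT s|lborel. f n x s)" for n x
    unfolding S f_def gauss_smoothing[OF F e] by (simp add: scaleR_conv_of_real)
  have "(\<lambda>n. e n) \<longlonglongrightarrow> 0" unfolding e_def by real_asymp
  then have lim: "(\<lambda>n. f n x s) \<longlonglongrightarrow>
      exp (- (0 * s)\<^sup>2 / 2) *\<^sub>R (cf F s * iexp (- (s * x)))" for s
    unfolding f_def by (intro tendsto_intros) auto
  have "(\<lambda>n. LINT s|lborel. f n x s)
     \<longlonglongrightarrow> (LINT s|lborel. cf F s * iexp (- (s * x)))"
    by (rule integral_dominated_convergence[where w="\<lambda>s. norm (cf F s)"]) (use I lim fle in auto)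
  then have cl: "(\<lambda>n. complex_of_real (S n x)) \<longlonglongrightarrow> G x"
    unfolding eq G_def by (intro tendsto_intros)
  from tendsto_Re[OF cl] show 1: "(\<lambda>n. S n x) \<longlonglongrightarrow> Re (G x)" by simp
  from tendsto_of_real[OF 1, where 'a=complex] cl show "G x = complex_of_real (Re (G x))"
    using LIMSEQ_unique by blast
  show S0: "0 \<le> S n x" for n
    unfolding S using prob_densD[OF F] by (intro Bochner_Integration.integral_nonneg) auto
  from 1 show "0 \<le> Re (G x)" by (rule LIMSEQ_le_const) (use S0 in auto)
  have "S n x \<le> norm (complex_of_real (S n x))" by simp
  also have "\<dots> \<le> 1 * norm (LINT s|lborel. f n x s)"
    unfolding eq norm_scaleR using pi_gt3 by (intro mult_right_mono) (auto simp: field_simps)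
  also have "\<dots> \<le> (LINT s|lborel. norm (cf F s))"
    unfolding mult_1 using I
    by (intro Bochner_Integration.integral_norm_bound_integral integrable_norm Bochner_Integration.integrable_bound[OF I])
      (auto simp: fle)
  finally show "S n x \<le> (LINT s|lborel. norm (cf F s))" .
qed

text \<open>The integral of \<open>S n\<close> over an interval has a limit that can be computed in
  two ways: directly, which gives the inversion integral, and after moving the Gaussian translation
  onto the indicator, which gives the integral of \<open>F\<close>. Equal masses on all intervals
  identify the two measures.\<close>

lemma inversion_AE:
  assumes F: "prob_dens F" and I: "integrable lborel (cf F)"
  shows "AE y in lborel. complex_of_real (F y) = (1 / (2 * pi)) *\<^sub>R (LINT s|lborel. cf F s * iexp (- (s * y)))"
proof -
  note D = prob_densD[OF F]
  note [measurable] = cf_measurable[OF F] D(1)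
  define G where "G x = (1 / (2 * pi)) *\<^sub>R (LINT s|lborel. cf F s * iexp (- (s * x)))" for x
  define e :: "nat \<Rightarrow> real" where "e n = 1 / real (Suc n)" for n
  define S where "S n x = (LINT y|lborel. F y * normal_density 0 (e n) (x - y))" for n x
  define C where "C = (LINT s|lborel. norm (cf F s))"
  have e: "e n > 0" for n by (simp add: e_def)
  have elim: "e \<longlonglongrightarrow> 0" unfolding e_def by real_asymp
  note inv = inversion_nonneg[OF F I, folded e_def G_def, folded S_def C_def]
  have [measurable]: "(\<lambda>x. Re (G x)) \<in> borel_measurable borel" unfolding G_def by measurable
  have [measurable]: "S n \<in> borel_measurable borel" for n unfolding S_def by measurable
  \<comment> \<open>Substituting x - y = e n z moves the width out of the kernel and into the
    argument of \<open>F\<close>.\<close>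
  have S2: "S n x = (LINT z|lborel. F (x - e n * z) * std_normal_density z)" for n x
  proof -
    have "S n x = e n * (LINT z|lborel. F (x - e n * z) * normal_density 0 (e n) (e n * z))"
      unfolding S_def using e[of n] by (subst lborel_integral_real_affine[of "- e n" _ x]) auto
    also have "\<dots> = (LINT z|lborel. e n * (F (x - e n * z) * normal_density 0 (e n) (e n * z)))" by simp
    also have "\<dots> = (LINT z|lborel. F (x - e n * z) * std_normal_density z)"
      using e[of n] by (intro Bochner_Integration.integral_cong refl)
        (simp add: normal_density_def real_sqrt_mult field_simps power_mult_distrib)
    finally show ?thesis .
  qed
  have interval: "emeasure (density lborel (\<lambda>x. ennreal (F x))) {a<..<b} = emeasure (density lborel (\<lambda>x. ennreal (Re (G x)))) {a<..<b}" if "a < b" for a b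
  proof -
    let ?i = "indicator {a<..<b} :: real \<Rightarrow> real"
    have intI: "integrable lborel (\<lambda>x. ?i x * c)" for c :: real
      using that by (intro integrable_mult_left integrable_real_indicator) auto
    have limG: "(\<lambda>n. LINT x|lborel. ?i x * S n x) \<longlonglongrightarrow> (LINT x|lborel. ?i x * Re (G x))"
    proof (rule integral_dominated_convergence[where w="\<lambda>x. ?i x * C"])
      show "AE x in lborel. norm (?i x * S n x) \<le> ?i x * C" for n
        using inv(4,5)[of n] by (auto simp: abs_mult intro!: mult_left_mono)
    qed (use inv(1) intI[of 1] in \<open>auto intro!: tendsto_intros\<close>)
    have intF: "integrable lborel (\<lambda>x. ?i (x + c) * F x)" for c
      by (rule Bochner_Integration.integrable_bound[OF D(3)]) (auto simp: indicator_def)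
    let ?J = "\<lambda>n z. LINT x|lborel. ?i (x + e n * z) * F x"
    have "(LINT x|lborel. ?i x * S n x) = (LINT z|lborel. std_normal_density z * ?J n z)" for n
    proof -
      have P0: "integrable (lborel \<Otimes>\<^sub>M lborel) (\<lambda>(z, x). F (x - e n * z) * std_normal_density z)"
      proof (rule lborel_pair.Fubini_integrable)
        have "(LINT x|lborel. norm (F (x - e n * z) * std_normal_density z)) = std_normal_density z" for z
          using D translation_integral[of F "e n * z"] by (simp add: abs_mult)
        then show "integrable lborel (\<lambda>z. LINT x|lborel. norm (case (z, x) of (z, x) \<Rightarrow> F (x - e n * z) * std_normal_density z))"
          by simp
      qed (use translation_integrable[OF D(3)] in auto)
      have P: "integrable (lborel \<Otimes>\<^sub>M lborel) (\<lambda>(z, x). ?i x * (F (x - e n * z) * std_normal_density z))"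
        by (rule Bochner_Integration.integrable_bound[OF P0]) (auto simp: indicator_def)
      have "(LINT x|lborel. ?i x * S n x) = (LINT x|lborel. LINT z|lborel. ?i x * (F (x - e n * z) * std_normal_density z))"
        unfolding S2 by simp
      also have "\<dots> = (LINT z|lborel. LINT x|lborel. ?i x * (F (x - e n * z) * std_normal_density z))"
        using lborel_pair.Fubini_integral[OF P] by simp
      also have "\<dots> = (LINT z|lborel. std_normal_density z * ?J n z)"
      proof (intro Bochner_Integration.integral_cong refl)
        fix z
        have "(LINT x|lborel. ?i x * (F (x - e n * z) * std_normal_density z)) =
           (LINT x|lborel. std_normal_density z * (?i ((x - e n * z) + e n * z) * F (x - e n * z)))"
          by (simp add: mult_ac)
        also have "\<dots> = std_normal_density z * ?J n z"
          unfolding integral_mult_right_zero translation_integral[of "\<lambda>x. ?i (x + e n * z) * F x"] ..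
        finally show "(LINT x|lborel. ?i x * (F (x - e n * z) * std_normal_density z)) = std_normal_density z * ?J n z" .
      qed
      finally show ?thesis .
    qed
    moreover have "(\<lambda>n. LINT z|lborel. std_normal_density z * ?J n z) \<longlonglongrightarrow> (LINT z|lborel. std_normal_density z * (LINT x|lborel. ?i x * F x))"
    proof (rule integral_dominated_convergence[where w="std_normal_density"])
      have "?J n z \<le> 1 \<and> 0 \<le> ?J n z" for n z
        using integral_mono'[of lborel F "\<lambda>x. ?i (x + e n * z) * F x"] D
        by (auto simp: indicator_def)
      then show "AE z in lborel. norm (std_normal_density z * ?J n z) \<le> std_normal_density z" for n
        by (auto simp: abs_mult intro!: mult_left_le)
      have "(\<lambda>n. ?J n z) \<longlonglongrightarrow> (LINT x|lborel. ?i x * F x)" for z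
      proof (rule integral_dominated_convergence[where w=F])
        show "AE x in lborel. norm (?i (x + e n * z) * F x) \<le> F x" for n
          using D(2) by (auto simp: indicator_def)
        \<comment> \<open>The indicator is locally constant except at the two end points, which form
          a null set.\<close>
        have cv: "(\<lambda>n. ?i (x + e n * z) * F x) \<longlonglongrightarrow> ?i x * F x" if "x \<noteq> a" "x \<noteq> b" for x
        proof -
          have l: "(\<lambda>n. x + e n * z) \<longlonglongrightarrow> x + 0 * z" by (intro tendsto_intros elim)
          have "\<forall>\<^sub>F n in sequentially. ?i (x + e n * z) = ?i x"
          proof (cases "x \<in> {a<..<b}")
            case True
            then have "\<forall>\<^sub>F n in sequentially. x + e n * z \<in> {a<..<b}"
              using l by (intro topological_tendstoD[OF l]) auto
            then show ?thesis by eventually_elim (use True in auto)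
          next
            case False
            then have "\<forall>\<^sub>F n in sequentially. x + e n * z \<in> - {a..b}"
              using l that by (intro topological_tendstoD[OF l]) auto
            then show ?thesis by eventually_elim (use False in auto)
          qed
          then show ?thesis by (intro tendsto_eventually) (auto elim: eventually_mono)
        qed
        show "AE x in lborel. (\<lambda>n. ?i (x + e n * z) * F x) \<longlonglongrightarrow> ?i x * F x"
          using AE_lborel_singleton[of a] AE_lborel_singleton[of b] by eventually_elim (rule cv)
      qed (use D in auto)
      then show "AE z in lborel. (\<lambda>n. std_normal_density z * ?J n z) \<longlonglongrightarrow> std_normal_density z * (LINT x|lborel. ?i x * F x)"
        by (auto intro!: tendsto_intros)
    qed auto
    ultimately have "(\<lambda>n. LINT x|lborel. ?i x * S n x) \<longlonglongrightarrow> (LINT x|lborel. ?i x * F x)" by simp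
    then have eq: "(LINT x|lborel. ?i x * F x) = (LINT x|lborel. ?i x * Re (G x))"
      using limG LIMSEQ_unique by blast
    have GC: "Re (G x) \<le> C" for x by (rule LIMSEQ_le_const2[OF inv(1)]) (use inv(5) in auto)
    have intG: "integrable lborel (\<lambda>x. ?i x * Re (G x))"
      using inv(3) by (intro Bochner_Integration.integrable_bound[OF intI[of C]])
        (auto simp: indicator_def intro!: AE_I2 order_trans[OF GC abs_ge_self])
    have "emeasure (density lborel (\<lambda>x. ennreal (F x))) {a<..<b} = (\<integral>\<^sup>+x. ennreal (?i x * F x) \<partial>lborel)"
      by (subst emeasure_density) (auto simp: indicator_def intro!: nn_integral_cong)
    also have "\<dots> = (\<integral>\<^sup>+x. ennreal (?i x * Re (G x)) \<partial>lborel)"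
      using intF[of 0] intG D(2) inv(3) eq by (subst (1 2) nn_integral_eq_integral) auto
    also have "\<dots> = emeasure (density lborel (\<lambda>x. ennreal (Re (G x)))) {a<..<b}"
      by (subst emeasure_density) (auto simp: indicator_def intro!: nn_integral_cong)
    finally show ?thesis .
  qed
  interpret M: real_distribution "density lborel (\<lambda>x. ennreal (F x))"
    by (rule real_distribution_prob_dens[OF F])
  have "density lborel (\<lambda>x. ennreal (F x)) = density lborel (\<lambda>x. ennreal (Re (G x)))"
  proof (rule density_eqI_intervals)
    show "emeasure (density lborel (\<lambda>x. ennreal (F x))) {a<..<b} < \<infinity>" for a b
      using M.emeasure_finite[of "{a<..<b}"] by (simp add: less_top[symmetric])
  qed (use interval in auto)
  then have "AE x in lborel. ennreal (F x) = ennreal (Re (G x))"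
    by (subst (asm) sigma_finite_measure.density_unique_iff[OF sigma_finite_lborel]) auto
  then show ?thesis
    unfolding G_def[symmetric] by eventually_elim (use D(2) inv(2,3) in \<open>metis ennreal_inj\<close>)
qed

lemma cf_power_integrable:
  assumes f: "prob_dens f" "\<And>x. f x \<le> K" and j: "j \<ge> 2"
  shows "integrable lborel (\<lambda>s. cf f s ^ j)"
proof -
  note [measurable] = cf_measurable[OF f(1)]
  have "norm (cf f s) ^ j \<le> norm (cf f s) ^ 2" for s
    using norm_cf_le_1[OF f(1)] j by (intro power_decreasing) auto
  then show ?thesis
    by (intro Bochner_Integration.integrable_bound[OF cf_square_integrable(1)[OF f]]) (auto simp: norm_power)
qed

text \<open>Inversion only identifies a density almost everywhere; one further convolution turns this
  into an identity at every point.\<close>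

lemma conv_power_inversion:
  assumes f: "prob_dens f" "\<And>x. f x \<le> K" and j: "j \<ge> 3"
  shows "complex_of_real (conv_power f j x) = (1 / (2 * pi)) *\<^sub>R (LINT s|lborel. cf f s ^ j * iexp (- (s * x)))"
proof -
  obtain i where i: "j = Suc i" "i \<ge> 2" using j by (cases j) auto
  let ?F = "conv_power f i"
  note D = prob_densD[OF f(1)]
  have F: "prob_dens ?F" and cF: "cf ?F = (\<lambda>s. cf f s ^ i)"
    using i by (auto intro!: conv_power_prob_dens f cf_conv_power)
  note I = cf_power_integrable[OF f i(2)]
  note [measurable] = cf_measurable[OF f(1)] D(1) prob_densD(1)[OF F]
  have AE: "AE y in lborel. complex_of_real (?F y) = (1 / (2 * pi)) *\<^sub>R (LINT s|lborel. cf f s ^ i * iexp (- (s * y)))"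
    using inversion_AE[OF F] I unfolding cF by simp
  let ?h = "\<lambda>s y. f (x - y) *\<^sub>R (cf f s ^ i * iexp (- (s * y)))"
  have P0: "integrable (lborel \<Otimes>\<^sub>M lborel) (\<lambda>(s, y). f (x - y) * norm (cf f s ^ i))"
    by (rule lborel_pair.Fubini_integrable)
      (use D I reflection_integrable[OF D(3), of x] in \<open>auto simp: abs_mult\<close>)
  have P: "integrable (lborel \<Otimes>\<^sub>M lborel) (\<lambda>(s, y). ?h s y)"
    by (rule Bochner_Integration.integrable_bound[OF P0]) (auto simp: norm_mult)
  have "complex_of_real (conv_power f j x) = (LINT y|lborel. complex_of_real (f (x - y) * ?F y))"
    using i by (simp add: conv_power_Suc conv_def del: of_real_mult)
  also have "\<dots> = (LINT y|lborel. (1 / (2 * pi)) *\<^sub>R (LINT s|lborel. ?h s y))"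
  proof (rule integral_cong_AE)
    show "AE y in lborel. complex_of_real (f (x - y) * ?F y) = (1 / (2 * pi)) *\<^sub>R (LINT s|lborel. ?h s y)"
      using AE by eventually_elim (simp add: scaleR_conv_of_real)
  qed auto
  also have "\<dots> = (1 / (2 * pi)) *\<^sub>R (LINT y|lborel. LINT s|lborel. ?h s y)"
    by (rule integral_scaleR_right)
  also have "(LINT y|lborel. LINT s|lborel. ?h s y) = (LINT s|lborel. LINT y|lborel. ?h s y)"
    using lborel_pair.Fubini_integral[OF P] by simp
  also have "\<dots> = (LINT s|lborel. cf f s ^ j * iexp (- (s * x)))"
  proof (intro Bochner_Integration.integral_cong refl)
    fix s :: real
    have "(LINT y|lborel. ?h s y) = (LINT y|lborel. (cf f s ^ i * iexp (- (s * x))) * (f (x - y) *\<^sub>R iexp (s * (x - y))))"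
      by (intro Bochner_Integration.integral_cong refl)
        (simp add: scaleR_conv_of_real algebra_simps flip: exp_add)
    also have "\<dots> = (cf f s ^ i * iexp (- (s * x))) * cf f s"
      unfolding integral_mult_right_zero cf_eq[OF f(1)] reflection_integral[of "\<lambda>y. f y *\<^sub>R iexp (s * y)"] ..
    finally show "(LINT y|lborel. ?h s y) = cf f s ^ j * iexp (- (s * x))"
      by (simp add: i(1))
  qed
  finally show ?thesis .
qed

section \<open>A uniform local limit ratio\<close>

lemma integrable_dominated:
  fixes f g :: "'a \<Rightarrow> real"
  assumes "integrable M g" "f \<in> borel_measurable M" "\<And>x. 0 \<le> f x" "\<And>x. f x \<le> g x"
  shows "integrable M f"
proof (rule Bochner_Integration.integrable_bound[OF assms(1,2)], rule AE_I2)
  fix x show "norm (f x) \<le> norm (g x)" using assms(3,4)[of x] by simp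
qed

text \<open>Raise x / j <= exp (x / j) to the power j; for j = 0 the constant is 0 ^ 0 = 1.\<close>

lemma power_le_exp: "x ^ j \<le> real j ^ j * exp x" if "x \<ge> 0" for x :: real
proof (cases "j = 0")
  case False
  have "x ^ j = real j ^ j * (x / real j) ^ j" using False by (simp add: power_divide)
  also have "\<dots> \<le> real j ^ j * exp (x / real j) ^ j"
    using that exp_ge_add_one_self[of "x / real j"] by (intro mult_left_mono power_mono) (linarith | simp)+
  also have "exp (x / real j) ^ j = exp x" using False by (simp flip: exp_of_nat_mult)
  finally show ?thesis .
qed (use that in auto)

text \<open>Half of the rate absorbs the power by \<open>power_le_exp\<close>; what remains lies
  below a multiple of an exponential density plus its mirror image.\<close>

lemma integrable_exp_abs:
  assumes k: "\<kappa> > (0::real)"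
  shows "integrable lborel (\<lambda>z. \<bar>z\<bar> ^ j * exp (- \<kappa> * \<bar>z\<bar>))"
proof -
  have I: "integrable lborel (exponential_density (\<kappa>/2))"
  proof -
    interpret prob_space "density lborel (exponential_density (\<kappa>/2))"
      using k by (intro prob_space_exponential_density) auto
    have "(\<integral>\<^sup>+x. ennreal (exponential_density (\<kappa>/2) x) \<partial>lborel) = 1"
      using emeasure_space_1 by (simp add: emeasure_density)
    then show ?thesis
      using k by (intro integrableI_bounded) (auto simp: exponential_density_nonneg)
  qed
  define c where "c = real j ^ j * (2/\<kappa>) ^ j"
  define B where "B z = c * ((2/\<kappa>) * (exponential_density (\<kappa>/2) z + exponential_density (\<kappa>/2) (0 - z)))" for z
  have c: "c \<ge> 0" using k by (simp add: c_def)
  have le: "\<bar>z\<bar> ^ j * exp (- \<kappa> * \<bar>z\<bar>) \<le> B z" for z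
  proof -
    have "\<bar>z\<bar> ^ j = (2/\<kappa>) ^ j * (\<kappa>/2 * \<bar>z\<bar>) ^ j" using k by (simp add: power_divide power_mult_distrib)
    also have "\<dots> \<le> (2/\<kappa>) ^ j * (real j ^ j * exp (\<kappa>/2 * \<bar>z\<bar>))"
      using k by (intro mult_left_mono power_le_exp) auto
    finally have "\<bar>z\<bar> ^ j * exp (- \<kappa> * \<bar>z\<bar>) \<le> c * exp (\<kappa>/2 * \<bar>z\<bar>) * exp (- \<kappa> * \<bar>z\<bar>)"
      unfolding c_def by (intro mult_right_mono) (auto simp: mult_ac)
    also have "\<dots> = c * exp (- (\<kappa>/2) * \<bar>z\<bar>)"
      by (simp flip: exp_add)
    also have "\<dots> \<le> B z" unfolding B_def
      using k c by (intro mult_left_mono) (auto simp: exponential_density_def field_simps)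
    finally show ?thesis .
  qed
  have "integrable lborel B"
    unfolding B_def by (intro integrable_mult_right Bochner_Integration.integrable_add I reflection_integrable[OF I])
  then show ?thesis by (rule integrable_dominated[OF _ _ _ le]) auto
qed

definition exp_moment :: "real \<Rightarrow> real \<Rightarrow> nat \<Rightarrow> real" where
  "exp_moment A \<kappa> j = A * (LINT z|lborel. \<bar>z\<bar> ^ j * exp (- \<kappa> * \<bar>z\<bar>))"

text \<open>The class is described by two constants only, so that anything derived from membership
  is uniform in \<open>f\<close>.\<close>

definition exp_dens :: "real \<Rightarrow> real \<Rightarrow> (real \<Rightarrow> real) \<Rightarrow> bool" where
  "exp_dens A \<kappa> f \<longleftrightarrow> prob_dens f \<and> (\<forall>z. f z \<le> A * exp (- \<kappa> * \<bar>z\<bar>))"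

lemma exp_dens_moment:
  assumes "exp_dens A \<kappa> f" "\<kappa> > 0"
  shows "integrable lborel (\<lambda>z. \<bar>z\<bar> ^ j * f z)" "(LINT z|lborel. \<bar>z\<bar> ^ j * f z) \<le> exp_moment A \<kappa> j"
    "integrable lborel (\<lambda>z. z ^ j * f z)"
proof -
  have f: "prob_dens f" and le: "f z \<le> A * exp (- \<kappa> * \<bar>z\<bar>)" for z using assms by (auto simp: exp_dens_def)
  note D = prob_densD[OF f]
  note [measurable] = D(1)
  have I: "integrable lborel (\<lambda>z. A * (\<bar>z\<bar> ^ j * exp (- \<kappa> * \<bar>z\<bar>)))"
    using integrable_exp_abs[OF assms(2)] by simp
  have le2: "\<bar>z\<bar> ^ j * f z \<le> A * (\<bar>z\<bar> ^ j * exp (- \<kappa> * \<bar>z\<bar>))" for z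
    using mult_left_mono[OF le[of z], of "\<bar>z\<bar> ^ j"] by (simp add: mult_ac)
  show 1: "integrable lborel (\<lambda>z. \<bar>z\<bar> ^ j * f z)"
    by (rule integrable_dominated[OF I _ _ le2]) (use D(2) in auto)
  then show "integrable lborel (\<lambda>z. z ^ j * f z)"
    by (rule Bochner_Integration.integrable_bound) (auto simp: abs_mult power_abs)
  show "(LINT z|lborel. \<bar>z\<bar> ^ j * f z) \<le> exp_moment A \<kappa> j"
    unfolding exp_moment_def integral_mult_right_zero[symmetric]
    by (intro integral_mono 1 I le2)
qed

text \<open>A density bounded by \<open>A\<close> puts mass at most 2 r A = 1/2 into a window of
  radius r = 1 / (4 A). The other half of the mass has distance at least r from \<open>c\<close> and
  contributes r^2 / 2 = 1 / (32 A^2).\<close>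

lemma bounded_dens_variance:
  assumes f: "prob_dens f" and A: "\<And>x. f x \<le> A" "A > 0" and I: "integrable lborel (\<lambda>z. (z - c)\<^sup>2 * f z)"
  shows "(LINT z|lborel. (z - c)\<^sup>2 * f z) \<ge> 1 / (32 * A\<^sup>2)"
proof -
  note D = prob_densD[OF f]
  define r where "r = 1 / (4 * A)"
  have r: "r > 0" using A by (simp add: r_def)
  let ?i = "indicator {c-r..c+r} :: real \<Rightarrow> real"
  have Ii: "integrable lborel (\<lambda>z. r\<^sup>2 * A * ?i z)"
    using r by (intro integrable_mult_right integrable_real_indicator) auto
  have "r\<^sup>2 * f z - r\<^sup>2 * A * ?i z \<le> (z - c)\<^sup>2 * f z" for z
  proof (cases "z \<in> {c-r..c+r}")
    case True
    then have "r\<^sup>2 * f z - r\<^sup>2 * A * ?i z \<le> 0" using A(1)[of z] by (auto intro!: mult_left_mono)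
    moreover have "0 \<le> (z - c)\<^sup>2 * f z" using D(2)[of z] by simp
    ultimately show ?thesis by linarith
  next
    case False
    then have "\<bar>r\<bar> \<le> \<bar>z - c\<bar>" using r by auto
    then have "r\<^sup>2 \<le> (z - c)\<^sup>2" by (rule abs_le_square_iff[THEN iffD1])
    then show ?thesis using False D(2)[of z] by (auto intro!: mult_right_mono)
  qed
  then have "(LINT z|lborel. r\<^sup>2 * f z - r\<^sup>2 * A * ?i z) \<le> (LINT z|lborel. (z - c)\<^sup>2 * f z)"
    by (intro integral_mono I Bochner_Integration.integrable_diff Ii integrable_mult_right D(3))
  moreover have "(LINT z|lborel. r\<^sup>2 * f z - r\<^sup>2 * A * ?i z) = r\<^sup>2 * 1 - r\<^sup>2 * A * (2 * r)"
    using D(3,4) Ii r by (subst Bochner_Integration.integral_diff) auto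
  moreover have "r\<^sup>2 * 1 - r\<^sup>2 * A * (2 * r) = 1 / (32 * A\<^sup>2)"
    using A by (simp add: r_def field_simps power2_eq_square)
  ultimately show ?thesis by simp
qed

section \<open>Uniform bounds for characteristic functions near and away from the origin\<close>

lemma cf_lipschitz:
  assumes f: "prob_dens f" and I: "integrable lborel (\<lambda>x. \<bar>x\<bar> * f x)"
  shows "norm (cf f s - cf f u) \<le> \<bar>s - u\<bar> * (LINT x|lborel. \<bar>x\<bar> * f x)"
proof -
  note D = prob_densD[OF f]
  note [measurable] = D(1)
  have nm: "norm (iexp (s * x) - iexp (u * x)) \<le> \<bar>s - u\<bar> * \<bar>x\<bar>" for x
  proof -
    have "iexp (s * x) - iexp (u * x) = iexp (u * x) * (iexp ((s - u) * x) - 1)"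
      by (simp add: algebra_simps flip: exp_add)
    then have "norm (iexp (s * x) - iexp (u * x)) = norm (iexp ((s - u) * x) - 1)"
      by (simp only: norm_mult norm_exp_i_times mult_1)
    also have "\<dots> \<le> \<bar>(s - u) * x\<bar>" using iexp_approx1[of "(s - u) * x" 0] by simp
    finally show ?thesis by (simp add: abs_mult)
  qed
  have *: "norm (f x *\<^sub>R iexp (s * x) - f x *\<^sub>R iexp (u * x)) \<le> \<bar>s - u\<bar> * (\<bar>x\<bar> * f x)" for x
    using mult_left_mono[OF nm[of x] D(2)[of x]] D(2)[of x]
    unfolding scaleR_diff_right[symmetric] norm_scaleR by (simp only: mult_ac abs_of_nonneg)
  have "norm (cf f s - cf f u) = norm (LINT x|lborel. f x *\<^sub>R iexp (s * x) - f x *\<^sub>R iexp (u * x))"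
    unfolding cf_eq[OF f] by (subst Bochner_Integration.integral_diff[OF integrable_cf_integrand[OF f] integrable_cf_integrand[OF f]]) (rule refl)
  also have "\<dots> \<le> (LINT x|lborel. \<bar>s - u\<bar> * (\<bar>x\<bar> * f x))"
    by (intro Bochner_Integration.integral_norm_bound_integral Bochner_Integration.integrable_diff integrable_cf_integrand[OF f] integrable_mult_right I *)
  finally show ?thesis by simp
qed

text \<open>With \<open>g\<close> the symmetrised density, 1 minus the squared modulus is the
  integral of g x (1 - cos (s x)), and 1 - cos (2 z) = 2 (1 - cos z) (1 + cos z) <= 4 (1 - cos z).
  Doubling the argument thus costs a factor 4.\<close>

lemma cf_doubling:
  assumes f: "prob_dens f"
  shows "1 - (norm (cf f (2 ^ i * s)))\<^sup>2 \<le> 4 ^ i * (1 - (norm (cf f s))\<^sup>2)"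
proof -
  define g where "g = conv f (\<lambda>x. f (- x))"
  have g: "prob_dens g" unfolding g_def by (intro conv_prob_dens f reflected_prob_dens)
  note D = prob_densD[OF g]
  note [measurable] = D(1)
  have cg: "complex_of_real ((norm (cf f s))\<^sup>2) = cf g s" for s
    unfolding g_def cf_conv[OF f reflected_prob_dens[OF f]] cf_reflected[OF f]
    by (simp only: complex_norm_square)
  have int: "integrable lborel (\<lambda>x. g x * cos (s * x))" for s
    by (rule Bochner_Integration.integrable_bound[OF D(3)]) (use D(2) in \<open>auto simp: abs_mult intro!: mult_left_le\<close>)
  have eq: "1 - (norm (cf f s))\<^sup>2 = (LINT x|lborel. g x * (1 - cos (s * x)))" for s
  proof -
    have "(norm (cf f s))\<^sup>2 = Re (complex_of_real ((norm (cf f s))\<^sup>2))" by simp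
    also have "\<dots> = (LINT x|lborel. g x * cos (s * x))"
      unfolding cg cf_eq[OF g]
      by (subst integral_Re[symmetric]) (rule integrable_cf_integrand[OF g], auto intro!: Bochner_Integration.integral_cong simp: Re_exp)
    finally show ?thesis using D int[of s] by (simp add: right_diff_distrib)
  qed
  have dbl: "1 - (norm (cf f (2 * s)))\<^sup>2 \<le> 4 * (1 - (norm (cf f s))\<^sup>2)" for s
    unfolding eq integral_mult_right_zero[symmetric]
  proof (intro integral_mono)
    fix x
    have "1 - cos (2 * (s * x)) = 2 * (1 - cos (s * x)) * (1 + cos (s * x))"
      unfolding cos_double_cos by (simp add: algebra_simps power2_eq_square)
    also have "\<dots> \<le> 2 * (1 - cos (s * x)) * 2"
      by (intro mult_left_mono) (auto simp: cos_le_one)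
    finally have "g x * (1 - cos (2 * (s * x))) \<le> g x * (4 * (1 - cos (s * x)))"
      using D(2)[of x] by (intro mult_left_mono) auto
    then show "g x * (1 - cos (2 * s * x)) \<le> 4 * (g x * (1 - cos (s * x)))" by (simp add: mult_ac)
  qed (use D int in \<open>auto simp: right_diff_distrib\<close>)
  show ?thesis
  proof (induction i)
    case (Suc i)
    have "1 - (norm (cf f (2 ^ Suc i * s)))\<^sup>2 \<le> 4 * (1 - (norm (cf f (2 ^ i * s)))\<^sup>2)"
      using dbl[of "2 ^ i * s"] by (simp add: mult_ac)
    with Suc show ?case by simp
  qed simp
qed

text \<open>If the modulus were close to 1 at s, it would by doubling stay close to 1 at
  many points 2^i s and, by the Lipschitz bound, on disjoint intervals of a fixed length around them;
  this contradicts the square integral bound.\<close>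

lemma cf_away_from_zero:
  fixes K m \<delta> :: real
  assumes K: "K > 0" and m: "m \<ge> 0" and \<delta>: "\<delta> > 0"
  obtains \<rho> where "0 < \<rho>" "\<rho> < 1"
    "\<And>f s. prob_dens f \<Longrightarrow> (\<And>x. f x \<le> K) \<Longrightarrow> integrable lborel (\<lambda>x. \<bar>x\<bar> * f x) \<Longrightarrow>
       (LINT x|lborel. \<bar>x\<bar> * f x) \<le> m \<Longrightarrow> \<bar>s\<bar> \<ge> \<delta> \<Longrightarrow> norm (cf f s) \<le> \<rho>"
proof -
  \<comment> \<open>The first bound keeps intervals of radius r around the points 2^i s disjoint,
    the second lets the modulus vary by at most 1/8 within one of them.\<close>
  define r where "r = min (\<delta> / 2) (1 / (8 * (m + 1)))"
  have r: "r > 0" "2 * r \<le> \<delta>" using m \<delta> by (auto simp: r_def)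
  have "r * m \<le> 1 / (8 * (m + 1)) * m" using m by (intro mult_right_mono) (auto simp: r_def)
  also have "\<dots> \<le> 1/8" using m by (simp add: field_simps)
  finally have rm: "r * m \<le> 1/8" .
  \<comment> \<open>J disjoint intervals of length 2 r on which the squared modulus is at least 1/2
    contribute J r, which exceeds the square integral bound 2 pi K.\<close>
  obtain J :: nat where J: "2 * pi * K / r < real J" using reals_Archimedean2 by blast
  \<comment> \<open>Some i < J has squared modulus below 3/4 at 2^i s; at most J doublings turn the
    gap 1/4 there into a gap 1 / (4 * 4^J) at s.\<close>
  define \<rho> where "\<rho> = sqrt (1 - 1 / (4 * 4 ^ J))"
  have "(1::real) \<le> 4 ^ J" by simp
  then have "(1::real) < 4 * 4 ^ J" by linarith
  then have \<rho>: "0 < \<rho>" "\<rho> < 1" by (auto simp: \<rho>_def field_simps real_less_lsqrt)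
  show thesis
  proof (rule that[OF \<rho>])
    fix f and s :: real
    assume f: "prob_dens f" and fK: "\<And>x. f x \<le> K" and I: "integrable lborel (\<lambda>x. \<bar>x\<bar> * f x)"
      and fm: "(LINT x|lborel. \<bar>x\<bar> * f x) \<le> m" and s: "\<bar>s\<bar> \<ge> \<delta>"
    let ?G = "\<lambda>s. (norm (cf f s))\<^sup>2"
    have "\<exists>i<J. ?G (2 ^ i * s) < 3/4"
    proof (rule ccontr)
      assume "\<not> ?thesis"
      then have ge: "?G (2 ^ i * s) \<ge> 3/4" if "i < J" for i using that by (meson not_le)
      let ?I = "\<lambda>i::nat. {2 ^ i * s - r<..<2 ^ i * s + r}"
      have sep: "\<bar>2 ^ i * s - 2 ^ j * s\<bar> \<ge> 2 * r" if "i < j" for i j :: nat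
      proof -
        have "(2::real) ^ Suc i \<le> 2 ^ j" using that by (intro power_increasing) auto
        moreover have "(1::real) \<le> 2 ^ i" by simp
        ultimately have "(2::real) ^ j - 2 ^ i \<ge> 1" unfolding power_Suc by linarith
        then have "1 * \<bar>s\<bar> \<le> \<bar>2 ^ j - 2 ^ i\<bar> * \<bar>s\<bar>" by (intro mult_right_mono) auto
        then show ?thesis using s r by (simp add: algebra_simps flip: abs_mult)
      qed
      have "?I i \<inter> ?I j = {}" if "i < j" for i j :: nat
        using sep[OF that] by auto
      then have disj: "disjoint_family_on ?I {..<J}"
        unfolding disjoint_family_on_def by (metis Int_commute linorder_neqE_nat)
      \<comment> \<open>By disjointness the sum of indicators is at most 1. On an interval the
        squared modulus drops by at most 1/8 times a sum of two moduli, so from 3/4 to no less than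
        1/2.\<close>
      have pt: "(1/2) * (\<Sum>i<J. indicator (?I i) u) \<le> ?G u" for u
      proof (cases "\<exists>i<J. u \<in> ?I i")
        case True
        then obtain i where i: "i < J" "u \<in> ?I i" by blast
        have "\<bar>norm (cf f (2 ^ i * s)) - norm (cf f u)\<bar> \<le> norm (cf f (2 ^ i * s) - cf f u)"
          by (rule norm_triangle_ineq3)
        also have "\<dots> \<le> \<bar>2 ^ i * s - u\<bar> * (LINT x|lborel. \<bar>x\<bar> * f x)"
          by (rule cf_lipschitz[OF f I])
        also have "\<dots> \<le> r * m" using i fm r by (intro mult_mono) (auto intro!: Bochner_Integration.integral_nonneg simp: prob_densD(2)[OF f])
        finally have d: "norm (cf f (2 ^ i * s)) - 1/8 \<le> norm (cf f u)" using rm by simp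
        have "?G (2 ^ i * s) - ?G u = (norm (cf f (2 ^ i * s)) - norm (cf f u)) * (norm (cf f (2 ^ i * s)) + norm (cf f u))"
          by (simp add: power2_eq_square algebra_simps)
        also have "\<dots> \<le> (1/8) * (norm (cf f (2 ^ i * s)) + norm (cf f u))"
          using d by (intro mult_right_mono) auto
        also have "\<dots> \<le> 1/4" using norm_cf_le_1[OF f, of "2 ^ i * s"] norm_cf_le_1[OF f, of u] by simp
        finally have "?G u \<ge> 1/2" using ge[OF i(1)] by simp
        then show ?thesis
          by (subst indicator_UN_disjoint[OF _ disj, symmetric]) (auto simp: indicator_def)
      next
        case False
        then have "(\<Sum>i<J. indicator (?I i) u :: real) = 0" by (intro sum.neutral) auto
        then show ?thesis by simp
      qed
      have "(1/2) * (\<Sum>i<J. 2 * r) = (LINT u|lborel. (1/2) * (\<Sum>i<J. indicator (?I i) u))"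
        using r by (simp add: integral_sum)
      also have "\<dots> \<le> (LINT u|lborel. ?G u)"
        by (intro integral_mono pt cf_square_integrable(1)[OF f fK] integrable_mult_right Bochner_Integration.integrable_sum integrable_real_indicator) (use r in auto)
      also have "\<dots> \<le> 2 * pi * K" by (rule cf_square_integrable(2)[OF f fK])
      finally show False using J r by (simp add: field_simps)
    qed
    then obtain i where i: "i < J" "?G (2 ^ i * s) < 3/4" by blast
    have "1/4 \<le> 1 - ?G (2 ^ i * s)" using i by simp
    also have "\<dots> \<le> 4 ^ i * (1 - ?G s)" by (rule cf_doubling[OF f])
    also have "\<dots> \<le> 4 ^ J * (1 - ?G s)"
      using i norm_cf_le_1[OF f, of s] by (intro mult_right_mono power_increasing) (auto simp: power_le_one)
    finally have "?G s \<le> 1 - 1 / (4 * 4 ^ J)" by (simp add: field_simps)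
    then show "norm (cf f s) \<le> \<rho>" unfolding \<rho>_def by (rule real_le_rsqrt)
  qed
qed

lemma prob_dens_expectation:
  fixes h :: "real \<Rightarrow> real"
  assumes f: "prob_dens f" and [measurable]: "h \<in> borel_measurable borel"
  shows "integral\<^sup>L (density lborel (\<lambda>x. ennreal (f x))) h = (LINT x|lborel. h x * f x)"
    and "integrable (density lborel (\<lambda>x. ennreal (f x))) h \<longleftrightarrow> integrable lborel (\<lambda>x. h x * f x)"
  using prob_densD[OF f] by (auto simp: integral_density integrable_density mult.commute)

text \<open>What the Fourier estimates need from a density. The constants \<open>K\<close>,
  \<open>b\<close>, \<open>C\<close>, \<open>\<delta>\<close> and \<open>\<rho>\<close> will be
  common to a whole class of densities; only \<open>v\<close>, the variance in the application,
  belongs to \<open>f\<close> itself.\<close>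

definition cf_control :: "real \<Rightarrow> real \<Rightarrow> real \<Rightarrow> real \<Rightarrow> real \<Rightarrow> (real \<Rightarrow> real) \<Rightarrow> real \<Rightarrow> bool" where
  "cf_control K b C \<delta> \<rho> f v \<longleftrightarrow> prob_dens f \<and> (\<forall>x. f x \<le> K) \<and> b \<le> v / 2 \<and>
     (\<forall>s. \<bar>s\<bar> \<le> \<delta> \<longrightarrow> norm (cf f s) \<le> exp (- b * s\<^sup>2) \<and>
        norm (cf f s - of_real (exp (- v * s\<^sup>2 / 2))) \<le> C * \<bar>s\<bar> ^ 3 \<and> norm (cf f s - 1) \<le> C * s\<^sup>2) \<and>
     (\<forall>s. \<bar>s\<bar> \<ge> \<delta> \<longrightarrow> norm (cf f s) \<le> \<rho>)"

text \<open>The Taylor remainder of a characteristic function is the expectation of a minimum; its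
  cubic branch is at most |s| times the third absolute moment of the envelope, so the constant does
  not depend on \<open>f\<close>.\<close>

lemma cf_third_order:
  assumes f: "exp_dens A \<kappa> f" and k: "\<kappa> > 0" and mean: "(LINT z|lborel. z * f z) = 0"
  shows "norm (cf f s - of_real (1 - s\<^sup>2 * (LINT z|lborel. z\<^sup>2 * f z) / 2)) \<le> \<bar>s\<bar> ^ 3 * exp_moment A \<kappa> 3 / 6"
proof -
  have F: "prob_dens f" using f by (simp add: exp_dens_def)
  let ?M = "density lborel (\<lambda>x. ennreal (f x))"
  interpret M: real_distribution ?M by (rule real_distribution_prob_dens[OF F])
  note D = prob_densD[OF F]
  note [measurable] = D(1)
  note mom = exp_dens_moment[OF f k]
  have i1: "integrable ?M (\<lambda>x. x)" using mom(3)[of 1] by (subst prob_dens_expectation(2)[OF F]) auto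
  have i2: "integrable ?M (\<lambda>x. x\<^sup>2)" using mom(3)[of 2] by (subst prob_dens_expectation(2)[OF F]) auto
  have e1: "M.expectation (\<lambda>x. x) = 0" using mean by (subst prob_dens_expectation(1)[OF F]) auto
  have e2: "M.variance (\<lambda>x. x) = (LINT z|lborel. z\<^sup>2 * f z)"
    unfolding e1 by (subst prob_dens_expectation(1)[OF F]) auto
  have "M.expectation (\<lambda>x. min (6 * x\<^sup>2) (\<bar>s\<bar> * \<bar>x\<bar> ^ 3)) =
     (LINT x|lborel. min (6 * x\<^sup>2) (\<bar>s\<bar> * \<bar>x\<bar> ^ 3) * f x)"
    by (subst prob_dens_expectation(1)[OF F]) auto
  also have "\<dots> \<le> (LINT x|lborel. \<bar>s\<bar> * (\<bar>x\<bar> ^ 3 * f x))"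
  proof (rule integral_mono')
    show "min (6 * x\<^sup>2) (\<bar>s\<bar> * \<bar>x\<bar> ^ 3) * f x \<le> \<bar>s\<bar> * (\<bar>x\<bar> ^ 3 * f x)" for x
      unfolding mult.assoc[symmetric] using D(2)[of x] by (intro mult_right_mono) auto
  qed (use mom(1)[of 3] D(2) in auto)
  also have "\<dots> \<le> \<bar>s\<bar> * exp_moment A \<kappa> 3" using mom(2)[of 3] by (auto intro: mult_left_mono)
  finally have le: "M.expectation (\<lambda>x. min (6 * x\<^sup>2) (\<bar>s\<bar> * \<bar>x\<bar> ^ 3)) \<le> \<bar>s\<bar> * exp_moment A \<kappa> 3" .
  have "norm (cf f s - of_real (1 - s\<^sup>2 * (LINT z|lborel. z\<^sup>2 * f z) / 2))
     \<le> s\<^sup>2 / 6 * M.expectation (\<lambda>x. min (6 * x\<^sup>2) (\<bar>s\<bar> * \<bar>x\<bar> ^ 3))"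
    unfolding cf_def using M.char_approx3[OF i1 e1 i2 e2, of s] by simp
  also have "\<dots> \<le> s\<^sup>2 / 6 * (\<bar>s\<bar> * exp_moment A \<kappa> 3)" by (intro mult_left_mono le) auto
  also have "\<dots> = \<bar>s\<bar> ^ 3 * exp_moment A \<kappa> 3 / 6"
    by (simp add: power3_eq_cube power2_eq_square)
  finally show ?thesis .
qed

text \<open>From below use 1 - x <= exp (- x); from above, exp (- x) <= 1 / (1 + x) <= 1 - x +
  x^2.\<close>

lemma exp_minus_quadratic: "\<bar>1 - x - exp (- x)\<bar> \<le> x\<^sup>2" if "0 \<le> x" "x \<le> 1" for x :: real
proof -
  have "1 - x \<le> exp (- x)" using exp_ge_add_one_self[of "- x"] by simp
  moreover have "exp (- x) \<le> 1 / (1 + x)"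
    using that exp_ge_add_one_self[of x] by (simp add: exp_minus field_simps)
  moreover have "1 / (1 + x) \<le> 1 - x + x\<^sup>2"
  proof -
    have "0 \<le> x * (x * x)" using that by simp
    then have "1 \<le> (1 - x + x\<^sup>2) * (1 + x)" by (simp add: algebra_simps power2_eq_square)
    then show ?thesis using that by (simp add: divide_le_eq)
  qed
  ultimately show ?thesis by linarith
qed

lemma cf_control_exists:
  assumes A: "A > 0" and k: "\<kappa> > (0::real)"
  obtains b C \<delta> \<rho> v1 where "b > 0" "C \<ge> 0" "\<delta> > 0" "0 < \<rho>" "\<rho> < 1"
    "\<And>f. exp_dens A \<kappa> f \<Longrightarrow> (LINT z|lborel. z * f z) = 0 \<Longrightarrow> \<exists>v\<le>v1. cf_control A b C \<delta> \<rho> f v"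
proof -
  define v0 v1 M3 m where "v0 = 1 / (32 * A\<^sup>2)" and "v1 = \<bar>exp_moment A \<kappa> 2\<bar> + 1"
    and "M3 = \<bar>exp_moment A \<kappa> 3\<bar>" and "m = \<bar>exp_moment A \<kappa> 1\<bar>"
  have pos: "v0 > 0" "v1 \<ge> 1" "M3 \<ge> 0" "m \<ge> 0" using A by (auto simp: v0_def v1_def M3_def m_def)
  \<comment> \<open>The bound 1 / v1 keeps s^2 v / 2 below 1, as the quadratic expansions require.
    The bound v0 / (M3 + 1) makes the cubic error at most v0 s^2 / 6, a third of the smallest
    possible quadratic term v0 s^2 / 2.\<close>
  define \<delta> where "\<delta> = min (1 / v1) (v0 / (M3 + 1))"
  have "v1 * \<delta> \<le> v1 * (1 / v1)" using pos by (intro mult_left_mono) (auto simp: \<delta>_def)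
  then have \<delta>1: "v1 * \<delta> \<le> 1" using pos by simp
  have "\<delta> \<le> 1 / v1" by (simp add: \<delta>_def)
  also have "1 / v1 \<le> 1" using pos by simp
  finally have \<delta>: "\<delta> > 0" "\<delta> \<le> 1" "v1 * \<delta> \<le> 1"
    using pos \<delta>1 by (auto simp: \<delta>_def)
  have "M3 * \<delta> \<le> M3 * (v0 / (M3 + 1))" using pos by (intro mult_left_mono) (auto simp: \<delta>_def)
  also have "\<dots> \<le> v0" using pos by (simp add: field_simps)
  finally have \<delta>3: "M3 * \<delta> \<le> v0" .
  \<comment> \<open>The summands pay for replacing 1 - x by exp (- x), for the quadratic term itself
    in the distance of the characteristic function from 1, and for the third-order Taylor
    error.\<close>
  define C where "C = v1\<^sup>2 + v1 + M3"
  obtain \<rho> where \<rho>: "0 < \<rho>" "\<rho> < 1" and away: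
    "\<And>f s. prob_dens f \<Longrightarrow> (\<And>x. f x \<le> A) \<Longrightarrow> integrable lborel (\<lambda>x. \<bar>x\<bar> * f x) \<Longrightarrow>
       (LINT x|lborel. \<bar>x\<bar> * f x) \<le> m \<Longrightarrow> \<bar>s\<bar> \<ge> \<delta> \<Longrightarrow> norm (cf f s) \<le> \<rho>"
    using cf_away_from_zero[OF A pos(4) \<delta>(1)] by blast
  show thesis
  \<comment> \<open>After the cubic error v0 s^2 / 6 a decrease of at least v0 s^2 / 3 is left; v0 /
    4 is a convenient smaller rate.\<close>
  proof (rule that[of "v0/4" C \<delta> \<rho> v1])
    fix f assume f: "exp_dens A \<kappa> f" and mean: "(LINT z|lborel. z * f z) = 0"
    have F: "prob_dens f" using f by (simp add: exp_dens_def)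
    have FA: "f x \<le> A" for x
    proof -
      have "f x \<le> A * exp (- \<kappa> * \<bar>x\<bar>)" using f by (simp add: exp_dens_def)
      also have "\<dots> \<le> A * 1" using A k by (intro mult_left_mono) auto
      finally show ?thesis by simp
    qed
    note mom = exp_dens_moment[OF f k]
    define v where "v = (LINT z|lborel. z\<^sup>2 * f z)"
    have "v \<ge> v0"
      using bounded_dens_variance[OF F FA A, of 0] mom(3)[of 2] by (simp add: v_def v0_def)
    moreover have "v \<le> v1" using mom(2)[of 2] by (simp add: v_def v1_def)
    ultimately have v: "v0 \<le> v" "v \<le> v1" by auto
    have M3: "exp_moment A \<kappa> 3 \<le> M3" by (simp add: M3_def)
    have near: "norm (cf f s) \<le> exp (- (v0/4) * s\<^sup>2) \<and>
        norm (cf f s - of_real (exp (- v * s\<^sup>2 / 2))) \<le> C * \<bar>s\<bar> ^ 3 \<and> norm (cf f s - 1) \<le> C * s\<^sup>2"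
      if s: "\<bar>s\<bar> \<le> \<delta>" for s
    proof -
      have s1: "\<bar>s\<bar> \<le> 1" using s \<delta> by simp
      have s3: "\<bar>s\<bar> ^ 3 = s\<^sup>2 * \<bar>s\<bar>" by (simp add: power3_eq_cube power2_eq_square)
      have s32: "\<bar>s\<bar> ^ 3 \<le> s\<^sup>2" unfolding s3 using s1 by (simp add: mult_left_le)
      have t: "norm (cf f s - of_real (1 - s\<^sup>2 * v / 2)) \<le> \<bar>s\<bar> ^ 3 * M3 / 6"
        using cf_third_order[OF f k mean, of s] mult_left_mono[OF M3, of "\<bar>s\<bar> ^ 3"] unfolding v_def by simp
      have "s\<^sup>2 * v \<le> (1 * \<delta>) * v1"
        using s s1 v pos unfolding power2_eq_square abs_mult_self_eq[symmetric, of s]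
        by (intro mult_mono) (auto intro: mult_mono)
      then have x1: "s\<^sup>2 * v / 2 \<le> 1" using \<delta>(3) by (simp add: mult.commute)
      have x0: "0 \<le> s\<^sup>2 * v / 2" using v pos by simp
      have "norm (cf f s) \<le> norm (of_real (1 - s\<^sup>2 * v / 2) :: complex) + \<bar>s\<bar> ^ 3 * M3 / 6"
        using t norm_triangle_sub[of "cf f s" "of_real (1 - s\<^sup>2 * v / 2)"] by linarith
      also have "norm (of_real (1 - s\<^sup>2 * v / 2) :: complex) = 1 - s\<^sup>2 * v / 2"
        unfolding norm_of_real using x1 by simp
      also have "\<bar>s\<bar> ^ 3 * M3 / 6 \<le> s\<^sup>2 * v0 / 6"
      proof -
        have "\<bar>s\<bar> * M3 \<le> v0" using \<delta>3 mult_right_mono[OF s pos(3)] by (simp add: mult.commute)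
        then show ?thesis unfolding s3 by (auto simp: mult.assoc intro!: mult_left_mono)
      qed
      also have "1 - s\<^sup>2 * v / 2 + s\<^sup>2 * v0 / 6 \<le> 1 + (- (v0/4) * s\<^sup>2)"
        proof -
          have "0 \<le> s\<^sup>2 * v0" using pos(1) by simp
          moreover have "1 + (- (v0/4) * s\<^sup>2) = 1 - (s\<^sup>2 * v0) / 4" by simp
          moreover have "s\<^sup>2 * v0 \<le> s\<^sup>2 * v" by (rule mult_left_mono[OF v(1)]) simp
          ultimately show ?thesis by linarith
        qed
      also have "\<dots> \<le> exp (- (v0/4) * s\<^sup>2)" by (rule exp_ge_add_one_self)
      finally have 1: "norm (cf f s) \<le> exp (- (v0/4) * s\<^sup>2)" by simp
      have "s\<^sup>2 * v / 2 \<le> s\<^sup>2 * v1" using mult_left_mono[OF v(2) zero_le_power2[of s]] x0 by linarith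
      then have "(s\<^sup>2 * v / 2)\<^sup>2 \<le> (s\<^sup>2 * v1)\<^sup>2" using x0 by (rule power_mono)
      also have "\<dots> = v1\<^sup>2 * (s\<^sup>2 * s\<^sup>2)" by (simp add: power2_eq_square)
      also have "\<dots> \<le> v1\<^sup>2 * (s\<^sup>2 * \<bar>s\<bar>)" using s1
        by (intro mult_left_mono) (auto simp: power2_eq_square abs_mult_self_eq[symmetric, of s] mult_left_le simp del: abs_mult_self_eq)
      finally have q: "(s\<^sup>2 * v / 2)\<^sup>2 \<le> v1\<^sup>2 * \<bar>s\<bar> ^ 3" by (simp add: s3)
      have "norm (of_real (1 - s\<^sup>2 * v / 2) - of_real (exp (- v * s\<^sup>2 / 2)) :: complex) = \<bar>1 - s\<^sup>2 * v / 2 - exp (- (s\<^sup>2 * v / 2))\<bar>"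
        unfolding of_real_diff[symmetric] norm_of_real by (simp add: mult.commute)
      also have "\<dots> \<le> (s\<^sup>2 * v / 2)\<^sup>2" by (rule exp_minus_quadratic[OF x0 x1])
      finally have "norm (of_real (1 - s\<^sup>2 * v / 2) - of_real (exp (- v * s\<^sup>2 / 2)) :: complex) \<le> v1\<^sup>2 * \<bar>s\<bar> ^ 3" using q by simp
      then have "norm (cf f s - of_real (exp (- v * s\<^sup>2 / 2))) \<le> \<bar>s\<bar> ^ 3 * M3 / 6 + v1\<^sup>2 * \<bar>s\<bar> ^ 3"
        using t norm_triangle_ineq[of "cf f s - of_real (1 - s\<^sup>2 * v / 2)" "of_real (1 - s\<^sup>2 * v / 2) - of_real (exp (- v * s\<^sup>2 / 2))"]
        by simp
      also have "\<dots> \<le> C * \<bar>s\<bar> ^ 3" using pos by (simp add: C_def algebra_simps)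
      finally have 2: "norm (cf f s - of_real (exp (- v * s\<^sup>2 / 2))) \<le> C * \<bar>s\<bar> ^ 3" .
      have "norm (cf f s - 1) \<le> norm (cf f s - of_real (1 - s\<^sup>2 * v / 2)) + norm (of_real (1 - s\<^sup>2 * v / 2) - 1 :: complex)"
        using norm_triangle_ineq[of "cf f s - of_real (1 - s\<^sup>2 * v / 2)" "of_real (1 - s\<^sup>2 * v / 2) - 1"] by simp
      also have "norm (of_real (1 - s\<^sup>2 * v / 2) - 1 :: complex) = s\<^sup>2 * v / 2"
      proof -
        have "(of_real (1 - s\<^sup>2 * v / 2) - 1 :: complex) = - of_real (s\<^sup>2 * v / 2)" by simp
        then show ?thesis using x0 by (simp only: norm_minus_cancel norm_of_real abs_of_nonneg)
      qed
      finally have "norm (cf f s - 1) \<le> s\<^sup>2 * M3 + s\<^sup>2 * v1"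
        using t \<open>s\<^sup>2 * v / 2 \<le> s\<^sup>2 * v1\<close> mult_right_mono[OF s32 pos(3)] mult_nonneg_nonneg[OF zero_le_power[OF abs_ge_zero[of s]] pos(3), of 3]
        by linarith
      also have "\<dots> \<le> C * s\<^sup>2" by (simp add: C_def algebra_simps)
      finally show ?thesis using 1 2 by simp
    qed
    have far: "norm (cf f s) \<le> \<rho>" if "\<bar>s\<bar> \<ge> \<delta>" for s
      using away[OF F FA _ _ that] mom(1,2)[of 1] by (simp add: m_def)
    have "cf_control A (v0/4) C \<delta> \<rho> f v"
      unfolding cf_control_def using F FA v pos near far by auto
    then show "\<exists>v\<le>v1. cf_control A (v0/4) C \<delta> \<rho> f v" using v by blast
  qed (use pos \<delta> \<rho> in \<open>auto simp: C_def\<close>)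
qed

section \<open>Fourier estimates for the difference of consecutive convolution powers\<close>

definition gauss_moment :: "nat \<Rightarrow> real" where
  "gauss_moment k = (LINT u|lborel. \<bar>u\<bar> ^ k * exp (- u\<^sup>2))"

lemma gauss_moment_scaled:
  assumes c: "c > 0"
  shows "integrable lborel (\<lambda>s. \<bar>s\<bar> ^ k * exp (- c * s\<^sup>2))"
    and "(LINT s|lborel. \<bar>s\<bar> ^ k * exp (- c * s\<^sup>2)) = (1 / sqrt c) ^ (k + 1) * gauss_moment k"
proof -
  have eq: "\<bar>u\<bar> ^ k * exp (- u\<^sup>2) =
     (sqrt (2 * pi) * (1 / sqrt 2) ^ k) * (std_normal_density (0 + sqrt 2 * u) * \<bar>0 + sqrt 2 * u\<bar> ^ k)" for u
    by (simp add: std_normal_density_def abs_mult power_mult_distrib power_divide)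
  have I: "integrable lborel (\<lambda>u::real. \<bar>u\<bar> ^ k * exp (- u\<^sup>2))"
    unfolding eq
    by (rule integrable_mult_right, rule lborel_integrable_real_affine[OF integrable_std_normal_moment_abs[of k]]) simp
  have sc: "\<bar>s\<bar> ^ k * exp (- c * s\<^sup>2) = (1 / sqrt c) ^ k * (\<bar>0 + sqrt c * s\<bar> ^ k * exp (- (0 + sqrt c * s)\<^sup>2))" for s
    using c by (simp add: abs_mult power_mult_distrib power_divide)
  show "integrable lborel (\<lambda>s. \<bar>s\<bar> ^ k * exp (- c * s\<^sup>2))"
    unfolding sc using c by (intro integrable_mult_right lborel_integrable_real_affine[OF I]) auto
  have "gauss_moment k = sqrt c * (LINT s|lborel. \<bar>0 + sqrt c * s\<bar> ^ k * exp (- (0 + sqrt c * s)\<^sup>2))"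
    unfolding gauss_moment_def using c by (subst lborel_integral_real_affine[of "sqrt c" _ 0]) auto
  then show "(LINT s|lborel. \<bar>s\<bar> ^ k * exp (- c * s\<^sup>2)) = (1 / sqrt c) ^ (k + 1) * gauss_moment k"
    unfolding sc using c by simp
qed

lemma norm_power_diff_le:
  fixes x y :: complex
  assumes "norm x \<le> m" "norm y \<le> m"
  shows "norm (x ^ Suc k - y ^ Suc k) \<le> real (Suc k) * norm (x - y) * m ^ k"
proof (induction k)
  case (Suc k)
  have m: "0 \<le> m" using assms norm_ge_zero order_trans by blast
  have "norm (x ^ Suc (Suc k) - y ^ Suc (Suc k)) = norm (x * (x ^ Suc k - y ^ Suc k) + (x - y) * y ^ Suc k)"
    by (simp add: algebra_simps)
  also have "\<dots> \<le> norm x * norm (x ^ Suc k - y ^ Suc k) + norm (x - y) * norm y ^ Suc k"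
    using norm_triangle_ineq by (metis norm_mult norm_power)
  also have "\<dots> \<le> m * (real (Suc k) * norm (x - y) * m ^ k) + norm (x - y) * m ^ Suc k"
    using assms m Suc by (intro add_mono mult_mono power_mono) auto
  also have "\<dots> = real (Suc (Suc k)) * norm (x - y) * m ^ Suc k" by (simp add: algebra_simps)
  finally show ?case .
qed simp

text \<open>Here \<open>x\<close> is the value of the characteristic function and \<open>y\<close>
  that of its Gaussian approximation. The expression splits into three errors: the second-order
  remainder of the exponential, the factor 1 - x, and the replacement of x by y in the linear term.
  The first two are of order s^2; the third is |s w| times a difference of powers, hence of order
  |s|^4 times the exponent.\<close>

lemma llt_pointwise:
  assumes x: "norm x \<le> m" and y: "norm y \<le> m" and m: "m \<le> 1"
    and xy: "norm (x - y) \<le> C * \<bar>s\<bar> ^ 3" and x1: "norm (x - 1) \<le> C * s\<^sup>2" and C: "C \<ge> 0"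
  shows "norm (x ^ (l + 2) * iexp (- (s * w)) - x ^ (l + 3) + \<i> * of_real (s * w) * y ^ (l + 2)) \<le>
     (1 + w\<^sup>2) * ((C + 1/2) * \<bar>s\<bar> ^ 2 + C * real (l + 2) * \<bar>s\<bar> ^ 4) * m ^ (l + 1)"
proof -
  have m0: "0 \<le> m" using x norm_ge_zero order_trans by blast
  have xm: "norm (x ^ (l + 2)) \<le> m ^ (l + 1)"
  proof -
    have "norm (x ^ (l + 2)) \<le> m ^ (l + 2)" unfolding norm_power using x by (intro power_mono) auto
    also have "\<dots> \<le> m ^ (l + 1)" using m m0 by (intro power_decreasing) auto
    finally show ?thesis .
  qed
  \<comment> \<open>The three errors grow like w^2, 1 and |w|; all are absorbed into the single
    factor \<open>1 + w\<^sup>2\<close>.\<close>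
  have w2: "\<bar>w\<bar> \<le> 1 + w\<^sup>2"
  proof -
    have "0 \<le> (\<bar>w\<bar> - 1)\<^sup>2" by simp
    moreover have "(\<bar>w\<bar> - 1)\<^sup>2 = w\<^sup>2 - 2 * \<bar>w\<bar> + 1" by (simp add: power2_eq_square algebra_simps)
    ultimately show ?thesis using zero_le_power2[of w] by linarith
  qed
  have "x ^ (l + 2) * iexp (- (s * w)) - x ^ (l + 3) + \<i> * of_real (s * w) * y ^ (l + 2) =
      x ^ (l + 2) * (iexp (- (s * w)) - (1 - \<i> * of_real (s * w))) + x ^ (l + 2) * (1 - x)
       - \<i> * of_real (s * w) * (x ^ (l + 2) - y ^ (l + 2))"
    by (simp add: algebra_simps eval_nat_numeral)
  also have "norm \<dots> \<le> norm (x ^ (l + 2)) * norm (iexp (- (s * w)) - (1 - \<i> * of_real (s * w))) +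
      norm (x ^ (l + 2)) * norm (1 - x) + \<bar>s * w\<bar> * norm (x ^ (l + 2) - y ^ (l + 2))"
  proof -
    have "norm (a * b + a * d - \<i> * of_real e * g) \<le> norm a * norm b + norm a * norm d + \<bar>e\<bar> * norm g"
      for a b d g :: complex and e :: real
      using norm_triangle_ineq4[of "a * b + a * d" "\<i> * of_real e * g"] norm_triangle_ineq[of "a * b" "a * d"]
      by (simp add: norm_mult)
    then show ?thesis .
  qed
  also have "\<dots> \<le> m ^ (l + 1) * ((s * w)\<^sup>2 / 2) + m ^ (l + 1) * (C * s\<^sup>2) +
      \<bar>s * w\<bar> * (real (l + 2) * (C * \<bar>s\<bar> ^ 3) * m ^ (l + 1))"
  proof (intro add_mono mult_mono xm)
    show "norm (iexp (- (s * w)) - (1 - \<i> * of_real (s * w))) \<le> (s * w)\<^sup>2 / 2"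
    proof -
      have "norm (iexp (- (s * w)) - (\<Sum>k\<le>1. (\<i> * complex_of_real (- (s * w))) ^ k / fact k)) \<le> \<bar>- (s * w)\<bar> ^ Suc 1 / fact (Suc 1)"
        by (rule iexp_approx1)
      also have "(\<Sum>k\<le>1. (\<i> * complex_of_real (- (s * w))) ^ k / fact k) = 1 - \<i> * of_real (s * w)"
        by simp
      also have "\<bar>- (s * w)\<bar> ^ Suc 1 / fact (Suc 1) = (s * w)\<^sup>2 / 2"
        by (simp only: abs_minus_cancel Suc_1 power2_abs fact_2)
      finally show ?thesis .
    qed
    show "norm (1 - x) \<le> C * s\<^sup>2" using x1 by (simp add: norm_minus_commute)
    have "norm (x ^ (l + 2) - y ^ (l + 2)) \<le> real (l + 2) * norm (x - y) * m ^ (l + 1)"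
      using norm_power_diff_le[OF x y, of "l + 1"] by simp
    also have "\<dots> \<le> real (l + 2) * (C * \<bar>s\<bar> ^ 3) * m ^ (l + 1)"
      using m0 xy C by (intro mult_mono) auto
    finally show "norm (x ^ (l + 2) - y ^ (l + 2)) \<le> real (l + 2) * (C * \<bar>s\<bar> ^ 3) * m ^ (l + 1)" .
  qed (use m0 in auto)
  also have "\<dots> = (w\<^sup>2 * (1/2 * \<bar>s\<bar> ^ 2) + 1 * (C * \<bar>s\<bar> ^ 2) + \<bar>w\<bar> * (C * real (l + 2) * \<bar>s\<bar> ^ 4)) * m ^ (l + 1)"
  proof -
    have "M * (a\<^sup>2 * w\<^sup>2 / 2) + M * (C * a\<^sup>2) + a * W * (L * (C * a ^ 3) * M) =
      (w\<^sup>2 * (1/2 * a ^ 2) + 1 * (C * a ^ 2) + W * (C * L * a ^ 4)) * M" for a W L M :: real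
      by (simp add: algebra_simps power2_eq_square power3_eq_cube power4_eq_xxxx)
    from this[of "m ^ (l + 1)" "\<bar>s\<bar>" "\<bar>w\<bar>" "real (l + 2)"] show ?thesis
      by (simp only: abs_mult power_mult_distrib power2_abs)
  qed
  also have "\<dots> \<le> ((1 + w\<^sup>2) * (1/2 * \<bar>s\<bar> ^ 2) + (1 + w\<^sup>2) * (C * \<bar>s\<bar> ^ 2) + (1 + w\<^sup>2) * (C * real (l + 2) * \<bar>s\<bar> ^ 4)) * m ^ (l + 1)"
    using m0 C w2 by (intro mult_right_mono add_mono) auto
  also have "\<dots> = (1 + w\<^sup>2) * ((C + 1/2) * \<bar>s\<bar> ^ 2 + C * real (l + 2) * \<bar>s\<bar> ^ 4) * m ^ (l + 1)"
    by (simp add: algebra_simps)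
  finally show ?thesis .
qed

lemma cf_controlD:
  assumes "cf_control K b C \<delta> \<rho> f v"
  shows "prob_dens f" "f x \<le> K" "b \<le> v / 2"
    "\<bar>s\<bar> \<le> \<delta> \<Longrightarrow> norm (cf f s) \<le> exp (- b * s\<^sup>2)"
    "\<bar>s\<bar> \<le> \<delta> \<Longrightarrow> norm (cf f s - of_real (exp (- v * s\<^sup>2 / 2))) \<le> C * \<bar>s\<bar> ^ 3"
    "\<bar>s\<bar> \<le> \<delta> \<Longrightarrow> norm (cf f s - 1) \<le> C * s\<^sup>2"
    "\<bar>s\<bar> \<ge> \<delta> \<Longrightarrow> norm (cf f s) \<le> \<rho>"
  using assms by (auto simp: cf_control_def)

lemma exp_power_quadratic: "exp (- b * s\<^sup>2) ^ n = exp (- (b * real n) * s\<^sup>2)" for b s :: real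
  by (simp add: mult_ac flip: exp_of_nat_mult)

lemma integral_odd:
  fixes h :: "real \<Rightarrow> real" assumes "\<And>s. h (- s) = - h s"
  shows "(LINT s|lborel. h s) = 0"
  using reflection_integral[of h 0] by (simp add: assms)

lemma cf_control_gauss:
  fixes l :: nat
  assumes cc: "cf_control K b C \<delta> \<rho> f v" and b: "b > 0"
  shows "exp (- v * s\<^sup>2 / 2) \<le> exp (- b * s\<^sup>2)"
    and "exp (- v * s\<^sup>2 / 2) ^ (l + Suc m) \<le> exp (- (b * real l) * s\<^sup>2)"
proof -
  show vb: "exp (- v * s\<^sup>2 / 2) \<le> exp (- b * s\<^sup>2)"
    using mult_right_mono[OF cf_controlD(3)[OF cc], of "s\<^sup>2"] by (simp add: mult_ac)
  have "exp (- v * s\<^sup>2 / 2) ^ (l + Suc m) \<le> exp (- b * s\<^sup>2) ^ (l + Suc m)" using vb by (intro power_mono) auto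
  also have "\<dots> \<le> exp (- b * s\<^sup>2) ^ l" using b by (intro power_decreasing) auto
  finally show "exp (- v * s\<^sup>2 / 2) ^ (l + Suc m) \<le> exp (- (b * real l) * s\<^sup>2)"
    unfolding exp_power_quadratic .
qed

text \<open>Both values are written as inversion integrals, for which the exponent l + 2 must be at
  least 3. Near 0 the pointwise bound integrates to Gaussian moments; as \<open>r\<close> is of
  order 1 / sqrt l, both moment terms are of order l^(-3/2), one power of l better than either
  value. Away from 0 the decay is geometric.\<close>

lemma conv_power_difference:
  assumes cc: "cf_control K b C \<delta> \<rho> f v" and b: "b > 0" and C: "C \<ge> 0" and \<rho>: "0 < \<rho>" "\<rho> < 1" and l: "l \<ge> 1"
  defines "r \<equiv> 1 / sqrt (b * real (l + 1))"
  shows "\<bar>conv_power f (l + 2) w - conv_power f (l + 3) 0\<bar> \<le>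
    (1 + w\<^sup>2) * ((C + 1/2) * gauss_moment 2 * r ^ 3 + C * real (l + 2) * gauss_moment 4 * r ^ 5) + 4 * pi * K * \<rho> ^ l"
proof -
  note cD = cf_controlD[OF cc]
  note f = cD(1) and fK = cD(2)
  note [measurable] = cf_measurable[OF f]
  define c where "c = b * real (l + 1)"
  have c: "c > 0" using b by (simp add: c_def)
  let ?T = "\<lambda>s. cf f s ^ (l + 2) * iexp (- (s * w)) - cf f s ^ (l + 3)"
  \<comment> \<open>The Gaussian is cut off at \<open>\<delta>\<close>, since the comparison with it
    is available only there; the cut-off keeps \<open>E\<close> even.\<close>
  define E where "E s = (if \<bar>s\<bar> \<le> \<delta> then exp (- v * s\<^sup>2 / 2) ^ (l + 2) else 0)" for s
  have [measurable]: "E \<in> borel_measurable borel" unfolding E_def by measurable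
  define B where "B s = (1 + w\<^sup>2) * ((C + 1/2) * (\<bar>s\<bar> ^ 2 * exp (- c * s\<^sup>2)) + C * real (l + 2) * (\<bar>s\<bar> ^ 4 * exp (- c * s\<^sup>2)))
      + 2 * \<rho> ^ l * (norm (cf f s))\<^sup>2" for s
  note vb = cf_control_gauss(1)[OF cc b]
  have mb: "exp (- b * s\<^sup>2) ^ (l + 1) = exp (- c * s\<^sup>2)" for s
    unfolding exp_power_quadratic c_def ..
  have TB: "norm (?T s + \<i> * of_real (s * w) * of_real (E s)) \<le> B s" for s
  proof (cases "\<bar>s\<bar> \<le> \<delta>")
    case True
    have "norm (cf f s ^ (l + 2) * iexp (- (s * w)) - cf f s ^ (l + 3) + \<i> * of_real (s * w) * of_real (exp (- v * s\<^sup>2 / 2)) ^ (l + 2)) \<le>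
     (1 + w\<^sup>2) * ((C + 1/2) * \<bar>s\<bar> ^ 2 + C * real (l + 2) * \<bar>s\<bar> ^ 4) * exp (- b * s\<^sup>2) ^ (l + 1)"
      using cD(4-6)[OF True] vb[of s] b C by (intro llt_pointwise) auto
    also have "\<dots> \<le> B s" unfolding mb B_def using \<rho> by (simp add: algebra_simps)
    finally show ?thesis using True by (simp add: E_def)
  next
    case False
    \<comment> \<open>Two powers are kept for square integrability and the remaining l decay
      geometrically.\<close>
    have n2: "norm (cf f s ^ (l + 2)) \<le> \<rho> ^ l * (norm (cf f s))\<^sup>2"
      unfolding power_add norm_mult norm_power using False \<rho> cD(7)[of s] by (intro mult_right_mono power_mono) auto
    have "norm (?T s) \<le> norm (cf f s ^ (l + 2)) * 1 + norm (cf f s ^ (l + 2)) * norm (cf f s)"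
    proof -
      have "?T s = cf f s ^ (l + 2) * iexp (- (s * w)) - cf f s ^ (l + 2) * cf f s" by (simp add: eval_nat_numeral)
      then show ?thesis
        using norm_triangle_ineq4[of "cf f s ^ (l + 2) * iexp (- (s * w))" "cf f s ^ (l + 2) * cf f s"]
        by (simp only: norm_mult norm_exp_i_times)
    qed
    also have "\<dots> \<le> norm (cf f s ^ (l + 2)) * 1 + norm (cf f s ^ (l + 2)) * 1"
      using norm_cf_le_1[OF f] by (intro add_mono mult_left_mono) auto
    also have "\<dots> \<le> 2 * (\<rho> ^ l * (norm (cf f s))\<^sup>2)" using n2 by simp
    also have "\<dots> \<le> B s" unfolding B_def using C by (auto intro!: add_nonneg_nonneg mult_nonneg_nonneg)
    finally show ?thesis using False by (simp add: E_def)
  qed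
  note sq = cf_square_integrable[OF f fK]
  note g2 = gauss_moment_scaled[OF c, of 2] and g4 = gauss_moment_scaled[OF c, of 4]
  have IB: "integrable lborel B"
    unfolding B_def by (intro Bochner_Integration.integrable_add integrable_mult_right g2 g4 sq)
  have "integral\<^sup>L lborel B = (1 + w\<^sup>2) * ((C + 1/2) * (LINT s|lborel. \<bar>s\<bar> ^ 2 * exp (- c * s\<^sup>2)) + C * real (l + 2) * (LINT s|lborel. \<bar>s\<bar> ^ 4 * exp (- c * s\<^sup>2)))
      + 2 * \<rho> ^ l * (LINT s|lborel. (norm (cf f s))\<^sup>2)"
    unfolding B_def
    by (intro has_bochner_integral_integral_eq has_bochner_integral_add has_bochner_integral_mult_right
        has_bochner_integral_integrable g2(1) g4(1) sq(1))
  also have "\<dots> \<le> (1 + w\<^sup>2) * ((C + 1/2) * (r ^ 3 * gauss_moment 2) + C * real (l + 2) * (r ^ 5 * gauss_moment 4)) + 2 * \<rho> ^ l * (2 * pi * K)"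
    unfolding g2 g4 using sq(2) \<rho> C by (intro add_mono mult_left_mono) (auto simp: r_def c_def)
  finally have iB: "integral\<^sup>L lborel B \<le> (1 + w\<^sup>2) * ((C + 1/2) * gauss_moment 2 * r ^ 3 + C * real (l + 2) * gauss_moment 4 * r ^ 5) + 4 * pi * K * \<rho> ^ l"
    by (simp add: mult_ac)
  have I1: "integrable lborel (\<lambda>s. cf f s ^ (l + 2) * iexp (- (s * w)))"
    by (rule Bochner_Integration.integrable_bound[OF cf_power_integrable[OF f fK, of "l + 2"]]) (auto simp: norm_mult)
  have I2: "integrable lborel (\<lambda>s. cf f s ^ (l + 3))"
    by (rule cf_power_integrable[OF f fK]) auto
  have E0: "0 \<le> E s" for s by (simp add: E_def)
  have IE: "integrable lborel (\<lambda>s. s * E s)"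
  proof (rule Bochner_Integration.integrable_bound[OF gauss_moment_scaled(1)[OF c, of 1]])
    have "E s \<le> exp (- c * s\<^sup>2)" for s
      using cf_control_gauss(2)[OF cc b, of s "l + 1" 0] by (simp add: E_def c_def)
    then show "AE s in lborel. norm (s * E s) \<le> norm (\<bar>s\<bar> ^ 1 * exp (- c * s\<^sup>2))"
      using E0 by (intro AE_I2) (simp add: abs_mult mult_left_mono)
  qed simp
  \<comment> \<open>Oddness makes the linear term free: it may be added to the integrand without
    changing the integral.\<close>
  have "(LINT s|lborel. s * E s) = 0" by (rule integral_odd) (simp add: E_def)
  then have oE: "(LINT s|lborel. \<i> * of_real w * of_real (s * E s)) = 0"
    by (simp only: integral_mult_right_zero integral_complex_of_real) simp
  have IE': "integrable lborel (\<lambda>s. \<i> * of_real w * complex_of_real (s * E s))"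
    by (intro integrable_mult_right integrable_of_real IE)
  have "complex_of_real (conv_power f (l + 2) w - conv_power f (l + 3) 0) = (1 / (2 * pi)) *\<^sub>R (LINT s|lborel. ?T s)"
    using conv_power_inversion[OF f fK, of "l + 2" w] conv_power_inversion[OF f fK, of "l + 3" 0] l
    unfolding Bochner_Integration.integral_diff[OF I1 I2] by (simp add: scaleR_diff_right)
  also have "(LINT s|lborel. ?T s) = (LINT s|lborel. ?T s + \<i> * of_real w * of_real (s * E s))"
    by (subst Bochner_Integration.integral_add[OF Bochner_Integration.integrable_diff[OF I1 I2] IE']) (simp only: oE add_0_right)
  finally have "norm (complex_of_real (conv_power f (l + 2) w - conv_power f (l + 3) 0)) =
     1 / (2 * pi) * norm (LINT s|lborel. ?T s + \<i> * of_real w * of_real (s * E s))"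
    by (simp only: norm_scaleR) simp
  also have "\<dots> \<le> 1 * norm (LINT s|lborel. ?T s + \<i> * of_real w * of_real (s * E s))"
    using pi_gt3 by (intro mult_right_mono) (auto simp: field_simps)
  also have "\<dots> \<le> 1 * integral\<^sup>L lborel B"
    using TB by (intro mult_left_mono Bochner_Integration.integral_norm_bound_integral IB
        Bochner_Integration.integrable_add[OF Bochner_Integration.integrable_diff[OF I1 I2] IE']) (auto simp: mult_ac)
  also note iB
  finally show ?thesis unfolding norm_of_real by simp
qed

text \<open>The inversion integral at 0 is compared with a truncated Gaussian, whose integral is at
  least of order 1 / sqrt l. The error terms are of order 1 / l and geometric, hence eventually
  negligible.\<close>

lemma conv_power_lower:
  fixes l :: nat
  assumes cc: "cf_control K b C \<delta> \<rho> f v" and v1: "v \<le> v1" and b: "b > 0" and C: "C \<ge> 0" and \<delta>: "\<delta> > 0" and \<rho>: "0 < \<rho>" "\<rho> < 1"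
  defines "r \<equiv> 1 / sqrt (b * real (l + 1))"
  shows "2 * pi * conv_power f (l + 3) 0 \<ge> 2 * \<delta> / sqrt (real (l + 3)) * exp (- (v1 * \<delta>\<^sup>2 / 2))
     - (C * real (l + 3) * gauss_moment 3 * r ^ 4 + 2 * pi * K * \<rho> ^ l)"
proof -
  note cD = cf_controlD[OF cc]
  note f = cD(1) and fK = cD(2)
  note [measurable] = cf_measurable[OF f]
  define c where "c = b * real (l + 1)"
  have c: "c > 0" using b by (simp add: c_def)
  define E where "E s = (if \<bar>s\<bar> \<le> \<delta> then exp (- v * s\<^sup>2 / 2) ^ (l + 3) else 0)" for s
  have [measurable]: "E \<in> borel_measurable borel" unfolding E_def by measurable
  define B where "B s = C * real (l + 3) * (\<bar>s\<bar> ^ 3 * exp (- c * s\<^sup>2)) + \<rho> ^ l * (norm (cf f s))\<^sup>2" for s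
  note vb = cf_control_gauss(1)[OF cc b]
  have mb: "exp (- b * s\<^sup>2) ^ (l + 1) = exp (- c * s\<^sup>2)" for s
    unfolding exp_power_quadratic c_def ..
  have TB: "norm (cf f s ^ (l + 3) - of_real (E s)) \<le> B s" for s
  proof (cases "\<bar>s\<bar> \<le> \<delta>")
    case True
    have "norm (cf f s ^ (l + 3) - of_real (exp (- v * s\<^sup>2 / 2)) ^ (l + 3)) \<le>
       real (l + 3) * norm (cf f s - of_real (exp (- v * s\<^sup>2 / 2))) * exp (- b * s\<^sup>2) ^ (l + 2)"
      using norm_power_diff_le[of "cf f s" "exp (- b * s\<^sup>2)" "of_real (exp (- v * s\<^sup>2 / 2))" "l + 2"] cD(4)[OF True] vb[of s]
      by (simp add: eval_nat_numeral)
    also have "\<dots> \<le> real (l + 3) * (C * \<bar>s\<bar> ^ 3) * exp (- b * s\<^sup>2) ^ (l + 1)"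
      using cD(5)[OF True] b C by (intro mult_mono power_decreasing) auto
    also have "\<dots> \<le> B s" unfolding mb B_def using \<rho> by (simp add: mult_ac)
    finally show ?thesis using True by (simp add: E_def)
  next
    case False
    have "norm (cf f s ^ (l + 3)) \<le> \<rho> ^ (l + 1) * (norm (cf f s))\<^sup>2"
    proof -
      have "norm (cf f s ^ (l + 3)) = norm (cf f s) ^ (l + 1) * (norm (cf f s))\<^sup>2"
        by (simp add: norm_power norm_mult eval_nat_numeral)
      also have "\<dots> \<le> \<rho> ^ (l + 1) * (norm (cf f s))\<^sup>2"
        using False \<rho> cD(7)[of s] by (intro mult_right_mono power_mono) auto
      finally show ?thesis .
    qed
    also have "\<dots> \<le> \<rho> ^ l * (norm (cf f s))\<^sup>2" using \<rho> by (intro mult_right_mono power_decreasing) auto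
    also have "\<dots> \<le> B s" unfolding B_def using C by simp
    finally show ?thesis using False by (simp add: E_def)
  qed
  note sq = cf_square_integrable[OF f fK]
  note g3 = gauss_moment_scaled[OF c, of 3]
  have IB: "integrable lborel B"
    unfolding B_def by (intro Bochner_Integration.integrable_add integrable_mult_right g3 sq)
  have "integral\<^sup>L lborel B = C * real (l + 3) * (LINT s|lborel. \<bar>s\<bar> ^ 3 * exp (- c * s\<^sup>2)) + \<rho> ^ l * (LINT s|lborel. (norm (cf f s))\<^sup>2)"
    unfolding B_def
    by (intro has_bochner_integral_integral_eq has_bochner_integral_add has_bochner_integral_mult_right
        has_bochner_integral_integrable g3(1) sq(1))
  also have "\<dots> \<le> C * real (l + 3) * (r ^ 4 * gauss_moment 3) + \<rho> ^ l * (2 * pi * K)"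
    unfolding g3 using sq(2) \<rho> C by (intro add_mono mult_left_mono) (auto simp: r_def c_def)
  finally have iB: "integral\<^sup>L lborel B \<le> C * real (l + 3) * gauss_moment 3 * r ^ 4 + 2 * pi * K * \<rho> ^ l"
    by (simp add: mult_ac)
  have I2: "integrable lborel (\<lambda>s. cf f s ^ (l + 3))"
    by (rule cf_power_integrable[OF f fK]) auto
  have IE: "integrable lborel E"
  proof (rule Bochner_Integration.integrable_bound[OF gauss_moment_scaled(1)[OF c, of 0]])
    have "E s \<le> exp (- c * s\<^sup>2)" for s
      using cf_control_gauss(2)[OF cc b, of s "l + 1" 1] by (simp add: E_def c_def eval_nat_numeral)
    then show "AE s in lborel. norm (E s) \<le> norm (\<bar>s\<bar> ^ 0 * exp (- c * s\<^sup>2))"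
      by (auto simp: E_def)
  qed simp
  \<comment> \<open>On |s| <= d the power l + 3 of the Gaussian factor is at least exp (- v1
    \<delta>^2 / 2), a bound free of l and f.\<close>
  define d where "d = \<delta> / sqrt (real (l + 3))"
  have d: "d > 0" using \<delta> by (simp add: d_def)
  have "sqrt 1 \<le> sqrt (real (l + 3))" by (subst real_sqrt_le_iff) simp
  then have d\<delta>: "d \<le> \<delta>" using \<delta> by (simp add: d_def divide_le_eq)
  have Id: "integrable lborel (\<lambda>s. exp (- (v1 * \<delta>\<^sup>2 / 2)) * indicator {-d..d} s :: real)"
    using d by (intro integrable_mult_right integrable_real_indicator) auto
  have "2 * d * exp (- (v1 * \<delta>\<^sup>2 / 2)) = (LINT s|lborel. exp (- (v1 * \<delta>\<^sup>2 / 2)) * indicator {-d..d} s)"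
    using d by simp
  also have "\<dots> \<le> integral\<^sup>L lborel E"
  proof (intro integral_mono Id IE)
    fix s
    show "exp (- (v1 * \<delta>\<^sup>2 / 2)) * indicator {-d..d} s \<le> E s"
    proof (cases "s \<in> {-d..d}")
      case True
      then have "\<bar>s\<bar> \<le> \<bar>d\<bar>" by auto
      then have "s\<^sup>2 \<le> d\<^sup>2" by (rule abs_le_square_iff[THEN iffD1])
      then have "real (l + 3) * s\<^sup>2 \<le> \<delta>\<^sup>2" by (simp add: d_def power_divide field_simps)
      moreover have "0 \<le> v" using cD(3) b by simp
      ultimately have "v * (real (l + 3) * s\<^sup>2) \<le> v1 * \<delta>\<^sup>2" using v1 by (intro mult_mono) auto
      then have "exp (- (v1 * \<delta>\<^sup>2 / 2)) \<le> exp (- v * s\<^sup>2 / 2) ^ (l + 3)"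
        unfolding exp_of_nat_mult[symmetric] by (simp add: mult_ac)
      moreover have "\<bar>s\<bar> \<le> \<delta>" using \<open>\<bar>s\<bar> \<le> \<bar>d\<bar>\<close> d d\<delta> by linarith
      ultimately show ?thesis using True by (simp add: E_def)
    qed (simp add: E_def)
  qed
  finally have lowE: "2 * d * exp (- (v1 * \<delta>\<^sup>2 / 2)) \<le> integral\<^sup>L lborel E" .
  have "2 * pi * conv_power f (l + 3) 0 = Re (LINT s|lborel. cf f s ^ (l + 3))"
    using arg_cong[OF conv_power_inversion[OF f fK, of "l + 3" 0], of Re] by simp
  moreover have "\<bar>Re (LINT s|lborel. cf f s ^ (l + 3)) - integral\<^sup>L lborel E\<bar> \<le> integral\<^sup>L lborel B"
  proof -
    have IE': "integrable lborel (\<lambda>s. complex_of_real (E s))" by (intro integrable_of_real IE)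
    have "Re (LINT s|lborel. cf f s ^ (l + 3)) - integral\<^sup>L lborel E = Re (LINT s|lborel. cf f s ^ (l + 3) - of_real (E s))"
      unfolding Bochner_Integration.integral_diff[OF I2 IE'] integral_complex_of_real by simp
    also have "\<bar>\<dots>\<bar> \<le> norm (LINT s|lborel. cf f s ^ (l + 3) - of_real (E s))" by (rule abs_Re_le_cmod)
    also have "\<dots> \<le> integral\<^sup>L lborel B"
      by (intro Bochner_Integration.integral_norm_bound_integral IB Bochner_Integration.integrable_diff I2 IE' TB)
    finally show ?thesis .
  qed
  ultimately show ?thesis using lowE iB by (simp add: d_def)
qed

text \<open>\<open>U\<close> bounds the difference up to the factor \<open>1 + w\<^sup>2\<close> and
  \<open>L\<close> bounds the denominator from below. With S = N, the products S^(3/2) U and S^(1/2)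
  L converge, the latter to a positive limit; hence S U / L is eventually bounded, which is the rate
  1 / N.\<close>

lemma local_limit_ratio:
  assumes A: "A > 0" and k: "\<kappa> > (0::real)"
  obtains D :: real and N0 :: nat where
    "\<And>f N w. exp_dens A \<kappa> f \<Longrightarrow> (LINT z|lborel. z * f z) = 0 \<Longrightarrow> N \<ge> N0 \<Longrightarrow>
       conv_power f N 0 > 0 \<and> \<bar>conv_power f (N - 1) w / conv_power f N 0 - 1\<bar> \<le> D * (1 + w\<^sup>2) / real N"
proof -
  obtain b C \<delta> \<rho> v1 where b: "b > 0" and C: "C \<ge> 0" and \<delta>: "\<delta> > 0" and \<rho>: "0 < \<rho>" "\<rho> < 1" and
    ex: "\<And>f. exp_dens A \<kappa> f \<Longrightarrow> (LINT z|lborel. z * f z) = 0 \<Longrightarrow> \<exists>v\<le>v1. cf_control A b C \<delta> \<rho> f v"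
    using cf_control_exists[OF A k] by blast
  define r where "r l = 1 / sqrt (b * (real l + 1))" for l :: nat
  define S where "S l = real l + 3" for l :: nat
  have [simp]: "0 < S l" "S l \<noteq> 0" "0 \<le> S l" for l by (simp_all add: S_def)
  define U where "U l = (C + 1/2) * gauss_moment 2 * r l ^ 3
     + C * gauss_moment 4 * ((real l + 2) * r l ^ 5) + 4 * pi * A * \<rho> ^ l" for l :: nat
  define u where "u = (C + 1/2) * gauss_moment 2 * inverse (b powr (1/2)) ^ 3
     + C * gauss_moment 4 * inverse (b powr (1/2)) ^ 5 + 4 * pi * A * 0"
  define e where "e = 2 * \<delta> * exp (- (v1 * \<delta>\<^sup>2 / 2))"
  have e: "e > 0" using \<delta> by (simp add: e_def)
  define L where "L l = (e / sqrt (S l) - (C * gauss_moment 3 * (S l * r l ^ 4) + 2 * pi * A * \<rho> ^ l)) / (2 * pi)" for l :: nat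
  have "(\<lambda>l::nat. S l * sqrt (S l) * r l ^ 3) \<longlonglongrightarrow> inverse (b powr (1/2)) ^ 3"
    unfolding r_def S_def using b by real_asymp
  moreover have "(\<lambda>l::nat. S l * sqrt (S l) * ((real l + 2) * r l ^ 5)) \<longlonglongrightarrow> inverse (b powr (1/2)) ^ 5"
    unfolding r_def S_def using b by real_asymp
  moreover have "(\<lambda>l::nat. S l * sqrt (S l) * \<rho> ^ l) \<longlonglongrightarrow> 0"
    unfolding S_def using \<rho> by real_asymp
  ultimately have "(\<lambda>l. (C + 1/2) * gauss_moment 2 * (S l * sqrt (S l) * r l ^ 3)
     + C * gauss_moment 4 * (S l * sqrt (S l) * ((real l + 2) * r l ^ 5))
     + 4 * pi * A * (S l * sqrt (S l) * \<rho> ^ l)) \<longlonglongrightarrow>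
     u"
    unfolding u_def by (intro tendsto_intros)
  moreover have "(C + 1/2) * gauss_moment 2 * (p * x) + C * gauss_moment 4 * (p * y) + 4 * pi * A * (p * z) =
      p * ((C + 1/2) * gauss_moment 2 * x + C * gauss_moment 4 * y + 4 * pi * A * z)" for p x y z
    by (simp only: distrib_left mult_ac)
  ultimately have u: "(\<lambda>l. S l * sqrt (S l) * U l) \<longlonglongrightarrow> u"
    by (simp only: U_def)
  have "(\<lambda>l::nat. sqrt (S l) * (S l * r l ^ 4)) \<longlonglongrightarrow> 0"
    unfolding r_def S_def using b by real_asymp
  moreover have "(\<lambda>l::nat. sqrt (S l) * \<rho> ^ l) \<longlonglongrightarrow> 0"
    unfolding S_def using \<rho> by real_asymp
  ultimately have "(\<lambda>l. (e - (C * gauss_moment 3 * (sqrt (S l) * (S l * r l ^ 4))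
     + 2 * pi * A * (sqrt (S l) * \<rho> ^ l))) / (2 * pi)) \<longlonglongrightarrow> (e - (C * gauss_moment 3 * 0 + 2 * pi * A * 0)) / (2 * pi)"
    by (intro tendsto_intros) auto
  moreover have "(e - (C * gauss_moment 3 * (sqrt (S l) * (S l * r l ^ 4))
     + 2 * pi * A * (sqrt (S l) * \<rho> ^ l))) / (2 * pi) = sqrt (S l) * L l" for l
  proof -
    have "sqrt (S l) * (e / sqrt (S l)) = e" by simp
    then show ?thesis unfolding L_def times_divide_eq_right right_diff_distrib by (simp add: algebra_simps)
  qed
  ultimately have L: "(\<lambda>l. sqrt (S l) * L l) \<longlonglongrightarrow> e / (2 * pi)" by simp
  have e2: "0 < e / (2 * pi)" using e by simp
  have "(\<lambda>l. (S l * sqrt (S l) * U l) / (sqrt (S l) * L l)) \<longlonglongrightarrow> u / (e / (2 * pi))"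
    using u L e2 by (intro tendsto_divide) auto
  then have "\<forall>\<^sub>F l in sequentially. (S l * sqrt (S l) * U l) / (sqrt (S l) * L l) < u / (e / (2 * pi)) + 1"
    by (rule order_tendstoD) simp
  moreover have "\<forall>\<^sub>F l in sequentially. 0 < sqrt (S l) * L l"
    using L e2 by (rule order_tendstoD)
  ultimately have "\<forall>\<^sub>F l in sequentially. 0 < L l \<and> S l * U l / L l < u / (e / (2 * pi)) + 1"
  proof eventually_elim
    case (elim l)
    have s: "0 < sqrt (S l)" by simp
    have "S l * sqrt (S l) * U l / (sqrt (S l) * L l) = S l * U l / L l"
    proof -
      have *: "p * q * x / (q * y) = p * x / y" if "q \<noteq> 0" for p q x y :: real
        using that by (simp add: divide_simps)
      show ?thesis by (rule *) (use s in simp)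
    qed
    then show ?case using elim(1) zero_less_mult_pos[OF elim(2) s] by (simp only: conj_absorb simp_thms)
  qed
  then obtain l0 where l0: "\<And>l. l \<ge> l0 \<Longrightarrow> 0 < L l \<and> S l * U l / L l < u / (e / (2 * pi)) + 1"
    unfolding eventually_sequentially by blast
  show thesis
  \<comment> \<open>The Fourier lemmas use l = N - 3 and need l >= 1, hence 4 rather than 3.\<close>
  proof (rule that[of "l0 + 4" "u / (e / (2 * pi)) + 1"])
    fix f :: "real \<Rightarrow> real" and N :: nat and w :: real
    assume f: "exp_dens A \<kappa> f" and m: "(LINT z|lborel. z * f z) = 0" and N: "N \<ge> l0 + 4"
    define l where "l = N - 3"
    have l: "N = l + 3" "l \<ge> 1" "l \<ge> l0" "N - 1 = l + 2" using N by (auto simp: l_def)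
    obtain v where v: "v \<le> v1" "cf_control A b C \<delta> \<rho> f v" using ex[OF f m] by blast
    have "conv_power f (l + 3) 0 \<ge> L l"
      using conv_power_lower[OF v(2,1) b C \<delta> \<rho>, of l] unfolding L_def e_def r_def S_def
      by (simp add: divide_le_eq field_simps)
    moreover have pos: "L l > 0" using l0[OF l(3)] by simp
    ultimately have p: "conv_power f (l + 3) 0 > 0" "conv_power f (l + 3) 0 \<ge> L l" by linarith+
    have w1: "1 \<le> 1 + w\<^sup>2" by simp
    have "\<bar>conv_power f (l + 2) w - conv_power f (l + 3) 0\<bar> \<le>
       (1 + w\<^sup>2) * ((C + 1/2) * gauss_moment 2 * r l ^ 3
     + C * gauss_moment 4 * ((real l + 2) * r l ^ 5)) + 1 * (4 * pi * A * \<rho> ^ l)"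
      using conv_power_difference[OF v(2) b C \<rho> l(2), of w] unfolding r_def by (simp add: mult_ac add_ac)
    also have "\<dots> \<le> (1 + w\<^sup>2) * ((C + 1/2) * gauss_moment 2 * r l ^ 3
     + C * gauss_moment 4 * ((real l + 2) * r l ^ 5)) + (1 + w\<^sup>2) * (4 * pi * A * \<rho> ^ l)"
      using A \<rho> w1 by (intro add_left_mono mult_right_mono) auto
    also have "\<dots> = (1 + w\<^sup>2) * U l" by (simp add: U_def algebra_simps)
    finally have diff: "\<bar>conv_power f (l + 2) w - conv_power f (l + 3) 0\<bar> \<le> (1 + w\<^sup>2) * U l" .
    then have "0 \<le> (1 + w\<^sup>2) * U l" by (rule order_trans[OF abs_ge_zero])
    then have U0: "0 \<le> U l" using w1 by (simp add: zero_le_mult_iff)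
    have "\<bar>conv_power f (l + 2) w / conv_power f (l + 3) 0 - 1\<bar> = \<bar>conv_power f (l + 2) w - conv_power f (l + 3) 0\<bar> / conv_power f (l + 3) 0"
    proof -
      have *: "\<bar>x / y - 1\<bar> = \<bar>x - y\<bar> / y" if "y > 0" for x y :: real
      proof -
        have "x / y - 1 = (x - y) / y" using that by (simp add: diff_divide_distrib)
        then show ?thesis using that by (simp only: abs_divide abs_of_pos)
      qed
      show ?thesis by (rule *[OF p(1)])
    qed
    also have "\<dots> \<le> (1 + w\<^sup>2) * U l / L l"
      using diff p pos U0 by (intro frac_le) auto
    also have "\<dots> = (1 + w\<^sup>2) * (S l * U l / L l) / S l" by simp
    also have "\<dots> \<le> (1 + w\<^sup>2) * (u / (e / (2 * pi)) + 1) / S l"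
      using l0[OF l(3)] by (intro divide_right_mono mult_left_mono) auto
    finally show "conv_power f N 0 > 0 \<and> \<bar>conv_power f (N - 1) w / conv_power f N 0 - 1\<bar> \<le> (u / (e / (2 * pi)) + 1) * (1 + w\<^sup>2) / real N"
      using p unfolding l(4) unfolding l(1) by (simp add: S_def mult.commute)
  qed
qed

section \<open>Exponential tilting\<close>

text \<open>Integrability for every real t, negative values included, makes
  \<open>tilt_mean p\<close> strictly increasing on the whole line, so that the definite description
  in \<open>tilted_density\<close> is meaningful.\<close>

definition exp_tails :: "(real \<Rightarrow> real) \<Rightarrow> bool" where
  "exp_tails p \<longleftrightarrow> prob_dens p \<and> (\<forall>x<0. p x = 0) \<and> (\<forall>t. integrable lborel (\<lambda>x. exp (t * x) * p x))"

lemma exp_tailsD: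
  assumes "exp_tails p"
  shows "prob_dens p" "x < 0 \<Longrightarrow> p x = 0" "integrable lborel (\<lambda>x. exp (t * x) * p x)"
  using assms by (auto simp: exp_tails_def)

lemma mgf_eq:
  assumes "exp_tails p" shows "mgf p t = (LINT x|lborel. exp (t * x) * p x)"
  unfolding mgf_def set_lebesgue_integral_def
  using exp_tailsD(2)[OF assms] by (intro Bochner_Integration.integral_cong) (auto simp: indicator_def)

text \<open>On the support x >= 0 the power is absorbed by exp x, that is, by raising the tilt by
  1.\<close>

lemma exp_tails_moment:
  assumes "exp_tails p" shows "integrable lborel (\<lambda>x. x ^ j * (exp (t * x) * p x))"
proof -
  note D = prob_densD[OF exp_tailsD(1)[OF assms]]
  note [measurable] = D(1)
  have le: "norm (x ^ j * (exp (t * x) * p x)) \<le> norm (real j ^ j * (exp ((t + 1) * x) * p x))" for x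
  proof (cases "x < 0")
    case False
    have "x ^ j * (exp (t * x) * p x) \<le> (real j ^ j * exp x) * (exp (t * x) * p x)"
      using False D(2)[of x] power_le_exp[of x j] by (intro mult_right_mono) auto
    also have "\<dots> = real j ^ j * (exp ((t + 1) * x) * p x)" by (simp add: algebra_simps exp_add)
    finally show ?thesis using False D(2)[of x] by (simp add: abs_mult)
  qed (simp add: exp_tailsD(2)[OF assms])
  show ?thesis
    by (rule Bochner_Integration.integrable_bound[OF integrable_mult_right[OF exp_tailsD(3)[OF assms, of "t + 1"], of "real j ^ j"]])
      (use le in \<open>auto intro!: AE_I2\<close>)
qed

text \<open>A vanishing integral would force \<open>p\<close> to vanish almost everywhere off the
  null set {c}, against total mass 1. The exceptional point allows weights with a zero at the
  mean.\<close>

lemma integral_pos_of_dens: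
  assumes p: "prob_dens p" and I: "integrable lborel (\<lambda>x. u x * p x)" and u: "\<And>x. 0 \<le> u x" "\<And>x. x \<noteq> c \<Longrightarrow> 0 < u x"
  shows "0 < (LINT x|lborel. u x * p x)"
proof -
  note D = prob_densD[OF p]
  have "0 \<le> (LINT x|lborel. u x * p x)" using D(2) u(1) by (intro Bochner_Integration.integral_nonneg) auto
  moreover have "(LINT x|lborel. u x * p x) \<noteq> 0"
  proof
    assume "(LINT x|lborel. u x * p x) = 0"
    then have "AE x in lborel. u x * p x = 0"
      using I D(2) u(1) by (subst (asm) integral_nonneg_eq_0_iff_AE) auto
    then have "AE x in lborel. p x = 0"
      using AE_lborel_singleton[of c] by eventually_elim (use u(2) in force)
    then have "(LINT x|lborel. p x) = 0" by (rule integral_eq_zero_AE)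
    then show False using D(4) by simp
  qed
  ultimately show ?thesis by linarith
qed

lemma mgf_pos: assumes "exp_tails p" shows "0 < mgf p t"
  unfolding mgf_eq[OF assms]
  by (rule integral_pos_of_dens[OF exp_tailsD(1,3)[OF assms]]) auto

lemma exp_remainder: "\<bar>exp z - 1 - z\<bar> \<le> z\<^sup>2 * exp \<bar>z\<bar>" for z :: real
proof -
  obtain s where s: "\<bar>s\<bar> \<le> \<bar>z\<bar>" "exp z = (\<Sum>m<2. z ^ m / fact m) + (exp s / fact 2) * z ^ 2"
    using Maclaurin_exp_le by blast
  have "exp z - 1 - z = exp s / 2 * z\<^sup>2" using s(2) by (simp add: eval_nat_numeral)
  then have "\<bar>exp z - 1 - z\<bar> = \<bar>exp s / 2 * z\<^sup>2\<bar>" by (simp only:)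
  then have "\<bar>exp z - 1 - z\<bar> = exp s / 2 * z\<^sup>2" by (simp only: abs_mult abs_divide) simp
  also have "\<dots> \<le> exp \<bar>z\<bar> * z\<^sup>2"
  proof (intro mult_right_mono)
    have "exp s \<le> exp \<bar>z\<bar>" using s(1) by simp
    then show "exp s / 2 \<le> exp \<bar>z\<bar>" using exp_gt_zero[of "\<bar>z\<bar>"] by linarith
  qed simp
  finally show ?thesis by (simp add: mult.commute)
qed

text \<open>Instead of a general theorem on differentiation under the integral, the difference
  quotient is bounded directly: for |s| <= 1 and x >= 0 the remainder of exp (s x) is at most (s
  x)^2 exp x, so the error integrates to s^2 times a finite moment at tilt t + 1.\<close>

lemma mgf_deriv:
  assumes p: "exp_tails p"
  shows "(mgf p has_real_derivative (LINT x|lborel. x * (exp (t * x) * p x))) (at t)"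
proof -
  note D = prob_densD[OF exp_tailsD(1)[OF p]]
  let ?m = "LINT x|lborel. x * (exp (t * x) * p x)"
  define C where "C = (LINT x|lborel. x ^ 2 * (exp ((t + 1) * x) * p x))"
  define u where "u s x = exp ((t + s) * x) * p x - exp (t * x) * p x - s * (x * (exp (t * x) * p x))" for s x
  note I0 = exp_tailsD(3)[OF p] and I1 = exp_tails_moment[OF p, of 1, simplified] and I2 = exp_tails_moment[OF p, of 2]
  have bound: "\<bar>mgf p (t + s) - mgf p t - s * ?m\<bar> \<le> s\<^sup>2 * C" if s: "\<bar>s\<bar> \<le> 1" for s
  proof -
    have eq: "mgf p (t + s) - mgf p t - s * ?m = (LINT x|lborel. u s x)"
      unfolding mgf_eq[OF p] u_def
      by (intro has_bochner_integral_integral_eq[symmetric] has_bochner_integral_diff has_bochner_integral_mult_right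
          has_bochner_integral_integrable I0 I1)
    have "norm (LINT x|lborel. u s x) \<le>
       (LINT x|lborel. s\<^sup>2 * (x ^ 2 * (exp ((t + 1) * x) * p x)))"
    proof (rule Bochner_Integration.integral_norm_bound_integral)
      show "integrable lborel (u s)"
        unfolding u_def by (intro Bochner_Integration.integrable_diff integrable_mult_right I0 I1)
      show "integrable lborel (\<lambda>x. s\<^sup>2 * (x ^ 2 * (exp ((t + 1) * x) * p x)))" by (intro integrable_mult_right I2)
      fix x :: real
      show "norm (u s x) \<le> s\<^sup>2 * (x ^ 2 * (exp ((t + 1) * x) * p x))"
      proof (cases "x < 0")
        case False
        have "u s x = (exp (t * x) * p x) * (exp (s * x) - 1 - s * x)"
          by (simp add: u_def algebra_simps exp_add)
        then have "norm (u s x) = (exp (t * x) * p x) * \<bar>exp (s * x) - 1 - s * x\<bar>"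
          using D(2)[of x] by (simp add: abs_mult)
        also have "\<dots> \<le> (exp (t * x) * p x) * ((s * x)\<^sup>2 * exp x)"
        proof (intro mult_left_mono)
          have "\<bar>s * x\<bar> \<le> 1 * x" unfolding abs_mult using False s by (intro mult_mono) auto
          then have "(s * x)\<^sup>2 * exp \<bar>s * x\<bar> \<le> (s * x)\<^sup>2 * exp x" by (intro mult_left_mono) auto
          then show "\<bar>exp (s * x) - 1 - s * x\<bar> \<le> (s * x)\<^sup>2 * exp x" using exp_remainder[of "s * x"] by linarith
        qed (use D(2) in auto)
        also have "\<dots> = s\<^sup>2 * (x ^ 2 * (exp ((t + 1) * x) * p x))"
          by (simp add: power_mult_distrib algebra_simps exp_add)
        finally show ?thesis .
      qed (simp add: u_def exp_tailsD(2)[OF p])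
    qed
    then show ?thesis unfolding eq by (simp add: C_def)
  qed
  have "(\<lambda>s. (mgf p (t + s) - mgf p t) / s - ?m) \<midarrow>0\<rightarrow> 0"
  proof (rule Lim_null_comparison)
    show "\<forall>\<^sub>F s in at 0. norm ((mgf p (t + s) - mgf p t) / s - ?m) \<le> \<bar>s\<bar> * C"
      unfolding eventually_at
    proof (intro exI[of _ 1] conjI ballI impI)
      fix s :: real assume s: "s \<noteq> 0 \<and> dist s 0 < 1"
      have "(mgf p (t + s) - mgf p t) / s - ?m = (mgf p (t + s) - mgf p t - s * ?m) / s"
        using s by (simp add: diff_divide_distrib)
      then have "norm ((mgf p (t + s) - mgf p t) / s - ?m) = \<bar>mgf p (t + s) - mgf p t - s * ?m\<bar> / \<bar>s\<bar>"
        by (simp only: real_norm_def abs_divide)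
      also have "\<dots> \<le> s\<^sup>2 * C / \<bar>s\<bar>" using bound[of s] s by (intro divide_right_mono) auto
      also have "s\<^sup>2 * C / \<bar>s\<bar> = \<bar>s\<bar> * C"
      proof -
        have *: "r * r * C / r = r * C" if "r \<noteq> 0" for r :: real using that by simp
        have "s\<^sup>2 = \<bar>s\<bar> * \<bar>s\<bar>" by (simp add: power2_eq_square)
        show ?thesis unfolding \<open>s\<^sup>2 = \<bar>s\<bar> * \<bar>s\<bar>\<close> by (rule *) (use s in simp)
      qed
      finally show "norm ((mgf p (t + s) - mgf p t) / s - ?m) \<le> \<bar>s\<bar> * C" .
    qed simp
    show "(\<lambda>s. \<bar>s\<bar> * C) \<midarrow>0\<rightarrow> 0" by (auto intro!: tendsto_eq_intros)
  qed
  then show ?thesis unfolding DERIV_def by (rule LIM_zero_cancel)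
qed

lemma tilt_mean_eq:
  assumes p: "exp_tails p"
  shows "tilt_mean p t = (LINT x|lborel. x * (exp (t * x) * p x)) / mgf p t"
proof -
  have "((\<lambda>s. ln (mgf p s)) has_real_derivative (LINT x|lborel. x * (exp (t * x) * p x)) / mgf p t) (at t)"
    using mgf_pos[OF p, of t] by (auto intro!: derivative_eq_intros mgf_deriv[OF p])
  then show ?thesis unfolding tilt_mean_def by (rule DERIV_imp_deriv)
qed

text \<open>The covariance of X and exp ((u - t) X) under the density tilted by t is positive.\<close>

lemma tilt_mean_strict_mono:
  assumes p: "exp_tails p" shows "strict_mono (tilt_mean p)"
proof (rule strict_monoI)
  fix t u :: real assume tu: "t < u"
  define \<mu> where "\<mu> = tilt_mean p t"
  \<comment> \<open>Since x - \<mu> integrates to 0 under the tilt by t, subtracting a constant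
    changes nothing; this constant gives both factors the same sign.\<close>
  define K where "K = exp ((u - t) * \<mu>)"
  note I0 = exp_tailsD(3)[OF p] and I1 = exp_tails_moment[OF p, of 1, simplified]
  let ?v = "\<lambda>x. (x - \<mu>) * (exp ((u - t) * x) - K) * exp (t * x)"
  have v: "?v x * p x = (x * (exp (u * x) * p x) - \<mu> * (exp (u * x) * p x)) - K * (x * (exp (t * x) * p x) - \<mu> * (exp (t * x) * p x))" for x
  proof -
    have "exp (u * x) = exp ((u - t) * x) * exp (t * x)" by (simp add: algebra_simps flip: exp_add)
    then show ?thesis by (simp add: algebra_simps)
  qed
  have I: "integrable lborel (\<lambda>x. ?v x * p x)"
    unfolding v by (intro Bochner_Integration.integrable_diff integrable_mult_right I0 I1)
  have sgn: "0 < (x - \<mu>) * (exp ((u - t) * x) - K)" if "x \<noteq> \<mu>" for x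
  proof (cases "x < \<mu>")
    case True
    then have "exp ((u - t) * x) < K" unfolding K_def using tu by simp
    then show ?thesis using True by (intro mult_neg_neg) auto
  next
    case False
    then have "K < exp ((u - t) * x)" unfolding K_def using tu that by simp
    then show ?thesis using False that by (intro mult_pos_pos) auto
  qed
  have "0 < (LINT x|lborel. ?v x * p x)"
  proof (rule integral_pos_of_dens[OF exp_tailsD(1)[OF p] I])
    show "0 < ?v x" if "x \<noteq> \<mu>" for x using sgn[OF that] by simp
    then show "0 \<le> ?v x" for x by (cases "x = \<mu>") (auto intro: less_imp_le)
  qed
  also have "(LINT x|lborel. ?v x * p x) = ((LINT x|lborel. x * (exp (u * x) * p x)) - \<mu> * mgf p u) - K * ((LINT x|lborel. x * (exp (t * x) * p x)) - \<mu> * mgf p t)"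
    unfolding v mgf_eq[OF p]
    by (intro has_bochner_integral_integral_eq has_bochner_integral_diff has_bochner_integral_mult_right
          has_bochner_integral_integrable I0 I1)
  also have "(LINT x|lborel. x * (exp (t * x) * p x)) = \<mu> * mgf p t"
    unfolding \<mu>_def tilt_mean_eq[OF p] using mgf_pos[OF p, of t] by simp
  finally have "\<mu> * mgf p u < (LINT x|lborel. x * (exp (u * x) * p x))" by simp
  then show "tilt_mean p t < tilt_mean p u"
    unfolding tilt_mean_eq[OF p, of u] \<mu>_def[symmetric] using mgf_pos[OF p, of u] by (simp add: pos_less_divide_eq)
qed

lemma tilted_density_eq:
  assumes p: "exp_tails p"
  shows "tilted_density p (tilt_mean p \<tau>) x = exp (\<tau> * x) * p x / mgf p \<tau>"
proof -
  have "(THE s. tilt_mean p s = tilt_mean p \<tau>) = \<tau>"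
    using strict_mono_eq[OF tilt_mean_strict_mono[OF p]] by (intro the_equality) auto
  then show ?thesis by (simp add: tilted_density_def)
qed

text \<open>Exponential factors pass through a convolution because exp (b (z - u)) exp (b u) does
  not depend on u; each of the j - 1 convolutions contributes 1 / \<sigma> from the change of
  variables.\<close>

lemma conv_power_affine:
  assumes \<sigma>: "\<sigma> > 0" and j: "j \<ge> 1"
  shows "conv_power (\<lambda>z. a * exp (b * z) * p (\<mu> + \<sigma> * z)) j z =
    a ^ j / \<sigma> ^ (j - 1) * exp (b * z) * conv_power p j (real j * \<mu> + \<sigma> * z)"
  using j
proof (induction j arbitrary: z rule: dec_induct)
  case (step j)
  let ?P = "\<lambda>z. a * exp (b * z) * p (\<mu> + \<sigma> * z)"
  obtain i where i: "j = Suc i" using step(1) by (cases j) auto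
  let ?c = "a ^ Suc j / \<sigma> ^ i * exp (b * z)"
  let ?r = "\<lambda>y. p (real (Suc j) * \<mu> + \<sigma> * z - y) * conv_power p j y"
  have "conv_power ?P (Suc j) z = (LINT u|lborel. ?P (z - u) * conv_power ?P j u)"
    using step(1) by (simp add: conv_power_Suc conv_def)
  also have "\<dots> = (LINT u|lborel. ?c * ?r (real j * \<mu> + \<sigma> * u))"
  proof (intro Bochner_Integration.integral_cong refl)
    fix u
    have 1: "exp (b * (z - u)) * exp (b * u) = exp (b * z)" by (simp add: algebra_simps flip: exp_add)
    have 2: "\<mu> + \<sigma> * (z - u) = real (Suc j) * \<mu> + \<sigma> * z - (real j * \<mu> + \<sigma> * u)" by (simp add: algebra_simps)
    have "?P (z - u) * conv_power ?P j u = a ^ Suc j / \<sigma> ^ i * (exp (b * (z - u)) * exp (b * u)) * (p (\<mu> + \<sigma> * (z - u)) * conv_power p j (real j * \<mu> + \<sigma> * u))"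
      unfolding step.IH by (simp add: i)
    then show "?P (z - u) * conv_power ?P j u = ?c * ?r (real j * \<mu> + \<sigma> * u)"
      unfolding 1 unfolding 2 .
  qed
  also have "\<dots> = ?c * (LINT u|lborel. ?r (real j * \<mu> + \<sigma> * u))" by (rule integral_mult_right_zero)
  also have "(LINT u|lborel. ?r (real j * \<mu> + \<sigma> * u)) = (LINT y|lborel. ?r y) / \<sigma>"
    using \<sigma> by (subst lborel_integral_real_affine[of \<sigma> ?r "real j * \<mu>"]) auto
  also have "(LINT y|lborel. ?r y) = conv_power p (Suc j) (real (Suc j) * \<mu> + \<sigma> * z)"
    using step(1) by (simp add: conv_power_Suc conv_def)
  finally show ?case by (simp add: i)
qed simp

lemma tilted_prob_dens:
  assumes p: "exp_tails p" shows "prob_dens (\<lambda>x. exp (\<tau> * x) * p x / mgf p \<tau>)"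
proof -
  note D = prob_densD[OF exp_tailsD(1)[OF p]]
  note [measurable] = D(1)
  show ?thesis
    unfolding prob_dens_def using D(2) mgf_pos[OF p, of \<tau>] exp_tailsD(3)[OF p, of \<tau>]
    by (auto simp flip: mgf_eq[OF p])
qed

lemma affine_prob_dens:
  assumes f: "prob_dens f" and \<sigma>: "\<sigma> > 0" shows "prob_dens (\<lambda>z. \<sigma> * f (m + \<sigma> * z))"
proof -
  note D = prob_densD[OF f]
  note [measurable] = D(1)
  show ?thesis
    unfolding prob_dens_def using D \<sigma> lborel_integral_real_affine[of \<sigma> f m] lborel_integrable_real_affine[OF D(3), of \<sigma> m]
    by auto
qed

lemma affine_mean:
  assumes f: "prob_dens f" and \<sigma>: "\<sigma> > 0" and I: "integrable lborel (\<lambda>x. x * f x)"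
  shows "(LINT z|lborel. z * (\<sigma> * f (m + \<sigma> * z))) = ((LINT x|lborel. x * f x) - m) / \<sigma>"
proof -
  note D = prob_densD[OF f]
  have "(LINT z|lborel. z * (\<sigma> * f (m + \<sigma> * z))) = (LINT z|lborel. ((m + \<sigma> * z) - m) * f (m + \<sigma> * z))"
    by (simp add: mult_ac)
  also have "\<dots> = (LINT x|lborel. (x - m) * f x) / \<sigma>"
    using \<sigma> by (subst (2) lborel_integral_real_affine[of \<sigma> _ m]) auto
  also have "(LINT x|lborel. (x - m) * f x) = (LINT x|lborel. x * f x) - m"
    unfolding left_diff_distrib using I D by (subst Bochner_Integration.integral_diff) auto
  finally show ?thesis .
qed

lemma exp_moment_nonneg: "A \<ge> 0 \<Longrightarrow> 0 \<le> exp_moment A \<kappa> j"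
  unfolding exp_moment_def by (intro mult_nonneg_nonneg Bochner_Integration.integral_nonneg) auto

text \<open>The envelope is centred at \<open>xh\<close>, later \<open>\<psi> \<tau>\<close>, where
  the exponent can be analysed; the mean of the tilted density is located only afterwards, by means
  of this bound.\<close>

definition tilt_dominated :: "(real \<Rightarrow> real) \<Rightarrow> real \<Rightarrow> real \<Rightarrow> real \<Rightarrow> real \<Rightarrow> real \<Rightarrow> bool" where
  "tilt_dominated p A \<kappa> \<sigma> xh \<tau> \<longleftrightarrow>
     (\<forall>x. exp (\<tau> * x) * p x / mgf p \<tau> \<le> A / \<sigma> * exp (- \<kappa> * (\<bar>x - xh\<bar> / \<sigma>)))"

text \<open>The first moment of the envelope bounds the distance between mean and \<open>xh\<close>
  in units of \<open>\<sigma>\<close>. By the triangle inequality, recentring at the mean costs only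
  the factor exp (\<kappa> M), with M that moment.\<close>

lemma tilted_mean_deviation:
  assumes p: "exp_tails p" and \<sigma>: "\<sigma> > 0" and k: "\<kappa> > 0"
    and dom: "tilt_dominated p A \<kappa> \<sigma> xh \<tau>"
  shows "\<bar>tilt_mean p \<tau> - xh\<bar> \<le> exp_moment A \<kappa> 1 * \<sigma>"
    and "exp_dens (A * exp (\<kappa> * exp_moment A \<kappa> 1)) \<kappa> (\<lambda>z. \<sigma> * (exp (\<tau> * (tilt_mean p \<tau> + \<sigma> * z)) * p (tilt_mean p \<tau> + \<sigma> * z) / mgf p \<tau>))"
    and "(LINT z|lborel. z * (\<sigma> * (exp (\<tau> * (tilt_mean p \<tau> + \<sigma> * z)) * p (tilt_mean p \<tau> + \<sigma> * z) / mgf p \<tau>))) = 0"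
proof -
  let ?f = "\<lambda>x. exp (\<tau> * x) * p x / mgf p \<tau>"
  define \<mu> where "\<mu> = tilt_mean p \<tau>"
  note le = dom[unfolded tilt_dominated_def, rule_format]
  have f: "prob_dens ?f" by (rule tilted_prob_dens[OF p])
  have I: "integrable lborel (\<lambda>x. x * ?f x)"
    using exp_tails_moment[OF p, of 1 \<tau>] by (simp add: integrable_divide)
  have mean: "(LINT x|lborel. x * ?f x) = \<mu>"
    unfolding \<mu>_def tilt_mean_eq[OF p] by simp
  define Q where "Q z = \<sigma> * ?f (xh + \<sigma> * z)" for z
  have Q: "exp_dens A \<kappa> Q"
  proof -
    have "Q z \<le> A * exp (- \<kappa> * \<bar>z\<bar>)" for z
      using mult_left_mono[OF le[of "xh + \<sigma> * z"], of \<sigma>] \<sigma> by (simp add: Q_def abs_mult)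
    then show ?thesis unfolding exp_dens_def using affine_prob_dens[OF f \<sigma>, of xh] by (simp add: Q_def[abs_def])
  qed
  have A0: "0 \<le> A"
  proof -
    have "0 \<le> ?f xh" using prob_densD(2)[OF f] by blast
    also have "\<dots> \<le> A / \<sigma>" using le[of xh] by simp
    finally show ?thesis using \<sigma> by (simp add: zero_le_divide_iff)
  qed
  define d where "d = (\<mu> - xh) / \<sigma>"
  have "d = (LINT z|lborel. z * Q z)"
    unfolding d_def Q_def affine_mean[OF f \<sigma> I] mean ..
  then have "\<bar>d\<bar> \<le> (LINT z|lborel. \<bar>z\<bar> ^ 1 * Q z)"
    using Bochner_Integration.integral_norm_bound_integral[of lborel "\<lambda>z. z * Q z" "\<lambda>z. \<bar>z\<bar> ^ 1 * Q z"]
      exp_dens_moment(1,3)[OF Q k, of 1] prob_densD(2)[of Q] Q by (simp add: abs_mult exp_dens_def)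
  also have "\<dots> \<le> exp_moment A \<kappa> 1" by (rule exp_dens_moment(2)[OF Q k])
  finally have d: "\<bar>d\<bar> \<le> exp_moment A \<kappa> 1" .
  then show "\<bar>tilt_mean p \<tau> - xh\<bar> \<le> exp_moment A \<kappa> 1 * \<sigma>"
    using \<sigma> by (simp add: d_def \<mu>_def[symmetric] abs_divide divide_le_eq)
  have "\<sigma> * ?f (\<mu> + \<sigma> * z) \<le> A * exp (\<kappa> * exp_moment A \<kappa> 1) * exp (- \<kappa> * \<bar>z\<bar>)" for z
  proof -
    have "xh + \<sigma> * (z + d) = \<mu> + \<sigma> * z"
    proof -
      have "\<sigma> * d = \<mu> - xh" using \<sigma> by (simp add: d_def)
      then show ?thesis by (simp add: distrib_left)
    qed
    then have "\<sigma> * ?f (\<mu> + \<sigma> * z) = Q (z + d)" by (simp add: Q_def)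
    also have "\<dots> \<le> A * exp (- \<kappa> * \<bar>z + d\<bar>)" using Q by (simp add: exp_dens_def)
    also have "\<dots> \<le> A * exp (\<kappa> * exp_moment A \<kappa> 1 + (- \<kappa> * \<bar>z\<bar>))"
    proof (intro mult_left_mono A0)
      have "\<bar>z\<bar> \<le> \<bar>z + d\<bar> + exp_moment A \<kappa> 1" using d by linarith
      then have "\<kappa> * \<bar>z\<bar> \<le> \<kappa> * (\<bar>z + d\<bar> + exp_moment A \<kappa> 1)" using k by (intro mult_left_mono) auto
      then show "exp (- \<kappa> * \<bar>z + d\<bar>) \<le> exp (\<kappa> * exp_moment A \<kappa> 1 + (- \<kappa> * \<bar>z\<bar>))" by (simp add: algebra_simps)
    qed
    finally show ?thesis by (simp only: exp_add mult.assoc)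
  qed
  then show "exp_dens (A * exp (\<kappa> * exp_moment A \<kappa> 1)) \<kappa> (\<lambda>z. \<sigma> * (exp (\<tau> * (tilt_mean p \<tau> + \<sigma> * z)) * p (tilt_mean p \<tau> + \<sigma> * z) / mgf p \<tau>))"
    unfolding exp_dens_def \<mu>_def[symmetric] using affine_prob_dens[OF f \<sigma>, of \<mu>] by auto
  show "(LINT z|lborel. z * (\<sigma> * (exp (\<tau> * (tilt_mean p \<tau> + \<sigma> * z)) * p (tilt_mean p \<tau> + \<sigma> * z) / mgf p \<tau>))) = 0"
    unfolding \<mu>_def[symmetric] affine_mean[OF f \<sigma> I] mean by simp
qed

text \<open>Tilting and rescaling multiply both convolution powers by explicit factors, so the ratio
  for \<open>p\<close> equals the ratio for the standardised density times exactly the tilted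
  density at \<open>y\<close>.\<close>

lemma conv_power_step:
  assumes p: "exp_tails p" and A: "A > 0" and k: "\<kappa> > 0"
  obtains D :: real and N0 :: nat where
    "\<And>\<tau> \<sigma> xh N y. \<sigma> > 0 \<Longrightarrow> tilt_dominated p A \<kappa> \<sigma> xh \<tau> \<Longrightarrow> N \<ge> N0 \<Longrightarrow>
       conv_power p N (real N * tilt_mean p \<tau>) > 0 \<and>
       (\<exists>r. p y * conv_power p (N - 1) (real N * tilt_mean p \<tau> - y) / conv_power p N (real N * tilt_mean p \<tau>) =
           tilted_density p (tilt_mean p \<tau>) y * (1 + r) \<and> \<bar>r\<bar> \<le> D * (1 + ((tilt_mean p \<tau> - y) / \<sigma>)\<^sup>2) / real N)"
proof -
  have A': "A * exp (\<kappa> * exp_moment A \<kappa> 1) > 0" using A by simp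
  show thesis
  proof (rule local_limit_ratio[OF A' k])
  fix D :: real and N0 :: nat
  assume R: "\<And>f N w. exp_dens (A * exp (\<kappa> * exp_moment A \<kappa> 1)) \<kappa> f \<Longrightarrow> (LINT z|lborel. z * f z) = 0 \<Longrightarrow> N \<ge> N0 \<Longrightarrow>
       conv_power f N 0 > 0 \<and> \<bar>conv_power f (N - 1) w / conv_power f N 0 - 1\<bar> \<le> D * (1 + w\<^sup>2) / real N"
  show thesis
  proof (rule that[of "N0 + 3" D])
    fix \<tau> \<sigma> xh y :: real and N :: nat
    assume \<sigma>: "\<sigma> > 0" and dom: "tilt_dominated p A \<kappa> \<sigma> xh \<tau>" and N: "N \<ge> N0 + 3"
    define \<mu> where "\<mu> = tilt_mean p \<tau>"
    define P where "P z = \<sigma> * (exp (\<tau> * (\<mu> + \<sigma> * z)) * p (\<mu> + \<sigma> * z) / mgf p \<tau>)" for z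
    define w where "w = (\<mu> - y) / \<sigma>"
    note T = tilted_mean_deviation[OF p \<sigma> k dom]
    have R1: "conv_power P N 0 > 0" "\<bar>conv_power P (N - 1) w / conv_power P N 0 - 1\<bar> \<le> D * (1 + w\<^sup>2) / real N"
      using R[OF T(2,3), of N] N by (auto simp: P_def[abs_def] \<mu>_def)
    define a where "a = \<sigma> * exp (\<tau> * \<mu>) / mgf p \<tau>"
    have a: "a > 0" using \<sigma> mgf_pos[OF p] by (simp add: a_def)
    have P: "P = (\<lambda>z. a * exp (\<tau> * \<sigma> * z) * p (\<mu> + \<sigma> * z))"
      by (intro ext) (simp add: P_def a_def algebra_simps exp_add)
    obtain i where i: "N = Suc (Suc i)" using N by (cases N; cases "N - 1") auto
    let ?c1 = "conv_power p (N - 1) (real N * \<mu> - y)" and ?c0 = "conv_power p N (real N * \<mu>)"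
    have e0: "conv_power P N 0 = a ^ N / \<sigma> ^ (N - 1) * ?c0"
      unfolding P using conv_power_affine[OF \<sigma>, of N a "\<tau> * \<sigma>" p \<mu> 0] N by simp
    \<comment> \<open>N - 1 variables have total mean (N - 1) \<mu>, and the target N \<mu> - y
      exceeds it by \<mu> - y; this dictates \<open>w\<close>.\<close>
    have sw: "real (N - 1) * \<mu> + \<sigma> * w = real N * \<mu> - y" "\<tau> * \<sigma> * w = \<tau> * (\<mu> - y)"
    proof -
      have "\<sigma> * w = \<mu> - y" using \<sigma> by (simp add: w_def)
      then show "real (N - 1) * \<mu> + \<sigma> * w = real N * \<mu> - y" "\<tau> * \<sigma> * w = \<tau> * (\<mu> - y)"
        by (simp add: i algebra_simps) (simp only: mult.assoc \<open>\<sigma> * w = \<mu> - y\<close>)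
    qed
    have e1: "conv_power P (N - 1) w = a ^ (N - 1) / \<sigma> ^ (N - 2) * exp (\<tau> * (\<mu> - y)) * ?c1"
      unfolding P using conv_power_affine[OF \<sigma>, of "N - 1" a "\<tau> * \<sigma>" p \<mu> w] N
      unfolding sw by (simp add: numeral_2_eq_2)
    have c0: "?c0 > 0" using R1(1) a \<sigma> unfolding e0 by (simp add: zero_less_mult_iff zero_less_divide_iff)
    define r where "r = conv_power P (N - 1) w / conv_power P N 0 - 1"
    have "1 + r = \<sigma> / a * exp (\<tau> * (\<mu> - y)) * (?c1 / ?c0)"
      unfolding r_def e0 e1 using a \<sigma> c0 by (simp add: i field_simps)
    also have "\<sigma> / a * exp (\<tau> * (\<mu> - y)) = mgf p \<tau> / exp (\<tau> * y)"
      using \<sigma> mgf_pos[OF p, of \<tau>] by (simp add: a_def right_diff_distrib exp_diff)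
    finally have r1: "1 + r = mgf p \<tau> / exp (\<tau> * y) * (?c1 / ?c0)" .
    have "tilted_density p \<mu> y * (1 + r) = p y * ?c1 / ?c0"
      unfolding r1 \<mu>_def tilted_density_eq[OF p] using mgf_pos[OF p, of \<tau>] by simp
    then show "conv_power p N (real N * tilt_mean p \<tau>) > 0 \<and>
       (\<exists>r. p y * conv_power p (N - 1) (real N * tilt_mean p \<tau> - y) / conv_power p N (real N * tilt_mean p \<tau>) =
           tilted_density p (tilt_mean p \<tau>) y * (1 + r) \<and> \<bar>r\<bar> \<le> D * (1 + ((tilt_mean p \<tau> - y) / \<sigma>)\<^sup>2) / real N)"
      using c0 R1(2) unfolding \<mu>_def[symmetric] r_def[symmetric] w_def[symmetric] by metis
  qed
  qed
qed

text \<open>The exponent t x - g x is concave beyond \<open>x0\<close> and maximal at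
  \<open>xh\<close>. Outside the window of radius \<sigma> its slope is at least 1 / (C \<sigma>) in
  modulus, which gives exponential decay; on the right half of the window it drops by at most C,
  which bounds \<open>mgf p t\<close> from below by a multiple of \<sigma> times the peak.\<close>

lemma tilted_exponential_bound:
  fixes p g q h :: "real \<Rightarrow> real"
  assumes p: "exp_tails p" and pB: "\<And>x. p x \<le> B" and c: "c > 0"
    and pform: "\<And>x. x \<ge> 0 \<Longrightarrow> p x = c * exp (- (g x - q x))"
    and x0: "x0 > 0" and gd: "\<And>x. x > 0 \<Longrightarrow> (g has_real_derivative h x) (at x)"
    and hmono: "\<And>x y. x0 \<le> x \<Longrightarrow> x \<le> y \<Longrightarrow> h x \<le> h y" and qb: "\<And>x. x \<ge> x0 \<Longrightarrow> \<bar>q x\<bar> \<le> 1"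
    and t: "t > 0" and \<sigma>: "\<sigma> > 0" and C: "C \<ge> 1" and xh: "xh - \<sigma> \<ge> x0" "h xh = t"
    and up: "h (xh + \<sigma>) \<ge> t + 1 / (C * \<sigma>)" "h (xh + \<sigma>) \<le> t + C / \<sigma>"
    and down: "h (xh - \<sigma>) \<le> t - 1 / (C * \<sigma>)" and big: "(x0 + 1) / (C * \<sigma>) \<le> t"
  shows "exp (t * x) * p x / mgf p t \<le>
     (c * exp (1 + 1 / C) + B * exp (1 / C + g (x0 + 1))) * exp (1 + C) / c / \<sigma> * exp (- (1 / C) * (\<bar>x - xh\<bar> / \<sigma>))"
proof -
  define K where "K x = t * x - g x" for x
  define d where "d x = - (1 / C) * (\<bar>x - xh\<bar> / \<sigma>)" for x
  define A where "A = c * exp (1 + 1 / C) + B * exp (1 / C + g (x0 + 1))"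
  \<comment> \<open>Concavity in the form of the mean value theorem with monotone
    \<open>h\<close>.\<close>
  have MV: "K b - K a \<le> (b - a) * (t - h a)" "(b - a) * (t - h b) \<le> K b - K a" if "x0 \<le> a" "a \<le> b" for a b
  proof -
    have "K b - K a \<le> (b - a) * (t - h a) \<and> (b - a) * (t - h b) \<le> K b - K a"
    proof (cases "a = b")
      case False
      have "\<exists>z>a. z < b \<and> K b - K a = (b - a) * (t - h z)"
      proof (rule MVT2)
        show "a < b" using that False by simp
        show "(K has_real_derivative t - h x) (at x)" if "a \<le> x" "x \<le> b" for x
          unfolding K_def using that \<open>x0 \<le> a\<close> x0 by (auto intro!: derivative_eq_intros gd)
      qed
      then obtain z where z: "a < z" "z < b" "K b - K a = (b - a) * (t - h z)" by blast
      have "h a \<le> h z" "h z \<le> h b" using z that by (auto intro!: hmono)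
      then show ?thesis unfolding z(3) using that by (auto intro!: mult_left_mono)
    qed simp
    then show "K b - K a \<le> (b - a) * (t - h a)" "(b - a) * (t - h b) \<le> K b - K a" by auto
  qed
  have C\<sigma>: "C * \<sigma> > 0" using C \<sigma> by simp
  have upper: "K x \<le> K xh - (\<bar>x - xh\<bar> - \<sigma>) / (C * \<sigma>)" if "x \<ge> x0" for x
  proof -
    have K1: "K (xh + \<sigma>) \<le> K xh" using MV(1)[of xh "xh + \<sigma>"] xh \<sigma> by simp
    have K2: "K (xh - \<sigma>) \<le> K xh" using MV(2)[of "xh - \<sigma>" xh] xh \<sigma> by simp
    consider "x \<ge> xh + \<sigma>" | "xh \<le> x" "x \<le> xh + \<sigma>" | "xh - \<sigma> \<le> x" "x \<le> xh" | "x \<le> xh - \<sigma>" by linarith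
    then show ?thesis
    proof cases
      case 1
      have "K x - K (xh + \<sigma>) \<le> (x - (xh + \<sigma>)) * (t - h (xh + \<sigma>))" using MV(1)[of "xh + \<sigma>" x] 1 xh \<sigma> by simp
      also have "\<dots> \<le> (x - (xh + \<sigma>)) * (- (1 / (C * \<sigma>)))" using 1 up by (intro mult_left_mono) auto
      also have "\<dots> = - ((\<bar>x - xh\<bar> - \<sigma>) / (C * \<sigma>))" using 1 \<sigma> by simp
      finally show ?thesis using K1 by linarith
    next
      case 2
      have "K x \<le> K xh" using MV(1)[of xh x] 2 xh \<sigma> by simp
      moreover have "(\<bar>x - xh\<bar> - \<sigma>) / (C * \<sigma>) \<le> 0" using 2 C\<sigma> by (intro divide_nonpos_pos) auto
      ultimately show ?thesis by linarith
    next
      case 3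
      have "K x \<le> K xh" using MV(2)[of x xh] 3 xh that by simp
      moreover have "(\<bar>x - xh\<bar> - \<sigma>) / (C * \<sigma>) \<le> 0" using 3 C\<sigma> by (intro divide_nonpos_pos) auto
      ultimately show ?thesis by linarith
    next
      case 4
      have "((xh - \<sigma>) - x) * (1 / (C * \<sigma>)) \<le> ((xh - \<sigma>) - x) * (t - h (xh - \<sigma>))"
        using 4 down by (intro mult_left_mono) auto
      also have "\<dots> \<le> K (xh - \<sigma>) - K x" using MV(2)[of x "xh - \<sigma>"] 4 that by simp
      finally have "((xh - \<sigma>) - x) * (1 / (C * \<sigma>)) \<le> K (xh - \<sigma>) - K x" .
      moreover have eq: "(xh - \<sigma>) - x = \<bar>x - xh\<bar> - \<sigma>" using 4 \<sigma> by linarith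
      ultimately have "(\<bar>x - xh\<bar> - \<sigma>) / (C * \<sigma>) \<le> K (xh - \<sigma>) - K x"
        by (simp only: eq times_divide_eq_right mult_1_right)
      then show ?thesis using K2 by linarith
    qed
  qed
  have lower: "K xh - C \<le> K x" if "xh \<le> x" "x \<le> xh + \<sigma>" for x
  proof -
    have "h x \<le> t + C / \<sigma>" using hmono[of x "xh + \<sigma>"] that xh \<sigma> up by linarith
    then have "(x - xh) * (- (C / \<sigma>)) \<le> (x - xh) * (t - h x)" using that by (intro mult_left_mono) auto
    also have "\<dots> \<le> K x - K xh" using MV(2)[of xh x] that xh \<sigma> by simp
    finally have "- ((x - xh) * (C / \<sigma>)) \<le> K x - K xh" by simp
    moreover have "(x - xh) * (C / \<sigma>) \<le> \<sigma> * (C / \<sigma>)" using that C \<sigma> by (intro mult_right_mono) auto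
    ultimately show ?thesis using \<sigma> by simp
  qed
  have pK: "exp (t * x) * p x = c * exp (K x + q x)" if "x \<ge> 0" for x
    using pform[OF that] by (simp add: K_def algebra_simps flip: exp_add)
  have B: "B \<ge> 0" using pB[of 0] prob_densD(2)[OF exp_tailsD(1)[OF p], of 0] by linarith
  have split: "a - (\<bar>x - xh\<bar> - \<sigma>) / (C * \<sigma>) = a + (1 / C + d x)" for x a
    using C \<sigma> by (simp add: d_def diff_divide_distrib)
  have A0: "0 < A" unfolding A_def using c B by (intro add_pos_nonneg) auto
  have ub: "exp (t * x) * p x \<le> exp (K xh) * A * exp (d x)"
  proof -
    consider "x < 0" | "0 \<le> x" "x < x0" | "x0 \<le> x" by linarith
    then show ?thesis
    proof cases
      case 1
      then show ?thesis using exp_tailsD(2)[OF p] A0 by simp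
    next
      case 2
      \<comment> \<open>Below \<open>x0\<close> only boundedness of \<open>p\<close> is available,
        so exp (t x) is compared with the exponent at x0 + 1. The surplus t gained by this unit step
        pays, by \<open>big\<close>, for the extra distance to \<open>xh\<close>.\<close>
      have "t * x0 = K (x0 + 1) - t + g (x0 + 1)" by (simp add: K_def algebra_simps)
      also have "\<dots> \<le> K xh - (\<bar>x0 + 1 - xh\<bar> - \<sigma>) / (C * \<sigma>) - t + g (x0 + 1)"
        using upper[of "x0 + 1"] by simp
      also have "\<dots> \<le> K xh - (\<bar>x - xh\<bar> - \<sigma>) / (C * \<sigma>) + g (x0 + 1)"
      proof -
        have "\<bar>x - xh\<bar> - \<sigma> \<le> (\<bar>x0 + 1 - xh\<bar> - \<sigma>) + (x0 + 1)" using 2 by linarith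
        then have "(\<bar>x - xh\<bar> - \<sigma>) / (C * \<sigma>) \<le> ((\<bar>x0 + 1 - xh\<bar> - \<sigma>) + (x0 + 1)) / (C * \<sigma>)"
          using C\<sigma> by (intro divide_right_mono) auto
        then show ?thesis using big by (simp add: add_divide_distrib)
      qed
      finally have tx0: "t * x0 \<le> K xh + (1 / C + d x) + g (x0 + 1)"
        unfolding split .
      have "exp (t * x) * p x \<le> exp (t * x0) * B"
        using 2 t pB[of x] prob_densD(2)[OF exp_tailsD(1)[OF p], of x] by (intro mult_mono) auto
      also have "\<dots> \<le> exp (K xh + (1 / C + d x) + g (x0 + 1)) * B"
        using tx0 B by (intro mult_right_mono) auto
      also have "\<dots> = exp (K xh) * (B * exp (1 / C + g (x0 + 1))) * exp (d x)"
        by (simp only: exp_add) (simp only: mult_ac)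
      also have "\<dots> \<le> exp (K xh) * A * exp (d x)"
        unfolding A_def using c by (intro mult_right_mono mult_left_mono) auto
      finally show ?thesis .
    next
      case 3
      have "K x + q x \<le> K xh + (1 / C + d x) + 1"
        using upper[OF 3] qb[OF 3] unfolding split by linarith
      then have "c * exp (K x + q x) \<le> c * exp (K xh + (1 / C + d x) + 1)"
        using c by (intro mult_left_mono) auto
      also have "\<dots> = exp (K xh) * (c * exp (1 + 1 / C)) * exp (d x)"
        by (simp only: exp_add) (simp only: mult_ac)
      also have "\<dots> \<le> exp (K xh) * A * exp (d x)"
        unfolding A_def using B by (intro mult_right_mono mult_left_mono) auto
      finally show ?thesis using pK[of x] 3 x0 by simp
    qed
  qed
  \<comment> \<open>Integrate only over the right half of the window, where the exponent stays
    within C of its maximum and \<open>q\<close> costs at most 1.\<close>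
  have lb: "\<sigma> * (c * exp (K xh) / exp (1 + C)) \<le> mgf p t"
  proof -
    have "\<sigma> * (c * exp (K xh) / exp (1 + C)) = (LINT x|lborel. (c * exp (K xh) / exp (1 + C)) * indicator {xh..xh+\<sigma>} x)"
      using \<sigma> by simp
    also have "\<dots> \<le> (LINT x|lborel. exp (t * x) * p x)"
    proof (intro integral_mono exp_tailsD(3)[OF p])
      show "integrable lborel (\<lambda>x. (c * exp (K xh) / exp (1 + C)) * indicator {xh..xh+\<sigma>} x :: real)"
        using \<sigma> by (intro integrable_mult_right integrable_real_indicator) auto
      fix x
      show "(c * exp (K xh) / exp (1 + C)) * indicator {xh..xh+\<sigma>} x \<le> exp (t * x) * p x"
      proof (cases "x \<in> {xh..xh+\<sigma>}")
        case True
        have "K xh - (1 + C) \<le> K x + q x" using lower[of x] qb[of x] True xh \<sigma> by auto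
        then have "c * exp (K xh - (1 + C)) \<le> c * exp (K x + q x)" using c by (intro mult_left_mono) auto
        then show ?thesis using True pK[of x] xh \<sigma> x0 by (simp add: exp_diff)
      qed (use prob_densD(2)[OF exp_tailsD(1)[OF p]] in simp)
    qed
    finally show ?thesis unfolding mgf_eq[OF p] .
  qed
  have "exp (t * x) * p x / mgf p t \<le> (exp (K xh) * A * exp (d x)) / (\<sigma> * (c * exp (K xh) / exp (1 + C)))"
    using ub lb \<sigma> c A0 by (intro frac_le) auto
  also have "\<dots> = A * exp (1 + C) / c / \<sigma> * exp (d x)"
  proof -
    have "(k * a * e) / (s * (c * k / d)) = a * d / c / s * e" if "k > 0" "d > 0" "s > 0" "c > 0" for k a e s c d :: real
      using that by (simp add: field_simps)
    then show ?thesis using \<sigma> c by (metis exp_gt_zero)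
  qed
  finally show ?thesis unfolding A_def d_def .
qed

text \<open>If \<open>h\<close> stayed bounded, the mean value theorem would bound g x / x.
  Monotonicity then upgrades unboundedness to divergence.\<close>

lemma mono_derivative_unbounded:
  fixes g h :: "real \<Rightarrow> real"
  assumes g: "filterlim (\<lambda>x. g x / x) at_top at_top" and gd: "\<And>x. x > 0 \<Longrightarrow> (g has_real_derivative h x) (at x)"
    and x0: "x0 > 0" and hmono: "\<And>x y. x0 \<le> x \<Longrightarrow> x \<le> y \<Longrightarrow> h x \<le> h y"
  shows "filterlim h at_top at_top"
proof -
  have ex: "\<exists>x\<ge>x0. L \<le> h x" for L
  proof (rule ccontr)
    assume "\<not> ?thesis"
    then have hL: "h x \<le> \<bar>L\<bar>" if "x \<ge> x0" for x using that by (meson abs_ge_self linear order_trans)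
    have "g x / x \<le> \<bar>g x0\<bar> / x0 + \<bar>L\<bar>" if x: "x > x0" for x
    proof -
      obtain z where z: "x0 < z" "z < x" "g x - g x0 = (x - x0) * h z"
        using MVT2[of x0 x g h] gd x x0 by force
      have "(x - x0) * h z \<le> (x - x0) * \<bar>L\<bar>" using hL[of z] z x by (intro mult_left_mono) auto
      also have "\<dots> \<le> x * \<bar>L\<bar>" using x x0 by (intro mult_right_mono) auto
      finally have "g x \<le> \<bar>g x0\<bar> + x * \<bar>L\<bar>" using z(3) by linarith
      then have "g x / x \<le> (\<bar>g x0\<bar> + x * \<bar>L\<bar>) / x" using x x0 by (intro divide_right_mono) auto
      also have "\<dots> = \<bar>g x0\<bar> / x + \<bar>L\<bar>" using x x0 by (simp add: add_divide_distrib)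
      also have "\<dots> \<le> \<bar>g x0\<bar> / x0 + \<bar>L\<bar>" using x x0 by (intro add_right_mono divide_left_mono) auto
      finally show ?thesis .
    qed
    moreover have "\<forall>\<^sub>F x in at_top. \<bar>g x0\<bar> / x0 + \<bar>L\<bar> + 1 \<le> g x / x"
      using g unfolding filterlim_at_top by blast
    moreover have "\<forall>\<^sub>F x in at_top. x0 < x" by (rule eventually_gt_at_top)
    ultimately have "\<forall>\<^sub>F x::real in at_top. False"
      by (smt (verit, best) eventually_elim2)
    then show False by simp
  qed
  show ?thesis unfolding filterlim_at_top
  proof
    fix L
    obtain x where x: "x \<ge> x0" "L \<le> h x" using ex by blast
    show "\<forall>\<^sub>F y in at_top. L \<le> h y"
      using eventually_ge_at_top[of x] by eventually_elim (use x hmono order_trans in blast)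
  qed
qed

section \<open>Regular variation\<close>

text \<open>The common interface of both regularity classes: later arguments use \<open>h\<close>
  only through it. \<open>x0\<close> bounds the region where \<open>h\<close> is monotone,
  \<open>t0\<close> the region where \<open>\<psi>\<close> is a differentiable right inverse of
  \<open>h\<close>.\<close>

definition growth_scale ::
  "(real \<Rightarrow> real) \<Rightarrow> (real \<Rightarrow> real) \<Rightarrow> (real \<Rightarrow> real) \<Rightarrow> real \<Rightarrow> real \<Rightarrow> real \<Rightarrow> bool" where
  "growth_scale h \<psi> \<psi>' C x0 t0 \<longleftrightarrow> C \<ge> 1 \<and> x0 \<ge> 1 \<and> t0 > 0 \<and>
     (\<forall>x y. x0 \<le> x \<and> x \<le> y \<longrightarrow> h x \<le> h y) \<and>
     (\<forall>u\<ge>t0. (\<psi> has_real_derivative \<psi>' u) (at u) \<and> 0 < \<psi>' u \<and> h (\<psi> u) = u \<and> x0 \<le> \<psi> u) \<and>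
     (\<forall>t u. t0 \<le> t \<and> t0 \<le> u \<and> u \<le> 2 * t \<and> t \<le> 2 * u \<longrightarrow> \<psi>' u \<le> C * \<psi>' t) \<and>
     filterlim (\<lambda>t. t * sqrt (\<psi>' t)) at_top at_top \<and> filterlim \<psi> at_top at_top"

text \<open>\<open>e\<close> is the elasticity u \<psi>' / \<psi>. Its upper bound controls \<psi>
  over a factor 2, its comparability then controls \<psi>', and t^2 \<psi>' = (t e) \<psi> diverges
  as a product of two divergent factors.\<close>

lemma growth_scale_of_elasticity:
  fixes h \<psi> e :: "real \<Rightarrow> real"
  assumes u0: "u0 > 0" and x0: "x0 \<ge> 1"
    and der: "\<And>u. u \<ge> u0 \<Longrightarrow> (\<psi> has_real_derivative \<psi> u * e u / u) (at u)"
    and pos: "\<And>u. u \<ge> u0 \<Longrightarrow> 0 < e u" "\<And>u. u \<ge> u0 \<Longrightarrow> e u \<le> E"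
    and comp: "\<And>t u. u0 \<le> t \<Longrightarrow> u0 \<le> u \<Longrightarrow> u \<le> 2 * t \<Longrightarrow> t \<le> 2 * u \<Longrightarrow> e u \<le> C1 * e t"
    and lim: "filterlim (\<lambda>t. t * e t) at_top at_top" "filterlim \<psi> at_top at_top"
    and hmono: "\<And>x y. x0 \<le> x \<Longrightarrow> x \<le> y \<Longrightarrow> h x \<le> h y"
    and inv: "\<And>u. u \<ge> u0 \<Longrightarrow> h (\<psi> u) = u" "\<And>u. u \<ge> u0 \<Longrightarrow> x0 \<le> \<psi> u"
  shows "\<exists>C. growth_scale h \<psi> (\<lambda>u. \<psi> u * e u / u) C x0 u0"
proof -
  have \<psi>0: "0 < \<psi> u" if "u \<ge> u0" for u using inv(2)[OF that] x0 by linarith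
  have E: "0 < E" using pos[of u0] by linarith
  have C1: "C1 \<ge> 1" using comp[of u0 u0] pos(1)[of u0] u0 by simp
  \<comment> \<open>This is 2 powr E, the largest growth over a doubling when the elasticity is at
    most E.\<close>
  define M where "M = exp (E * ln 2)"
  have M1: "M \<ge> 1" unfolding M_def using E by simp
  have \<psi>le: "\<psi> u \<le> M * \<psi> t" if "u0 \<le> t" "u0 \<le> u" "u \<le> 2 * t" for t u
  proof (cases "u \<le> t")
    case True
    have "\<psi> u \<le> \<psi> t"
    proof (rule DERIV_nonneg_imp_nondecreasing[OF True])
      fix x assume x: "u \<le> x" "x \<le> t"
      then show "\<exists>y. (\<psi> has_real_derivative y) (at x) \<and> 0 \<le> y"
        using der[of x] that \<psi>0[of x] pos(1)[of x] u0 by (intro exI[of _ "\<psi> x * e x / x"]) auto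
    qed
    also have "\<dots> \<le> M * \<psi> t" using M1 \<psi>0[OF that(1)] by simp
    finally show ?thesis .
  next
    case False
    let ?F = "\<lambda>x. E * ln x - ln (\<psi> x)"
    have "?F t \<le> ?F u"
    proof (rule DERIV_nonneg_imp_nondecreasing[of t u ?F])
      show "t \<le> u" using False by simp
      fix x assume x: "t \<le> x" "x \<le> u"
      then have x': "x \<ge> u0" "x > 0" using that u0 by auto
      have "(?F has_real_derivative E * (1 / x) - (1 / \<psi> x) * (\<psi> x * e x / x)) (at x)"
        using x' \<psi>0[OF x'(1)] by (auto intro!: derivative_eq_intros der)
      moreover have "(1 / \<psi> x) * (\<psi> x * e x / x) = e x / x" using \<psi>0[OF x'(1)] by simp
      moreover have "e x / x \<le> E * (1 / x)" using pos(2)[OF x'(1)] x' by (simp add: divide_right_mono)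
      ultimately show "\<exists>y. (?F has_real_derivative y) (at x) \<and> 0 \<le> y" by (metis diff_ge_0_iff_ge)
    qed
    then have "ln (\<psi> u) \<le> ln (\<psi> t) + E * (ln u - ln t)" by (simp add: algebra_simps)
    also have "E * (ln u - ln t) \<le> E * ln 2"
    proof (intro mult_left_mono)
      have "ln u \<le> ln (2 * t)" using that u0 by simp
      also have "\<dots> = ln 2 + ln t" using that u0 by (simp add: ln_mult)
      finally show "ln u - ln t \<le> ln 2" by simp
    qed (use E in simp)
    finally have "ln (\<psi> u) \<le> ln (\<psi> t) + E * ln 2" by simp
    then have "exp (ln (\<psi> u)) \<le> exp (ln (\<psi> t) + E * ln 2)" by simp
    then show ?thesis using \<psi>0 that by (simp add: exp_add M_def mult.commute)
  qed
  \<comment> \<open>The factors come from 1 / u <= 2 / t, from \<psi> and from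
    \<open>e\<close>.\<close>
  define C where "C = 2 * M * C1"
  have Ccomp: "\<psi> u * e u / u \<le> C * (\<psi> t * e t / t)" if "u0 \<le> t" "u0 \<le> u" "u \<le> 2 * t" "t \<le> 2 * u" for t u
  proof -
    have "\<psi> u * e u / u \<le> (M * \<psi> t) * (C1 * e t) / (t / 2)"
      using \<psi>le[OF that(1-3)] comp[OF that] that u0 \<psi>0[OF that(1)] \<psi>0[OF that(2)] pos(1)[OF that(1)] pos(1)[OF that(2)] M1 C1
      by (intro frac_le mult_mono) auto
    also have "\<dots> = C * (\<psi> t * e t / t)" by (simp add: C_def)
    finally show ?thesis .
  qed
  have "filterlim (\<lambda>t. (t * e t) * \<psi> t) at_top at_top"
    by (intro filterlim_at_top_mult_at_top lim)
  then have "filterlim (\<lambda>t. sqrt ((t * e t) * \<psi> t)) at_top at_top"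
    by (rule filterlim_compose[OF sqrt_at_top])
  moreover have "\<forall>\<^sub>F t in at_top. sqrt ((t * e t) * \<psi> t) = t * sqrt (\<psi> t * e t / t)"
    using eventually_ge_at_top[of u0]
  proof eventually_elim
    case (elim t)
    have "t * sqrt (\<psi> t * e t / t) = sqrt (t\<^sup>2) * sqrt (\<psi> t * e t / t)" using elim u0 by simp
    also have "\<dots> = sqrt (t\<^sup>2 * (\<psi> t * e t / t))" by (simp only: real_sqrt_mult)
    also have "t\<^sup>2 * (\<psi> t * e t / t) = (t * e t) * \<psi> t" using elim u0 by (simp add: power2_eq_square)
    finally show ?case ..
  qed
  ultimately have tlim: "filterlim (\<lambda>t. t * sqrt (\<psi> t * e t / t)) at_top at_top"
    by (rule filterlim_mono_eventually[OF _ order_refl order_refl])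
  have "1 * 1 \<le> M * C1" using M1 C1 by (intro mult_mono) auto
  then have "C \<ge> 1" by (simp add: C_def)
  moreover have "0 < \<psi> u * e u / u" if "u \<ge> u0" for u using that u0 \<psi>0 pos(1) by simp
  ultimately have "growth_scale h \<psi> (\<lambda>u. \<psi> u * e u / u) C x0 u0"
    unfolding growth_scale_def using x0 u0 hmono der inv Ccomp tlim lim(2) by auto
  then show ?thesis by blast
qed

lemma R0_rep_deriv:
  assumes R: "R0_rep l e e' e''" and x: "x > 1"
  shows "(e has_real_derivative e' x) (at x)" "(l has_real_derivative l x * (e x / x)) (at x)"
proof -
  have d: "(e has_real_derivative e' u) (at u within {1..})" if "u \<ge> 1" for u
    using R that by (simp add: R0_rep_def)
  have le: "l u = exp (integral {1..u} (\<lambda>u. e u / u))" if "u \<ge> 1" for u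
    using R that by (simp add: R0_rep_def)
  have "at x within {1..} = at x" using x by (intro at_within_interior) simp
  then show "(e has_real_derivative e' x) (at x)" using d[of x] x by simp
  have "continuous_on {1..} e" using d by (intro DERIV_continuous_on) auto
  then have "continuous_on {1..x+1} e" by (rule continuous_on_subset) auto
  then have "continuous_on {1..x+1} (\<lambda>u. e u / u)" by (intro continuous_intros) auto
  then have "((\<lambda>y. integral {1..y} (\<lambda>u. e u / u)) has_real_derivative e x / x) (at x within {1..x+1})"
    using x by (intro integral_has_real_derivative) auto
  moreover have "at x within {1..x+1} = at x" using x by (intro at_within_interior) simp
  ultimately have "((\<lambda>y. integral {1..y} (\<lambda>u. e u / u)) has_real_derivative e x / x) (at x)" by simp
  then have "((\<lambda>y. exp (integral {1..y} (\<lambda>u. e u / u))) has_real_derivative l x * (e x / x)) (at x)"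
    using le[of x] x by (auto intro!: derivative_eq_intros)
  then show "(l has_real_derivative l x * (e x / x)) (at x)"
  proof (rule has_field_derivative_transform_within_open[where S="{1<..}"])
    show "exp (integral {1..y} (\<lambda>u. e u / u)) = l y" if "y \<in> {1<..}" for y
      using le[of y] that by simp
  qed (use x in auto)
qed

text \<open>The hypothesis says that ln f is 1-Lipschitz as a function of ln x, so a change of the
  argument by a factor at most 2 changes f by a factor at most 2.\<close>

lemma log_lipschitz_doubling:
  fixes f f' :: "real \<Rightarrow> real"
  assumes u0: "u0 > 0" and der: "\<And>x. x \<ge> u0 \<Longrightarrow> (f has_real_derivative f' x) (at x)"
    and pos: "\<And>x. x \<ge> u0 \<Longrightarrow> 0 < f x" and bd: "\<And>x. x \<ge> u0 \<Longrightarrow> \<bar>x * f' x / f x\<bar> \<le> 1"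
    and tu: "u0 \<le> t" "u0 \<le> u" "u \<le> 2 * t" "t \<le> 2 * u"
  shows "f u \<le> 2 * f t"
proof -
  have mono: "ln a - ln (f a) \<le> ln b - ln (f b) \<and> ln a + ln (f a) \<le> ln b + ln (f b)" if "u0 \<le> a" "a \<le> b" for a b
  proof -
    have D: "(f has_real_derivative f' x) (at x)" "0 < f x" "\<bar>f' x / f x\<bar> \<le> 1 / x" "0 < x" if "a \<le> x" for x
    proof -
      have x: "x \<ge> u0" "0 < x" using that \<open>u0 \<le> a\<close> u0 by auto
      show "(f has_real_derivative f' x) (at x)" "0 < f x" "0 < x" using der[OF x(1)] pos[OF x(1)] x by auto
      have "x * \<bar>f' x / f x\<bar> \<le> 1" using bd[OF x(1)] x by (simp add: abs_mult abs_divide)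
      then show "\<bar>f' x / f x\<bar> \<le> 1 / x" using x by (simp add: pos_le_divide_eq mult.commute)
    qed
    have "ln a - ln (f a) \<le> ln b - ln (f b)"
    proof (rule DERIV_nonneg_imp_nondecreasing[OF that(2)])
      fix x assume x: "a \<le> x" "x \<le> b"
      have "((\<lambda>x. ln x - ln (f x)) has_real_derivative 1 / x - f' x / f x) (at x)"
        using D[OF x(1)] by (auto intro!: derivative_eq_intros)
      moreover have "0 \<le> 1 / x - f' x / f x" using D(3)[OF x(1)] by linarith
      ultimately show "\<exists>y. ((\<lambda>x. ln x - ln (f x)) has_real_derivative y) (at x) \<and> 0 \<le> y" by blast
    qed
    moreover have "ln a + ln (f a) \<le> ln b + ln (f b)"
    proof (rule DERIV_nonneg_imp_nondecreasing[OF that(2)])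
      fix x assume x: "a \<le> x" "x \<le> b"
      have "((\<lambda>x. ln x + ln (f x)) has_real_derivative 1 / x + f' x / f x) (at x)"
        using D[OF x(1)] by (auto intro!: derivative_eq_intros)
      moreover have "0 \<le> 1 / x + f' x / f x" using D(3)[OF x(1)] by linarith
      ultimately show "\<exists>y. ((\<lambda>x. ln x + ln (f x)) has_real_derivative y) (at x) \<and> 0 \<le> y" by blast
    qed
    ultimately show ?thesis ..
  qed
  have ln2: "ln u \<le> ln 2 + ln t" "ln t \<le> ln 2 + ln u"
  proof -
    have "ln u \<le> ln (2 * t)" using tu u0 by simp
    then show "ln u \<le> ln 2 + ln t" using tu u0 by (simp add: ln_mult)
    have "ln t \<le> ln (2 * u)" using tu u0 by simp
    then show "ln t \<le> ln 2 + ln u" using tu u0 by (simp add: ln_mult)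
  qed
  have "ln (f u) \<le> ln 2 + ln (f t)"
  proof (cases "u \<le> t")
    case True
    show ?thesis using mono[OF tu(2) True] ln2 by linarith
  next
    case False
    then show ?thesis using mono[OF tu(1), of u] ln2 by linarith
  qed
  also have "\<dots> = ln (2 * f t)" using pos[OF tu(1)] by (simp add: ln_mult)
  finally show ?thesis using pos[OF tu(1)] pos[OF tu(2)] by simp
qed

text \<open>This class is defined through the inverse, so the representing function \<open>e\<close>
  of \<open>\<psi>\<close> already is the elasticity. Eventually |x e' / e| < 1 yields comparability
  over doublings, and the liminf condition with \<eta> < 1 makes t e t diverge.\<close>

lemma growth_scale_R_infty:
  fixes g h \<psi> :: "real \<Rightarrow> real"
  assumes hR: "h \<in> R_infty" and \<psi>: "\<psi> = gen_inverse h"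
    and inv: "\<forall>\<^sub>F x in at_top. \<psi> (h x) = x" and hlim: "filterlim h at_top at_top"
    and X: "X \<ge> 1"
  shows "\<exists>\<psi>' C x0 t0. growth_scale h \<psi> \<psi>' C x0 t0 \<and> X \<le> x0"
proof -
  have hs: "strict_mono_on {0<..} h" and R: "\<psi> \<in> R0_tilde" using hR by (auto simp: R_infty_def \<psi>)
  obtain e e' e'' \<eta> where e: "R0_rep \<psi> e e' e''" and lim: "filterlim \<psi> at_top at_top"
    and e1: "((\<lambda>x. x * e' x / e x) \<longlongrightarrow> 0) at_top"
    and \<eta>: "0 < \<eta>" "\<eta> < 1/8" "Liminf at_top (\<lambda>x. ereal (x powr \<eta> * e x)) > 0"
    using R unfolding R0_tilde_def by blast
  obtain d where d: "0 < ereal d" "ereal d < Liminf at_top (\<lambda>x. ereal (x powr \<eta> * e x))"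
    using ereal_dense2[OF \<eta>(3)] by blast
  have ev1: "\<forall>\<^sub>F x in at_top. d < x powr \<eta> * e x"
    using less_LiminfD[OF d(2)] by simp
  have ev2: "\<forall>\<^sub>F x in at_top. \<bar>x * e' x / e x\<bar> < 1"
    using order_tendstoD(2)[OF tendsto_rabs[OF e1], of 1] by simp
  have "(e \<longlongrightarrow> 0) at_top" using e by (simp add: R0_rep_def)
  then have ev3: "\<forall>\<^sub>F x in at_top. e x < 1" by (rule order_tendstoD) simp
  have ev4: "\<forall>\<^sub>F x in at_top. X < \<psi> x" using lim unfolding filterlim_at_top_dense by blast
  obtain Y where Y: "\<And>x. x \<ge> Y \<Longrightarrow> \<psi> (h x) = x"
    using inv unfolding eventually_at_top_linorder by blast
  have "\<forall>\<^sub>F x in at_top. d < x powr \<eta> * e x \<and> \<bar>x * e' x / e x\<bar> < 1 \<and> e x < 1 \<and> X < \<psi> x \<and> 1 < x"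
    using ev1 ev2 ev3 ev4 eventually_gt_at_top[of 1] by eventually_elim auto
  then obtain v0 where v0: "\<And>x. x \<ge> v0 \<Longrightarrow> d < x powr \<eta> * e x \<and> \<bar>x * e' x / e x\<bar> < 1 \<and> e x < 1 \<and> X < \<psi> x \<and> 1 < x"
    unfolding eventually_at_top_linorder by blast
  have v01: "v0 > 1" using v0[of v0] by simp
  have epos: "0 < e x" if "x \<ge> v0" for x
  proof -
    have "0 < x powr \<eta> * e x" using v0[OF that] d(1) by (auto intro: less_trans)
    then show ?thesis by (simp add: zero_less_mult_iff)
  qed
  have der: "(\<psi> has_real_derivative \<psi> x * e x / x) (at x)" if "x \<ge> v0" for x
    using R0_rep_deriv(2)[OF e, of x] v0[OF that] by simp
  have smono: "\<psi> x < \<psi> y" if "v0 \<le> x" "x < y" for x y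
  proof (rule DERIV_pos_imp_increasing[OF that(2)])
    fix z assume z: "x \<le> z" "z \<le> y"
    then have "v0 \<le> z" using that by simp
    then show "\<exists>w. (\<psi> has_real_derivative w) (at z) \<and> 0 < w"
      using der epos[of z] v0[of z] X by (intro exI[of _ "\<psi> z * e z / z"]) auto
  qed
  have ev5: "\<forall>\<^sub>F u in at_top. Y \<le> \<psi> u \<and> v0 \<le> h (\<psi> u)"
  proof -
    have "filterlim (\<lambda>u. h (\<psi> u)) at_top at_top" by (rule filterlim_compose[OF hlim lim])
    then have "\<forall>\<^sub>F u in at_top. v0 \<le> h (\<psi> u)" unfolding filterlim_at_top by blast
    moreover have "\<forall>\<^sub>F u in at_top. Y \<le> \<psi> u" using lim unfolding filterlim_at_top by blast
    ultimately show ?thesis by eventually_elim auto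
  qed
  then obtain v1 where v1: "\<And>u. u \<ge> v1 \<Longrightarrow> Y \<le> \<psi> u \<and> v0 \<le> h (\<psi> u)"
    unfolding eventually_at_top_linorder by blast
  define u0 where "u0 = max v0 v1"
  have u0: "u0 > 0" using v01 by (simp add: u0_def less_max_iff_disj)
  \<comment> \<open>The hypothesis makes \<open>\<psi>\<close> a left inverse of \<open>h\<close>.
    Applied at \<psi> u it gives \<psi> (h (\<psi> u)) = \<psi> u, and strict monotonicity of
    \<open>\<psi>\<close> beyond \<open>v0\<close> cancels \<psi>.\<close>
  have hinv: "h (\<psi> u) = u" if "u \<ge> u0" for u
  proof -
    have u: "u \<ge> v0" "Y \<le> \<psi> u" "v0 \<le> h (\<psi> u)" using that v1[of u] by (auto simp: u0_def)
    have "\<psi> (h (\<psi> u)) = \<psi> u" using Y u by simp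
    then show ?thesis using smono[OF u(3), of u] smono[OF u(1), of "h (\<psi> u)"] by (metis less_irrefl linorder_neqE)
  qed
  have elim: "filterlim (\<lambda>t. t * e t) at_top at_top"
  proof (rule filterlim_at_top_mono)
    show "filterlim (\<lambda>t. d * t powr (1 - \<eta>)) at_top at_top"
      using d(1) \<eta> by real_asymp
    show "\<forall>\<^sub>F t in at_top. d * t powr (1 - \<eta>) \<le> t * e t"
      using eventually_ge_at_top[of v0]
    proof eventually_elim
      case (elim t)
      have t: "t > 1" using v0[OF elim] by simp
      have "d * t powr (1 - \<eta>) \<le> (t powr \<eta> * e t) * t powr (1 - \<eta>)"
        using v0[OF elim] by (intro mult_right_mono) auto
      also have "\<dots> = (t powr \<eta> * t powr (1 - \<eta>)) * e t" by simp
      also have "t powr \<eta> * t powr (1 - \<eta>) = t" using t by (simp flip: powr_add)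
      finally show ?case .
    qed
  qed
  have "\<exists>C. growth_scale h \<psi> (\<lambda>u. \<psi> u * e u / u) C X u0"
  proof (rule growth_scale_of_elasticity[where E=1 and ?C1.0=2])
    show "e u \<le> 2 * e t" if "u0 \<le> t" "u0 \<le> u" "u \<le> 2 * t" "t \<le> 2 * u" for t u
    proof (rule log_lipschitz_doubling[OF _ _ _ _ that, where f'=e'])
      show "(e has_real_derivative e' x) (at x)" if "x \<ge> u0" for x
        using R0_rep_deriv(1)[OF e, of x] v0[of x] that by (simp add: u0_def)
    qed (use u0 v0 epos in \<open>auto simp: u0_def intro: less_imp_le\<close>)
    show "h x \<le> h y" if "X \<le> x" "x \<le> y" for x y
      using strict_mono_on_leD[OF hs, of x y] that X by simp
  qed (use u0 v0 epos der hinv elim lim X in \<open>auto simp: u0_def intro: less_imp_le\<close>)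
  then show ?thesis by blast
qed

text \<open>The elasticity of x powr \<beta> * l x is \<beta> + e x; once |e x| < \<beta> / 2 it is
  positive, so \<open>h\<close> increases strictly.\<close>

lemma R_beta_derivative:
  assumes hR: "h \<in> R_beta \<beta>" and \<beta>: "\<beta> > 0"
  shows "\<exists>e Y. (\<forall>x\<ge>Y. \<bar>e x\<bar> < \<beta>/2 \<and> 1 < x \<and> 0 < h x) \<and>
    (\<forall>x>Y. (h has_real_derivative h x * (\<beta> + e x) / x) (at x)) \<and>
    (\<forall>x y. Y < x \<and> x < y \<longrightarrow> h x < h y)"
proof -
  obtain l e e' e'' where e: "R0_rep l e e' e''" and hl: "\<forall>\<^sub>F x in at_top. h x = x powr \<beta> * l x"
    using hR unfolding R_beta_def by blast
  have "(e \<longlongrightarrow> 0) at_top" using e by (simp add: R0_rep_def)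
  then have ev3: "\<forall>\<^sub>F x in at_top. \<bar>e x\<bar> < \<beta>/2"
    using order_tendstoD(2)[OF tendsto_rabs, of e 0 at_top "\<beta>/2"] \<beta> by simp
  have "\<forall>\<^sub>F x in at_top. h x = x powr \<beta> * l x \<and> \<bar>e x\<bar> < \<beta>/2 \<and> 1 < x"
    using hl ev3 eventually_gt_at_top[of 1] by eventually_elim auto
  then obtain Y where Y: "\<And>x. x \<ge> Y \<Longrightarrow> h x = x powr \<beta> * l x \<and> \<bar>e x\<bar> < \<beta>/2 \<and> 1 < x"
    unfolding eventually_at_top_linorder by blast
  have lpos: "l x > 0" if "x \<ge> 1" for x using e that by (simp add: R0_rep_def)
  have hpos: "h x > 0" if "x \<ge> Y" for x using Y[OF that] lpos[of x] by simp
  have hder: "(h has_real_derivative h x * (\<beta> + e x) / x) (at x)" if "x > Y" for x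
  proof (rule has_field_derivative_transform_within_open[where S="{Y<..}"])
    have x: "x > 1" "h x = x powr \<beta> * l x" using Y[of x] that by auto
    have "x powr (\<beta> - 1) = x powr \<beta> / x" using x by (simp add: powr_diff)
    then show "((\<lambda>x. x powr \<beta> * l x) has_real_derivative h x * (\<beta> + e x) / x) (at x)"
      using x by (auto intro!: derivative_eq_intros R0_rep_deriv(2)[OF e] simp: field_simps)
    show "y powr \<beta> * l y = h y" if "y \<in> {Y<..}" for y using Y[of y] that by simp
  qed (use that in auto)
  have hsm: "h x < h y" if "Y < x" "x < y" for x y
  proof (rule DERIV_pos_imp_increasing[OF that(2)])
    fix z assume z: "x \<le> z" "z \<le> y"
    then have "Y < z" using that by simp
    then have "0 < \<beta> + e z" "0 < h z" "0 < z" using Y[of z] hpos[of z] \<beta> by (auto simp: abs_less_iff)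
    then have "0 < h z * (\<beta> + e z) / z" by simp
    then show "\<exists>w. (h has_real_derivative w) (at z) \<and> 0 < w"
      using hder[OF \<open>Y < z\<close>] by blast
  qed
  have "\<bar>e x\<bar> < \<beta>/2 \<and> 1 < x \<and> 0 < h x" if "x \<ge> Y" for x
    using Y[OF that] hpos[OF that] by auto
  then show ?thesis using hder hsm by (intro exI[of _ e] exI[of _ Y]) auto
qed

text \<open>The inverse has the reciprocal elasticity 1 / (\<beta> + e (\<psi> u)), which lies
  between 2 / (3 \<beta>) and 2 / \<beta>. Being bounded away from 0 and infinity, it is comparable
  everywhere with ratio 3.\<close>

lemma growth_scale_R_beta:
  fixes h \<psi> :: "real \<Rightarrow> real"
  assumes hR: "h \<in> R_beta \<beta>" and \<beta>: "\<beta> > 0"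
    and inv: "\<forall>\<^sub>F x in at_top. \<psi> (h x) = x" and hlim: "filterlim h at_top at_top"
    and X: "X \<ge> 1"
  shows "\<exists>\<psi>' C x0 t0. growth_scale h \<psi> \<psi>' C x0 t0 \<and> X \<le> x0"
proof -
  obtain e Z where eZ: "\<forall>x\<ge>Z. \<bar>e x\<bar> < \<beta>/2 \<and> 1 < x \<and> 0 < h x"
      "\<forall>x>Z. (h has_real_derivative h x * (\<beta> + e x) / x) (at x)" "\<forall>x y. Z < x \<and> x < y \<longrightarrow> h x < h y"
    using R_beta_derivative[OF hR \<beta>] by (elim exE conjE)
  then have Z: "\<And>x. x \<ge> Z \<Longrightarrow> \<bar>e x\<bar> < \<beta>/2 \<and> 1 < x \<and> 0 < h x"
    and dZ: "\<And>x. x > Z \<Longrightarrow> (h has_real_derivative h x * (\<beta> + e x) / x) (at x)"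
    and mZ: "\<And>x y. Z < x \<Longrightarrow> x < y \<Longrightarrow> h x < h y"
    by simp_all
  have "\<forall>\<^sub>F x in at_top. \<psi> (h x) = x \<and> X < x \<and> Z \<le> x"
    using inv eventually_gt_at_top[of X] eventually_ge_at_top[of Z] by eventually_elim auto
  then obtain Y where Y1: "\<And>x. x \<ge> Y \<Longrightarrow> \<psi> (h x) = x \<and> X < x \<and> Z \<le> x"
    unfolding eventually_at_top_linorder by blast
  have Y: "\<psi> (h x) = x \<and> \<bar>e x\<bar> < \<beta>/2 \<and> X < x \<and> 1 < x" if "x \<ge> Y" for x
    using Y1[OF that] Z[of x] by auto
  define x0 where "x0 = Y + 1"
  have x0: "x0 > 1" "X \<le> x0" using Y[of Y] by (auto simp: x0_def)
  have hpos: "h x > 0" if "x \<ge> Y" for x using Y1[OF that] Z[of x] by simp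
  have hder: "(h has_real_derivative h x * (\<beta> + e x) / x) (at x)" if "x > Y" for x
    using dZ[of x] Y1[of Y] that by simp
  have hsm: "h x < h y" if "x0 \<le> x" "x < y" for x y
    using mZ[of x y] Y1[of Y] that by (simp add: x0_def)
  have hm: "h x \<le> h y" if "x0 \<le> x" "x \<le> y" for x y using hsm[of x y] that by (cases "x = y") auto
  \<comment> \<open>A left inverse acts as a right inverse only on the range of \<open>h\<close>;
    the intermediate value theorem shows that the range contains all large u.\<close>
  have sur: "\<exists>x\<ge>b. h x = u" if "b \<ge> x0" "u \<ge> h b" for b u
  proof -
    obtain c where c: "c \<ge> b" "h c \<ge> u"
    proof -
      have "\<forall>\<^sub>F c in at_top. u \<le> h c" using hlim unfolding filterlim_at_top by blast
      then have "\<forall>\<^sub>F c in at_top. u \<le> h c \<and> b \<le> c" using eventually_ge_at_top[of b] by eventually_elim auto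
      then show thesis using that unfolding eventually_at_top_linorder by blast
    qed
    have "continuous_on {b..c} h"
    proof (rule DERIV_continuous_on)
      fix x assume "x \<in> {b..c}"
      then have "x > Y" using \<open>b \<ge> x0\<close> by (simp add: x0_def)
      then show "(h has_real_derivative h x * (\<beta> + e x) / x) (at x within {b..c})"
        by (rule has_field_derivative_at_within[OF hder])
    qed
    from IVT'[OF \<open>u \<ge> h b\<close> c(2,1) this] show ?thesis by blast
  qed
  define u0 where "u0 = h (x0 + 1)"
  have u0: "u0 > 0" unfolding u0_def by (rule hpos) (simp add: x0_def)
  have \<psi>ge: "b \<le> \<psi> u \<and> h (\<psi> u) = u" if "b \<ge> x0" "u \<ge> h b" for b u
  proof -
    obtain x where "x \<ge> b" "h x = u" using sur[OF \<open>b \<ge> x0\<close> \<open>u \<ge> h b\<close>] by blast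
    moreover have "\<psi> (h x) = x" by (rule conjunct1[OF Y]) (use \<open>x \<ge> b\<close> \<open>b \<ge> x0\<close> in \<open>simp add: x0_def\<close>)
    ultimately show ?thesis by auto
  qed
  have \<psi>lim: "filterlim \<psi> at_top at_top"
    unfolding filterlim_at_top
  proof
    fix Z
    show "\<forall>\<^sub>F u in at_top. Z \<le> \<psi> u"
      using eventually_ge_at_top[of "h (max x0 Z)"] by eventually_elim (use \<psi>ge[of "max x0 Z"] in auto)
  qed
  define E where "E u = 1 / (\<beta> + e (\<psi> u))" for u
  have \<psi>u0: "x0 + 1 \<le> \<psi> u" "h (\<psi> u) = u" if "u \<ge> u0" for u
    using \<psi>ge[of "x0 + 1" u] that by (auto simp: u0_def)
  have Eb: "2 / (3 * \<beta>) \<le> E u" "E u \<le> 2 / \<beta>" if "u \<ge> u0" for u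
  proof -
    have "\<bar>e (\<psi> u)\<bar> < \<beta>/2" using Y[of "\<psi> u"] \<psi>u0[OF that] by (simp add: x0_def)
    then have b: "\<beta>/2 < \<beta> + e (\<psi> u)" "\<beta> + e (\<psi> u) < 3 * \<beta> / 2" by (auto simp: abs_less_iff)
    have "1 / (3 * \<beta> / 2) \<le> E u" unfolding E_def using b \<beta> by (intro divide_left_mono) auto
    then show "2 / (3 * \<beta>) \<le> E u" by simp
    have "E u \<le> 1 / (\<beta>/2)" unfolding E_def using b \<beta> by (intro divide_left_mono) auto
    then show "E u \<le> 2 / \<beta>" by simp
  qed
  have \<psi>der: "(\<psi> has_real_derivative \<psi> u * E u / u) (at u)" if "u \<ge> u0" for u
  proof -
    define x where "x = \<psi> u"
    have x: "x \<ge> x0 + 1" "h x = u" using \<psi>u0[OF that] by (auto simp: x_def)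
    have cont: "isCont h z" if "\<bar>z - x\<bar> \<le> 1" for z
      using DERIV_isCont[OF hder[of z]] that x by (simp add: x0_def abs_le_iff)
    have "isCont \<psi> (h x)"
      by (rule isCont_inverse_function[of 1]) (use Y x cont in \<open>auto simp: x0_def abs_le_iff\<close>)
    have "(\<psi> has_real_derivative inverse (h x * (\<beta> + e x) / x)) (at u)"
    proof (rule DERIV_inverse_function[where f=h and a="h x0" and b="u + 1"])
      show "(h has_real_derivative h x * (\<beta> + e x) / x) (at (\<psi> u))"
        using hder[of x] x by (simp add: x_def[symmetric] x0_def)
      show "h x * (\<beta> + e x) / x \<noteq> 0" using hpos[of x] x Y[of x] \<beta> x0 by (auto simp: x0_def abs_less_iff)
      show "h x0 < u" using hsm[of x0 x] x by simp
      show "h (\<psi> y) = y" if "h x0 < y" "y < u + 1" for y using \<psi>ge[of x0 y] that by simp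
      show "isCont \<psi> u" using \<open>isCont \<psi> (h x)\<close> x by simp
    qed simp
    moreover have "inverse (h x * (\<beta> + e x) / x) = \<psi> u * E u / u"
      using x by (simp add: E_def x_def[symmetric] field_simps)
    ultimately show ?thesis by simp
  qed
  have Elim: "filterlim (\<lambda>t. t * E t) at_top at_top"
  proof (rule filterlim_at_top_mono)
    show "filterlim (\<lambda>t::real. t * (2 / (3 * \<beta>))) at_top at_top" using \<beta> by real_asymp
    show "\<forall>\<^sub>F t in at_top. t * (2 / (3 * \<beta>)) \<le> t * E t"
      using eventually_ge_at_top[of u0]
    proof eventually_elim
      case (elim t)
      show ?case by (rule mult_left_mono[OF Eb(1)[OF elim]]) (use elim u0 in linarith)
    qed
  qed
  have Epos: "0 < E u" if "u \<ge> u0" for u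
    using Eb(1)[OF that] \<beta> divide_pos_pos[of 2 "3 * \<beta>"] by linarith
  have "\<exists>C. growth_scale h \<psi> (\<lambda>u. \<psi> u * E u / u) C x0 u0"
  proof (rule growth_scale_of_elasticity[where E="2/\<beta>" and ?C1.0=3])
    show "E u \<le> 3 * E t" if "u0 \<le> t" "u0 \<le> u" "u \<le> 2 * t" "t \<le> 2 * u" for t u
      using Eb(2)[OF that(2)] Eb(1)[OF that(1)] by (simp add: field_simps)
    show "x0 \<le> \<psi> u" if "u0 \<le> u" for u using \<psi>u0(1)[OF that] by simp
  qed (use u0 x0 \<psi>der Eb Epos Elim \<psi>lim hm \<psi>u0 in auto)
  then show ?thesis using x0 by blast
qed

text \<open>Divergence of \<open>h\<close> comes from superlinearity of \<open>g\<close> and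
  eventual monotonicity. The free bound \<open>X\<close> allows \<open>x0\<close> to be placed where
  \<open>q\<close> is already small.\<close>

lemma R_frak_growth_scale:
  fixes g h \<psi> :: "real \<Rightarrow> real"
  assumes hR: "h \<in> R_frak" and \<psi>: "\<psi> = gen_inverse h"
    and inv: "\<forall>\<^sub>F x in at_top. \<psi> (h x) = x"
    and g: "filterlim (\<lambda>x. g x / x) at_top at_top" and gd: "\<And>x. x > 0 \<Longrightarrow> (g has_real_derivative h x) (at x)"
  shows "filterlim h at_top at_top"
    and "X \<ge> 1 \<Longrightarrow> \<exists>\<psi>' C x0 t0. growth_scale h \<psi> \<psi>' C x0 t0 \<and> X \<le> x0"
proof -
  have "filterlim h at_top at_top \<and> (X \<ge> 1 \<longrightarrow> (\<exists>\<psi>' C x0 t0. growth_scale h \<psi> \<psi>' C x0 t0 \<and> X \<le> x0))"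
  proof (cases "h \<in> R_infty")
    case True
    then have sm: "strict_mono_on {0<..} h" by (simp add: R_infty_def)
    have "filterlim h at_top at_top"
    proof (rule mono_derivative_unbounded[OF g gd])
      show "(0::real) < 1" by simp
      show "h x \<le> h y" if "1 \<le> x" "x \<le> y" for x y
        using strict_mono_on_leD[OF sm, of x y] that by simp
    qed
    note hl = this
    show ?thesis by (rule conjI[OF hl], rule impI, rule growth_scale_R_infty[OF True \<psi> inv hl])
  next
    case False
    then obtain \<beta> where \<beta>: "\<beta> > 0" "h \<in> R_beta \<beta>" using hR by (auto simp: R_frak_def)
    obtain e Z where eZ: "\<forall>x\<ge>Z. \<bar>e x\<bar> < \<beta>/2 \<and> 1 < x \<and> 0 < h x" "\<forall>x y. Z < x \<and> x < y \<longrightarrow> h x < h y"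
      using R_beta_derivative[OF \<beta>(2,1)] by (elim exE conjE)
    then have Z: "\<And>x. x \<ge> Z \<Longrightarrow> \<bar>e x\<bar> < \<beta>/2 \<and> 1 < x \<and> 0 < h x"
      and mZ: "\<And>x y. Z < x \<Longrightarrow> x < y \<Longrightarrow> h x < h y"
      by simp_all
    have "filterlim h at_top at_top"
    proof (rule mono_derivative_unbounded[OF g gd])
      show "0 < Z + 1" using Z[of Z] by simp
      show "h x \<le> h y" if "Z + 1 \<le> x" "x \<le> y" for x y using mZ[of x y] that by (cases "x = y") auto
    qed
    note hl = this
    show ?thesis by (rule conjI[OF hl], rule impI, rule growth_scale_R_beta[OF \<beta>(2,1) inv hl])
  qed
  then show "filterlim h at_top at_top"
    and "X \<ge> 1 \<Longrightarrow> \<exists>\<psi>' C x0 t0. growth_scale h \<psi> \<psi>' C x0 t0 \<and> X \<le> x0" by auto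
qed

section \<open>The window of radius sqrt (psi' t) around psi t\<close>

lemma growth_scaleD:
  assumes "growth_scale h \<psi> \<psi>' C x0 t0"
  shows "C \<ge> 1" "x0 \<ge> 1" "t0 > 0" "x0 \<le> x \<Longrightarrow> x \<le> y \<Longrightarrow> h x \<le> h y"
    "u \<ge> t0 \<Longrightarrow> (\<psi> has_real_derivative \<psi>' u) (at u)" "u \<ge> t0 \<Longrightarrow> 0 < \<psi>' u"
    "u \<ge> t0 \<Longrightarrow> h (\<psi> u) = u" "u \<ge> t0 \<Longrightarrow> x0 \<le> \<psi> u"
    "t0 \<le> t \<Longrightarrow> t0 \<le> u \<Longrightarrow> u \<le> 2 * t \<Longrightarrow> t \<le> 2 * u \<Longrightarrow> \<psi>' u \<le> C * \<psi>' t"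
    "filterlim (\<lambda>t. t * sqrt (\<psi>' t)) at_top at_top" "filterlim \<psi> at_top at_top"
  using assms by (auto simp: growth_scale_def)

text \<open>Mean value theorem, with psi' at the intermediate point comparable to psi' t throughout
  [t / 2, 2 t].\<close>

lemma growth_scale_increment:
  assumes G: "growth_scale h \<psi> \<psi>' C x0 t0" and t: "t \<ge> 2 * t0" and ab: "t / 2 \<le> a" "a \<le> b" "b \<le> 2 * t"
  shows "(b - a) * (\<psi>' t / C) \<le> \<psi> b - \<psi> a" "\<psi> b - \<psi> a \<le> (b - a) * (C * \<psi>' t)"
proof -
  note D = growth_scaleD[OF G]
  have "(b - a) * (\<psi>' t / C) \<le> \<psi> b - \<psi> a \<and> \<psi> b - \<psi> a \<le> (b - a) * (C * \<psi>' t)"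
  proof (cases "a = b")
    case False
    have "\<exists>z>a. z < b \<and> \<psi> b - \<psi> a = (b - a) * \<psi>' z"
      by (rule MVT2) (use False ab t in \<open>auto intro!: D(5)\<close>)
    then obtain z where z: "a < z" "z < b" "\<psi> b - \<psi> a = (b - a) * \<psi>' z" by blast
    have "\<psi>' z \<le> C * \<psi>' t" "\<psi>' t \<le> C * \<psi>' z" using z ab t D(3) by (auto intro!: D(9))
    then have "\<psi>' t / C \<le> \<psi>' z" "\<psi>' z \<le> C * \<psi>' t" using D(1) by (auto simp: divide_le_eq mult.commute)
    then show ?thesis unfolding z(3) using ab by (intro conjI mult_left_mono) auto
  qed simp
  then show "(b - a) * (\<psi>' t / C) \<le> \<psi> b - \<psi> a" "\<psi> b - \<psi> a \<le> (b - a) * (C * \<psi>' t)" by auto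
qed

text \<open>A change of the argument of psi by 1 / \<sigma> changes psi by about \<psi>' t /
  \<sigma> = \<sigma>, up to the factor C. Reading this backwards through \<open>h\<close> gives the
  change of \<open>h\<close> over a distance \<sigma>; \<open>big\<close> keeps all arguments
  between t / 2 and 2 t.\<close>

lemma growth_scale_window:
  assumes G: "growth_scale h \<psi> \<psi>' C x0 t0" and t: "t \<ge> 2 * t0" and \<sigma>: "\<sigma> = sqrt (\<psi>' t)" and big: "t * \<sigma> \<ge> 2 * C"
  shows "\<psi> t - \<sigma> \<ge> x0" "h (\<psi> t + \<sigma>) \<ge> t + 1 / (C * \<sigma>)" "h (\<psi> t + \<sigma>) \<le> t + C / \<sigma>" "h (\<psi> t - \<sigma>) \<le> t - 1 / (C * \<sigma>)"
proof -
  note D = growth_scaleD[OF G]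
  note inc = growth_scale_increment[OF G t]
  have t0: "t0 \<le> t" "0 < t" using t D(3) by auto
  have \<psi>': "\<psi>' t = \<sigma> * \<sigma>" "\<sigma> > 0" using D(6)[OF t0(1)] by (auto simp: \<sigma>)
  have C: "C \<ge> 1" by (rule D(1))
  have s1: "C / \<sigma> \<le> t / 2" using big \<psi>'(2) by (simp add: divide_le_eq mult.commute)
  have "1 / (C * \<sigma>) \<le> C / \<sigma>"
  proof -
    have "1 / (C * \<sigma>) = (1 / C) / \<sigma>" by simp
    also have "\<dots> \<le> C / \<sigma>" using C \<psi>'(2) by (intro divide_right_mono order_trans[of "1 / C" 1 C]) auto
    finally show ?thesis .
  qed
  then have s2: "1 / (C * \<sigma>) \<le> t / 2" using s1 by linarith
  have s0: "0 < C / \<sigma>" "0 < 1 / (C * \<sigma>)" using C \<psi>'(2) by auto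
  show 1: "\<psi> t - \<sigma> \<ge> x0"
  proof -
    have "(t - t/2) * (\<psi>' t / C) \<le> \<psi> t - \<psi> (t/2)" using inc(1)[of "t/2" t] t0 by simp
    moreover have "\<sigma> \<le> (t - t/2) * (\<psi>' t / C)"
    proof -
      have "2 * C * \<sigma> \<le> t * \<sigma> * \<sigma>" using big \<psi>'(2) by (intro mult_right_mono) auto
      then show ?thesis using C unfolding \<psi>'(1) by (simp add: pos_le_divide_eq mult_ac)
    qed
    moreover have "x0 \<le> \<psi> (t/2)" using t by (intro D(8)) simp
    ultimately show ?thesis by linarith
  qed
  have e1: "1 / (C * \<sigma>) * (C * \<psi>' t) = \<sigma>" and e2: "C / \<sigma> * (\<psi>' t / C) = \<sigma>" using C \<psi>' by auto
  show "h (\<psi> t + \<sigma>) \<ge> t + 1 / (C * \<sigma>)"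
  proof -
    have "\<psi> (t + 1 / (C * \<sigma>)) - \<psi> t \<le> \<sigma>"
      using inc(2)[of t "t + 1 / (C * \<sigma>)"] s0 s2 t0 e1 by simp
    moreover have u: "t0 \<le> t + 1 / (C * \<sigma>)" using s0 t0 by linarith
    ultimately have "h (\<psi> (t + 1 / (C * \<sigma>))) \<le> h (\<psi> t + \<sigma>)" by (intro D(4) D(8)) linarith+
    then show ?thesis using D(7)[OF u] by simp
  qed
  show "h (\<psi> t + \<sigma>) \<le> t + C / \<sigma>"
  proof -
    have "\<sigma> \<le> \<psi> (t + C / \<sigma>) - \<psi> t"
      using inc(1)[of t "t + C / \<sigma>"] s0 s1 t0 e2 by simp
    then have "h (\<psi> t + \<sigma>) \<le> h (\<psi> (t + C / \<sigma>))" using 1 \<psi>'(2) by (intro D(4)) linarith+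
    moreover have u: "t0 \<le> t + C / \<sigma>" using s0 t0 by linarith
    ultimately show ?thesis using D(7)[OF u] by simp
  qed
  show "h (\<psi> t - \<sigma>) \<le> t - 1 / (C * \<sigma>)"
  proof -
    have "\<psi> t - \<psi> (t - 1 / (C * \<sigma>)) \<le> \<sigma>"
      using inc(2)[of "t - 1 / (C * \<sigma>)" t] s0 s2 t0 e1 by simp
    then have "h (\<psi> t - \<sigma>) \<le> h (\<psi> (t - 1 / (C * \<sigma>)))" using 1 by (intro D(4)) linarith+
    moreover have u: "t0 \<le> t - 1 / (C * \<sigma>)" using s2 t by linarith
    ultimately show ?thesis using D(7)[OF u] by simp
  qed
qed

section \<open>The conditional density\<close>

text \<open>Beyond some \<open>Y\<close>, superlinearity gives g x >= (t + 1) x and so decay like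
  exp (- x); below \<open>Y\<close> boundedness of \<open>p\<close> suffices after enlarging the
  constant.\<close>

lemma exp_tails_of_form:
  fixes p g q :: "real \<Rightarrow> real"
  assumes p: "prob_dens p" and pB: "\<And>x. p x \<le> B" and c: "c > 0" and neg: "\<And>x. x < 0 \<Longrightarrow> p x = 0"
    and pform: "\<And>x. x \<ge> 0 \<Longrightarrow> p x = c * exp (- (g x - q x))"
    and g: "filterlim (\<lambda>x. g x / x) at_top at_top" and qb: "\<And>x. x \<ge> X \<Longrightarrow> \<bar>q x\<bar> \<le> 1"
  shows "exp_tails p"
proof -
  note D = prob_densD[OF p]
  note [measurable] = D(1)
  have "integrable lborel (\<lambda>x. exp (t * x) * p x)" for t
  proof -
    have "\<forall>\<^sub>F x in at_top. t + 1 \<le> g x / x \<and> X \<le> x \<and> 1 \<le> x"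
      using g eventually_ge_at_top[of X] eventually_ge_at_top[of 1] unfolding filterlim_at_top
      by (intro eventually_conj) auto
    then obtain Y where Y: "\<And>x. x \<ge> Y \<Longrightarrow> t + 1 \<le> g x / x \<and> X \<le> x \<and> 1 \<le> x"
      unfolding eventually_at_top_linorder by blast
    define L where "L = c * exp 1 + B * exp ((\<bar>t\<bar> + 1) * \<bar>Y\<bar>)"
    have B: "B \<ge> 0" using pB[of 0] D(2)[of 0] by linarith
    have bound: "exp (t * x) * p x \<le> L * (\<bar>x\<bar> ^ 0 * exp (- 1 * \<bar>x\<bar>))" for x
    proof -
      consider "x < 0" | "0 \<le> x" "x < Y" | "0 \<le> x" "x \<ge> Y" by linarith
      then show ?thesis
      proof cases
        case 1
        then show ?thesis using neg c B by (simp add: L_def)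
      next
        case 2
        have "exp (t * x) * p x \<le> exp (\<bar>t\<bar> * \<bar>Y\<bar>) * B"
        proof (intro mult_mono pB D)
          have "t * x \<le> \<bar>t\<bar> * x" using 2 by (intro mult_right_mono) auto
          also have "\<dots> \<le> \<bar>t\<bar> * \<bar>Y\<bar>" using 2 by (intro mult_left_mono) auto
          finally show "exp (t * x) \<le> exp (\<bar>t\<bar> * \<bar>Y\<bar>)" by simp
        qed (use B in auto)
        also have "\<dots> \<le> exp ((\<bar>t\<bar> + 1) * \<bar>Y\<bar> + (- \<bar>x\<bar>)) * B"
          using 2 B by (intro mult_right_mono) (auto simp: algebra_simps)
        also have "\<dots> = B * exp ((\<bar>t\<bar> + 1) * \<bar>Y\<bar>) * exp (- \<bar>x\<bar>)" by (simp only: exp_add mult_ac)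
        also have "\<dots> \<le> L * exp (- \<bar>x\<bar>)" using c by (intro mult_right_mono) (auto simp: L_def)
        finally show ?thesis by simp
      next
        case 3
        have Yx: "t + 1 \<le> g x / x" "X \<le> x" "1 \<le> x" using Y[OF 3(2)] by auto
        then have "(t + 1) * x \<le> g x" by (simp add: pos_le_divide_eq)
        then have le: "t * x + (- (g x - q x)) \<le> 1 + (- \<bar>x\<bar>)" using qb[OF Yx(2)] Yx(3) by (simp add: algebra_simps)
        have "exp (t * x) * p x = c * exp (t * x + (- (g x - q x)))"
          unfolding pform[OF 3(1)] exp_add by simp
        also have "\<dots> \<le> c * exp (1 + (- \<bar>x\<bar>))" using le c by (intro mult_left_mono) auto
        also have "\<dots> = c * exp 1 * exp (- \<bar>x\<bar>)" by (simp only: exp_add mult.assoc)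
        also have "\<dots> \<le> L * exp (- \<bar>x\<bar>)" using B by (intro mult_right_mono) (auto simp: L_def)
        finally show ?thesis by simp
      qed
    qed
    have "integrable lborel (\<lambda>x. L * (\<bar>x\<bar> ^ 0 * exp (- 1 * \<bar>x\<bar>)))"
      by (intro integrable_mult_right integrable_exp_abs) simp
    then show ?thesis by (rule integrable_dominated) (use D(2) bound in auto)
  qed
  then show ?thesis using p neg by (simp add: exp_tails_def)
qed

text \<open>Both bounds are proved together because the induction step for the first needs the crude
  size of the partial product.\<close>

lemma prod_one_plus_bound:
  fixes r :: "nat \<Rightarrow> real"
  assumes "\<And>i. i < j \<Longrightarrow> \<bar>r i\<bar> \<le> R" "R \<le> 1" "0 \<le> R"
  shows "\<bar>(\<Prod>i<j. 1 + r i) - 1\<bar> \<le> 2 ^ j * R \<and> \<bar>\<Prod>i<j. 1 + r i\<bar> \<le> 2 ^ j"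
  using assms(1)
proof (induction j)
  case (Suc j)
  define P where "P = (\<Prod>i<j. 1 + r i)"
  have IH: "\<bar>P - 1\<bar> \<le> 2 ^ j * R" "\<bar>P\<bar> \<le> 2 ^ j" using Suc unfolding P_def by auto
  have rj: "\<bar>r j\<bar> \<le> R" using Suc.prems by simp
  have "\<bar>P * (1 + r j) - 1\<bar> \<le> \<bar>P - 1\<bar> + \<bar>P\<bar> * \<bar>r j\<bar>"
    using abs_triangle_ineq[of "P - 1" "P * r j"] by (simp add: algebra_simps abs_mult)
  also have "\<dots> \<le> 2 ^ j * R + 2 ^ j * R" using IH rj by (intro add_mono mult_mono) auto
  finally have 1: "\<bar>P * (1 + r j) - 1\<bar> \<le> 2 ^ Suc j * R" by (simp add: mult_ac)
  have "\<bar>P * (1 + r j)\<bar> \<le> 2 ^ j * 2" unfolding abs_mult using IH rj assms(2) by (intro mult_mono) auto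
  then have "\<bar>P * (1 + r j)\<bar> \<le> 2 ^ Suc j" by (simp only: power_Suc2)
  with 1 show ?case unfolding prod.lessThan_Suc P_def[symmetric] by blast
qed (use assms in simp)

text \<open>The distribution statement concerns \<open>ennreal (p x)\<close> only; nonnegativity at
  every point transfers measurability and total mass back to \<open>p\<close> itself.\<close>

lemma distributed_prob_dens:
  assumes "prob_space M" "distributed M lborel X (\<lambda>x. ennreal (p x))" "\<And>x. 0 \<le> p x"
  shows "prob_dens p"
proof -
  interpret prob_space M by fact
  have "(\<lambda>x. ennreal (p x)) \<in> borel_measurable lborel" using assms(2) by (rule distributed_borel_measurable)
  then have "(\<lambda>x. enn2real (ennreal (p x))) \<in> borel_measurable borel" by simp
  then have m [measurable]: "p \<in> borel_measurable borel" using assms(3) by simp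
  have "distr M lborel X = density lborel (\<lambda>x. ennreal (p x))"
    using assms(2) by (rule distributed_distr_eq_density)
  moreover have "prob_space (distr M lborel X)"
    using assms(2) by (intro prob_space_distr distributed_measurable)
  ultimately have "prob_space (density lborel (\<lambda>x. ennreal (p x)))" by simp
  from prob_space.emeasure_space_1[OF this] have 1: "(\<integral>\<^sup>+x. ennreal (p x) \<partial>lborel) = 1"
    by (simp add: emeasure_density)
  then have I: "integrable lborel p"
    using assms(3) by (intro integrableI_bounded) auto
  then have "ennreal (LINT x|lborel. p x) = 1" using 1 assms(3) by (subst nn_integral_eq_integral[symmetric]) auto
  then have "(LINT x|lborel. p x) = 1"
    using assms(3) by (metis Bochner_Integration.integral_nonneg ennreal_1 ennreal_inj zero_le_one)
  then show ?thesis using m I assms(3) by (simp add: prob_dens_def)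
qed

text \<open>These bounds up to constants replace Laplace asymptotics of the tilted moments.\<close>

lemma tilted_dominated:
  fixes p g q h \<psi> \<psi>' :: "real \<Rightarrow> real"
  assumes G: "growth_scale h \<psi> \<psi>' C x0 t0"
    and p: "exp_tails p" and pB: "\<And>x. p x \<le> B" and c: "c > 0"
    and pform: "\<And>x. x \<ge> 0 \<Longrightarrow> p x = c * exp (- (g x - q x))"
    and gd: "\<And>x. x > 0 \<Longrightarrow> (g has_real_derivative h x) (at x)" and qb: "\<And>x. x \<ge> x0 \<Longrightarrow> \<bar>q x\<bar> \<le> 1"
  shows "\<exists>A>0. \<forall>\<^sub>F t in at_top. tilt_dominated p A (1 / C) (sqrt (\<psi>' t)) (\<psi> t) t"
proof -
  note D = growth_scaleD[OF G]
  have B: "B \<ge> 0" using pB[of 0] prob_densD(2)[OF exp_tailsD(1)[OF p], of 0] by linarith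
  define A where "A = (c * exp (1 + 1 / C) + B * exp (1 / C + g (x0 + 1))) * exp (1 + C) / c"
  have "A > 0" unfolding A_def using c B by (intro divide_pos_pos mult_pos_pos add_pos_nonneg) auto
  moreover have "\<forall>\<^sub>F t in at_top. tilt_dominated p A (1 / C) (sqrt (\<psi>' t)) (\<psi> t) t"
  proof -
    \<comment> \<open>The part 2 * C feeds the window estimate, the part x0 + 1 the comparison with
      the region below \<open>x0\<close>.\<close>
    have "\<forall>\<^sub>F t in at_top. 2 * C + x0 + 1 \<le> t * sqrt (\<psi>' t)" using D(10) unfolding filterlim_at_top by blast
    then show ?thesis using eventually_ge_at_top[of "2 * t0"]
    proof eventually_elim
      case (elim t)
      define \<sigma> where "\<sigma> = sqrt (\<psi>' t)"
      have t: "t0 \<le> t" "0 < t" using elim D(3) by auto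
      have \<sigma>: "\<sigma> > 0" using D(6)[OF t(1)] by (simp add: \<sigma>_def)
      have big: "t * \<sigma> \<ge> 2 * C" using elim(1) D(2) by (simp add: \<sigma>_def)
      note W = growth_scale_window[OF G elim(2) \<sigma>_def big]
      have "x0 + 1 \<le> t * \<sigma>" using elim(1) D(1) by (simp add: \<sigma>_def)
      also have "\<dots> \<le> t * (C * \<sigma>)" using D(1) t \<sigma> by (intro mult_left_mono) auto
      finally have sm: "(x0 + 1) / (C * \<sigma>) \<le> t" using D(1) \<sigma> by (simp add: pos_divide_le_eq)
      have x0: "x0 > 0" using D(2) by simp
      show ?case
        unfolding \<sigma>_def[symmetric] A_def tilt_dominated_def
        using tilted_exponential_bound[OF p pB c pform x0 gd D(4) qb t(2) \<sigma> D(1) W(1) D(7)[OF t(1)] W(2-4) sm] by blast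
    qed
  qed
  ultimately show ?thesis by blast
qed

text \<open>In the application F i is the density of the last n - i variables at the remaining sum;
  F 0, ..., F (k - 1) are the values that become denominators.\<close>

lemma cond_density_telescope:
  fixes F :: "nat \<Rightarrow> real" and y :: "nat \<Rightarrow> real"
  assumes pos: "\<And>i. i < k \<Longrightarrow> F i \<noteq> 0" and k: "k \<ge> 1"
  shows "(\<Prod>i=1..k. p (y i)) * F k / F 0 = (\<Prod>i<k. p (y (i + 1)) * F (i + 1) / F i)"
proof -
  have "j \<le> k \<Longrightarrow> j \<ge> 1 \<Longrightarrow> (\<Prod>i=1..j. p (y i)) * F j / F 0 = (\<Prod>i<j. p (y (i + 1)) * F (i + 1) / F i)" for j
  proof (induction j)
    case (Suc j)
    show ?case
    proof (cases "j = 0")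
      case False
      then have IH: "(\<Prod>i=1..j. p (y i)) * F j / F 0 = (\<Prod>i<j. p (y (i + 1)) * F (i + 1) / F i)" using Suc by simp
      have "F j \<noteq> 0" using pos Suc.prems by simp
      then have "a * b * f / z = (a * F j / z) * (b * f / F j)" for a b f z by simp
      then show ?thesis unfolding prod.lessThan_Suc IH[symmetric] by simp
    qed simp
  qed simp
  then show ?thesis using k by simp
qed

text \<open>The last two inequalities serve to invert the mean function: a mean within sqrt (psi' t)
  of that at t belongs to a tilt between t / 2 and 2 t.\<close>

definition tilt_mean_scale ::
  "(real \<Rightarrow> real) \<Rightarrow> (real \<Rightarrow> real) \<Rightarrow> (real \<Rightarrow> real) \<Rightarrow> real \<Rightarrow> real \<Rightarrow> bool" where
  "tilt_mean_scale p \<psi> \<psi>' C1 t \<longleftrightarrow> \<bar>tilt_mean p t - \<psi> t\<bar> \<le> C1 * sqrt (\<psi>' t) \<and> sqrt (\<psi>' t) \<le> \<psi> t \<and> 0 < \<psi>' t \<and>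
     tilt_mean p t + sqrt (\<psi>' t) \<le> tilt_mean p (2 * t) \<and> tilt_mean p (t / 2) \<le> tilt_mean p t - sqrt (\<psi>' t)"

text \<open>Means follow psi up to a multiple of the scale, while psi itself moves by any prescribed
  multiple of the scale over a factor 2 in t, because t sqrt (psi' t) diverges.\<close>

lemma tilt_mean_scale_exists:
  assumes G: "growth_scale h \<psi> \<psi>' C x0 t0" and p: "exp_tails p" and A: "A > 0"
    and dom: "\<forall>\<^sub>F t in at_top. tilt_dominated p A (1 / C) (sqrt (\<psi>' t)) (\<psi> t) t"
  shows "\<exists>C1\<ge>0. \<forall>\<^sub>F t in at_top. tilt_mean_scale p \<psi> \<psi>' C1 t"
proof -
  note D = growth_scaleD[OF G]
  define C1 where "C1 = exp_moment A (1 / C) 1"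
  have C1: "C1 \<ge> 0" unfolding C1_def using A by (intro exp_moment_nonneg) simp
  have kp: "1 / C > 0" using D(1) by simp
  have dev: "\<forall>\<^sub>F t in at_top. \<bar>tilt_mean p t - \<psi> t\<bar> \<le> C1 * sqrt (\<psi>' t)"
    using dom eventually_ge_at_top[of t0]
  proof eventually_elim
    case (elim t)
    show ?case unfolding C1_def
      by (rule tilted_mean_deviation(1)[OF p _ kp]) (use elim D(6) in auto)
  qed
  have "filterlim (\<lambda>t::real. 2 * t) at_top at_top" "filterlim (\<lambda>t::real. t / 2) at_top at_top" by real_asymp+
  note dev2 = eventually_compose_filterlim[OF dev this(1)] eventually_compose_filterlim[OF dev this(2)]
  \<comment> \<open>One unit for the desired gap, C1 for the deviation of the mean at t, and C1 * C
    for the one at 2 t or t / 2, where the scale may be larger by the factor C.\<close>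
  define K where "K = 1 + C1 * (1 + C)"
  have K: "K \<ge> 1" using C1 D(1) by (simp add: K_def)
  have "\<forall>\<^sub>F t in at_top. 2 * K * C + 2 * C \<le> t * sqrt (\<psi>' t)" using D(10) unfolding filterlim_at_top by blast
  then have "\<forall>\<^sub>F t in at_top. tilt_mean_scale p \<psi> \<psi>' C1 t"
    using dev dev2 eventually_ge_at_top[of "2 * t0"]
  proof eventually_elim
    case (elim t)
    define \<sigma> where "\<sigma> = sqrt (\<psi>' t)"
    have t: "t0 \<le> t" "0 < t" using elim D(3) by auto
    have \<sigma>: "\<sigma> > 0" "\<psi>' t = \<sigma> * \<sigma>" using D(6)[OF t(1)] by (auto simp: \<sigma>_def)
    have C: "C \<ge> 1" by (rule D(1))
    have big: "2 * C \<le> t * \<sigma>" "2 * K * C \<le> t * \<sigma>"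
      using elim(1) K C mult_nonneg_nonneg[of K C] unfolding \<sigma>_def by linarith+
    have "\<psi> t - \<sigma> \<ge> x0" by (rule growth_scale_window(1)[OF G elim(5) \<sigma>_def big(1)])
    then have le\<psi>: "\<sigma> \<le> \<psi> t" using D(2) by linarith
    have comp: "sqrt (\<psi>' u) \<le> C * \<sigma>" if "t / 2 \<le> u" "u \<le> 2 * t" for u
    proof -
      have "\<psi>' u \<le> C * \<psi>' t" using that elim(5) t by (intro D(9)) auto
      also have "\<dots> \<le> C * (C * \<psi>' t)" using C D(6)[OF t(1)] by (intro mult_left_mono) auto
      also have "\<dots> = (C * \<sigma>)\<^sup>2" unfolding \<sigma>(2) by (simp add: power2_eq_square)
      finally show ?thesis using C \<sigma>(1) by (intro real_le_lsqrt) auto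
    qed
    have inc: "K * \<sigma> \<le> t / 2 * (\<psi>' t / C)"
    proof -
      have "2 * K * C * \<sigma> \<le> t * \<sigma> * \<sigma>" using big(2) \<sigma>(1) by (intro mult_right_mono) auto
      then show ?thesis using C unfolding \<sigma>(2) by (simp add: pos_le_divide_eq mult_ac)
    qed
    have K\<sigma>: "K * \<sigma> = \<sigma> + C1 * \<sigma> + C1 * (C * \<sigma>)" by (simp add: K_def algebra_simps)
    have "t * (\<psi>' t / C) \<le> \<psi> (2 * t) - \<psi> t"
      using growth_scale_increment(1)[OF G elim(5), of t "2 * t"] t by simp
    moreover have "t / 2 * (\<psi>' t / C) \<le> t * (\<psi>' t / C)"
      using t C D(6)[OF t(1)] by (intro mult_right_mono) auto
    ultimately have up: "K * \<sigma> \<le> \<psi> (2 * t) - \<psi> t" using inc by linarith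
    have down: "K * \<sigma> \<le> \<psi> t - \<psi> (t / 2)"
      using growth_scale_increment(1)[OF G elim(5), of "t / 2" t] t inc by simp
    have "C1 * sqrt (\<psi>' (2 * t)) \<le> C1 * (C * \<sigma>)" "C1 * sqrt (\<psi>' (t / 2)) \<le> C1 * (C * \<sigma>)"
      using C1 t by (auto intro!: mult_left_mono comp)
    then show ?case
      using elim(2-4) up down K\<sigma> le\<psi> D(6)[OF t(1)] unfolding tilt_mean_scale_def \<sigma>_def[symmetric] by auto
  qed
  then show ?thesis using C1 by blast
qed

theorem theorem5p1:
  fixes p g q h \<psi> :: "real \<Rightarrow> real" and c \<theta> :: real
    and M :: "'a measure" and X :: "nat \<Rightarrow> 'a \<Rightarrow> real"
    and k :: nat and y :: "nat \<Rightarrow> real"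
    and a t :: "nat \<Rightarrow> real" and ti :: "nat \<Rightarrow> nat \<Rightarrow> real"
  assumes p_form: "c > 0" "\<forall>x\<ge>0. p x = c * exp (- (g x - q x))" "\<forall>x<0. p x = 0"
    and p_bounded: "\<exists>B. \<forall>x. p x \<le> B"
    and g_pos: "\<forall>x\<ge>0. g x > 0"
    and g_superlinear: "filterlim (\<lambda>x. g x / x) at_top at_top"
    and g_deriv: "\<forall>x>0. (g has_real_derivative h x) (at x)"
    and q_small: "\<theta> > 0"
      "\<forall>\<^sub>F x in at_top. \<forall>v\<ge>0. \<bar>v - x\<bar> < \<theta> * x \<longrightarrow> \<bar>q v\<bar> \<le> 1 / (x * sqrt (h x))"
    and h_regular: "h \<in> R_frak"
    and psi_def: "\<psi> = gen_inverse h"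
    and psi_inverse: "\<forall>\<^sub>F x in at_top. \<psi> (h x) = x"
    and X_iid: "prob_space M" "prob_space.indep_vars M (\<lambda>_. borel) X {1..}"
      "\<forall>i\<ge>1. distributed M lborel (X i) (\<lambda>x. ennreal (p x))"
    and k: "k \<ge> 1"
    and a_lim: "filterlim a at_top sequentially"
    and t_def: "\<forall>\<^sub>F n in sequentially. tilt_mean p (t n) = a n"
    and growth: "(\<lambda>n. (\<psi> (t n))\<^sup>2 / (sqrt (real n) * deriv \<psi> (t n))) \<longlonglongrightarrow> 0"
    and ti_def: "\<forall>\<^sub>F n in sequentially. \<forall>i<k.
      tilt_mean p (ti n i) = (real n * a n - (\<Sum>j=1..i. y j)) / (real n - real i)"
  shows "\<exists>\<delta> :: nat \<Rightarrow> real. \<delta> \<in> o(\<lambda>n. 1 / sqrt (real n)) \<and>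
    (\<forall>\<^sub>F n in sequentially.
       cond_density p n (real n * a n) k y =
       (\<Prod>i<k. tilted_density p (tilt_mean p (ti n i)) (y (i + 1))) * (1 + \<delta> n))"
proof -
  have pform: "p x = c * exp (- (g x - q x))" if "x \<ge> 0" for x using p_form(2) that by blast
  have pneg: "p x = 0" if "x < 0" for x using p_form(3) that by blast
  have p0: "0 \<le> p x" for x using pform[of x] pneg[of x] p_form(1) by (cases "x < 0") auto
  have dens: "prob_dens p"
    using X_iid(3) by (intro distributed_prob_dens[OF X_iid(1) _ p0]) auto
  obtain B where pB: "\<And>x. p x \<le> B" using p_bounded by blast
  have gd: "(g has_real_derivative h x) (at x)" if "x > 0" for x using g_deriv that by blast
  have hlim: "filterlim h at_top at_top"
    by (rule R_frak_growth_scale(1)[OF h_regular psi_def psi_inverse g_superlinear gd])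
  have "\<forall>\<^sub>F x in at_top. 1 \<le> h x" using hlim unfolding filterlim_at_top by blast
  then have "\<forall>\<^sub>F x in at_top. \<bar>q x\<bar> \<le> 1"
    using q_small(2) eventually_ge_at_top[of 1]
  proof eventually_elim
    case (elim x)
    \<comment> \<open>The case v = x of the smallness condition; since \<open>h\<close> tends to
      infinity, the right side is eventually at most 1.\<close>
    have "\<bar>q x\<bar> \<le> 1 / (x * sqrt (h x))" using elim q_small(1) by simp
    also have "\<dots> \<le> 1"
    proof -
      have "1 * 1 \<le> x * sqrt (h x)" using elim by (intro mult_mono) auto
      then show ?thesis by simp
    qed
    finally show ?case .
  qed
  then obtain X0 where X0: "\<And>x. x \<ge> X0 \<Longrightarrow> \<bar>q x\<bar> \<le> 1"
    unfolding eventually_at_top_linorder by blast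
  have "\<exists>\<psi>' C x0 t0. growth_scale h \<psi> \<psi>' C x0 t0 \<and> max 1 X0 \<le> x0"
    by (rule R_frak_growth_scale(2)[OF h_regular psi_def psi_inverse g_superlinear gd]) simp_all
  then obtain \<psi>' C x0 t0 where G: "growth_scale h \<psi> \<psi>' C x0 t0" and x0: "max 1 X0 \<le> x0"
    by (elim exE conjE)
  have qb: "\<bar>q x\<bar> \<le> 1" if "x \<ge> x0" for x using X0[of x] that x0 by simp
  note D = growth_scaleD[OF G]
  have tails: "exp_tails p"
    by (rule exp_tails_of_form[OF dens pB p_form(1) pneg pform g_superlinear qb])
  let ?m = "tilt_mean p"
  note mono = tilt_mean_strict_mono[OF tails]
  have "\<exists>A>0. \<forall>\<^sub>F t in at_top. tilt_dominated p A (1 / C) (sqrt (\<psi>' t)) (\<psi> t) t"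
    by (rule tilted_dominated[OF G tails pB p_form(1) pform gd qb])
  then obtain A where A: "A > 0" and dom: "\<forall>\<^sub>F t in at_top. tilt_dominated p A (1 / C) (sqrt (\<psi>' t)) (\<psi> t) t"
    by (elim exE conjE)
  from tilt_mean_scale_exists[OF G tails A dom]
  obtain C1 where C1: "C1 \<ge> 0" and scale: "\<forall>\<^sub>F t in at_top. tilt_mean_scale p \<psi> \<psi>' C1 t"
    by (elim exE conjE)
  obtain T where T: "\<And>t. t \<ge> T \<Longrightarrow> tilt_dominated p A (1 / C) (sqrt (\<psi>' t)) (\<psi> t) t"
    using dom unfolding eventually_at_top_linorder by blast
  have kp: "1 / C > 0" using D(1) by simp
  show ?thesis
  proof (rule conv_power_step[OF tails A kp])
    fix N0 :: nat and D0 :: real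
    assume step: "\<And>\<tau> \<sigma> xh N y. \<sigma> > 0 \<Longrightarrow> tilt_dominated p A (1 / C) \<sigma> xh \<tau> \<Longrightarrow> N \<ge> N0 \<Longrightarrow>
       conv_power p N (real N * ?m \<tau>) > 0 \<and>
       (\<exists>r. p y * conv_power p (N - 1) (real N * ?m \<tau> - y) / conv_power p N (real N * ?m \<tau>) =
           tilted_density p (?m \<tau>) y * (1 + r) \<and> \<bar>r\<bar> \<le> D0 * (1 + ((?m \<tau> - y) / \<sigma>)\<^sup>2) / real N)"
    define W where "W n = (\<psi> (t n))\<^sup>2 / \<psi>' (t n)" for n
    define Y where "Y = (\<Sum>j=1..k. \<bar>y j\<bar>)"
    define S where "S i = (\<Sum>j=1..i. y j)" for i
    define F where "F n i = conv_power p (n - i) (real n * a n - S i)" for n i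
    define d where "d n i = tilted_density p (?m (ti n i)) (y (i + 1))" for n i
    define \<pi> where "\<pi> n i = p (y (i + 1)) * F n (i + 1) / F n i" for n i
    \<comment> \<open>The distance from m_i to y (i + 1) is at most \<psi> + 2 a <= (3 + 2 C1)
      \<psi>, and C compares psi' at t with psi' at t_i.\<close>
    define K3 where "K3 = (3 + 2 * C1)\<^sup>2 * C"
    define \<rho> where "\<rho> n = 2 * \<bar>D0\<bar> * (1 + K3 * W n) / real n" for n
    \<comment> \<open>The means tend to infinity and the mean function is strictly increasing, so
      the tilts cannot stay below any bound.\<close>
    have tn: "filterlim t at_top sequentially"
      unfolding filterlim_at_top
    proof
      fix Z
      have "\<forall>\<^sub>F n in sequentially. ?m Z \<le> a n" using a_lim unfolding filterlim_at_top by blast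
      then show "\<forall>\<^sub>F n in sequentially. Z \<le> t n"
        using t_def
      proof eventually_elim
        case (elim n)
        then have "?m Z \<le> ?m (t n)" by simp
        then show ?case using strict_mono_less_eq[OF mono] by blast
      qed
    qed
    have evt: "\<forall>\<^sub>F n in sequentially. P (t n)" if "\<forall>\<^sub>F t in at_top. P t" for P
      by (rule eventually_compose_filterlim[OF that tn])
    have Wlim: "(\<lambda>n. W n / sqrt (real n)) \<longlonglongrightarrow> 0"
    proof (rule Lim_transform_eventually[OF growth])
      show "\<forall>\<^sub>F n in sequentially. (\<psi> (t n))\<^sup>2 / (sqrt (real n) * deriv \<psi> (t n)) = W n / sqrt (real n)"
        using evt[OF eventually_ge_at_top[of t0]]
        by eventually_elim (simp add: W_def DERIV_imp_deriv[OF D(5)] mult.commute)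
    qed
    have SY: "\<bar>S i\<bar> \<le> Y" if "i \<le> k" for i
    proof -
      have "\<bar>S i\<bar> \<le> (\<Sum>j=1..i. \<bar>y j\<bar>)" unfolding S_def by (rule sum_abs)
      also have "\<dots> \<le> Y" unfolding Y_def using that by (intro sum_mono2) auto
      finally show ?thesis .
    qed
    have yY: "\<bar>y (i + 1)\<bar> \<le> Y" if "i < k" for i
      unfolding Y_def by (rule member_le_sum) (use that in auto)
    \<comment> \<open>The difference m_i - a_n is (i a_n - S i) / (n - i), at most (k + 1) a_n / (n
      / 2), and a_n <= (1 + C1) \<psi> (t n).\<close>
    define K where "K = 2 * (real k + 1) * (1 + C1)"
    have K: "K > 0" using C1 by (simp add: K_def)
    have evW: "\<forall>\<^sub>F n in sequentially. W n / sqrt (real n) < 1 / K\<^sup>2"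
      using Wlim K by (intro order_tendstoD) auto
    \<comment> \<open>This ensures that n - i is at least n / 2 and at least N0 for all i <
      k.\<close>
    have evn: "\<forall>\<^sub>F n in sequentially. 2 * k + 2 * N0 + 1 \<le> n" by (rule eventually_ge_at_top)
    have evY: "\<forall>\<^sub>F n in sequentially. Y + 1 \<le> a n" using a_lim unfolding filterlim_at_top by blast
    have main: "\<forall>\<^sub>F n in sequentially. \<forall>i<k. F n i \<noteq> 0 \<and>
      (\<exists>r. \<pi> n i = d n i * (1 + r) \<and> \<bar>r\<bar> \<le> \<rho> n)"
      using evW evn evY t_def ti_def evt[OF scale] evt[OF eventually_ge_at_top[of "2 * \<bar>T\<bar> + 2 * t0"]]
    proof eventually_elim
      case (elim n)
      define \<sigma> where "\<sigma> = sqrt (\<psi>' (t n))"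
      have \<psi>'0: "0 < \<psi>' (t n)" using elim(6) by (simp add: tilt_mean_scale_def)
      have \<sigma>: "0 < \<sigma>" "\<sigma> \<le> \<psi> (t n)" "\<bar>a n - \<psi> (t n)\<bar> \<le> C1 * \<sigma>"
        and mt: "a n + \<sigma> \<le> ?m (2 * t n)" "?m (t n / 2) \<le> a n - \<sigma>"
        using elim(6) unfolding tilt_mean_scale_def elim(4) \<sigma>_def by auto
      have n: "real n \<ge> 1" using elim(2) by simp
      have Y0: "0 \<le> Y" unfolding Y_def by (intro sum_nonneg) simp
      have "C1 * \<sigma> \<le> C1 * \<psi> (t n)" using C1 \<sigma>(2) by (intro mult_left_mono) auto
      then have a: "a n \<le> (1 + C1) * \<psi> (t n)" "0 < a n" "Y \<le> a n"
        using \<sigma>(3) elim(3) Y0 by (auto simp: algebra_simps)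
      have \<psi>: "0 < \<psi> (t n)" using \<sigma> by linarith
      show "\<forall>i<k. F n i \<noteq> 0 \<and>
        (\<exists>r. \<pi> n i = d n i * (1 + r) \<and> \<bar>r\<bar> \<le> \<rho> n)"
      proof (intro allI impI)
        fix i assume i: "i < k"
        let ?\<tau> = "ti n i"
        have in2: "real n / 2 \<le> real n - real i" "real (n - i) = real n - real i" "0 < real n - real i" "N0 \<le> n - i"
          using i elim(2) by auto
        have mi: "?m ?\<tau> = (real n * a n - S i) / (real n - real i)" using elim(5) i by (simp add: S_def)
        have "?m ?\<tau> - a n = (real i * a n - S i) / (real n - real i)"
          unfolding mi using in2(3) by (simp add: field_simps)
        then have "\<bar>?m ?\<tau> - a n\<bar> = \<bar>real i * a n - S i\<bar> / (real n - real i)"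
          using in2(3) by (simp add: abs_divide)
        also have "\<dots> \<le> ((real k + 1) * a n) / (real n / 2)"
        proof (rule frac_le)
          have "real i * a n \<le> real k * a n" "0 \<le> real i * a n" using i a(2) by (auto intro!: mult_right_mono)
          moreover have "(real k + 1) * a n = real k * a n + a n" by (simp add: algebra_simps)
          ultimately show "\<bar>real i * a n - S i\<bar> \<le> (real k + 1) * a n"
            using SY[OF less_imp_le[OF i]] a(3) by linarith
        qed (use in2 n a in auto)
        also have "\<dots> \<le> ((real k + 1) * ((1 + C1) * \<psi> (t n))) / (real n / 2)"
          using a n by (intro divide_right_mono mult_left_mono) auto
        also have "\<dots> = K * \<psi> (t n) / real n" by (simp add: K_def)
        \<comment> \<open>After squaring, the claim reads K^2 W n <= n^2; the growth assumption
          bounds the left side by sqrt n.\<close>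
        also have "\<dots> \<le> \<sigma>"
          unfolding \<sigma>_def
        proof (rule real_le_rsqrt)
          have "W n < 1 / K\<^sup>2 * sqrt (real n)" using elim(1) n by (simp add: pos_divide_less_eq)
          then have "K\<^sup>2 * W n \<le> sqrt (real n)" using K by (simp add: field_simps)
          also have "sqrt (real n) \<le> real n * real n"
          proof -
            have "sqrt (real n) \<le> sqrt (real n * real n)" using n by (intro real_sqrt_le_mono) simp
            also have "\<dots> = real n" using n by simp
            also have "\<dots> \<le> real n * real n" using n by simp
            finally show ?thesis .
          qed
          finally have "K\<^sup>2 * W n / (real n)\<^sup>2 \<le> 1" using n by (simp add: power2_eq_square)
          then have "\<psi>' (t n) * (K\<^sup>2 * W n / (real n)\<^sup>2) \<le> \<psi>' (t n) * 1" using \<psi>'0 by (intro mult_left_mono) auto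
          moreover have "\<psi>' (t n) * (K\<^sup>2 * W n / (real n)\<^sup>2) = (K * \<psi> (t n) / real n)\<^sup>2"
            using \<psi>'0 by (simp add: W_def power_mult_distrib power_divide)
          ultimately show "(K * \<psi> (t n) / real n)\<^sup>2 \<le> \<psi>' (t n)" by simp
        qed
        finally have dev: "\<bar>?m ?\<tau> - a n\<bar> \<le> \<sigma>" .
        have "?m ?\<tau> \<le> ?m (2 * t n)" "?m (t n / 2) \<le> ?m ?\<tau>" using dev mt by (auto simp: abs_le_iff)
        \<comment> \<open>This confines t_i to the range where the scales at t_i and t are
          comparable and the domination holds.\<close>
        then have \<tau>: "?\<tau> \<le> 2 * t n" "t n / 2 \<le> ?\<tau>" using strict_mono_less_eq[OF mono] by auto
        have tT: "T \<le> ?\<tau>" "t0 \<le> ?\<tau>" "t0 \<le> t n" using \<tau> elim(7) D(3) by auto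
        define w where "w = (?m ?\<tau> - y (i + 1)) / sqrt (\<psi>' ?\<tau>)"
        have s\<tau>: "0 < sqrt (\<psi>' ?\<tau>)" using D(6)[OF tT(2)] by simp
        have st: "0 < conv_power p (n - i) (real (n - i) * ?m ?\<tau>)"
          "\<exists>r. p (y (i + 1)) * conv_power p (n - i - 1) (real (n - i) * ?m ?\<tau> - y (i + 1)) / conv_power p (n - i) (real (n - i) * ?m ?\<tau>) =
           d n i * (1 + r) \<and> \<bar>r\<bar> \<le> D0 * (1 + w\<^sup>2) / real (n - i)"
          using step[OF s\<tau> T[OF tT(1)] in2(4)] unfolding w_def d_def by blast+
        have e1: "real (n - i) * ?m ?\<tau> = real n * a n - S i" unfolding mi in2(2) using in2(3) by simp
        have e2: "real n * a n - S i - y (i + 1) = real n * a n - S (i + 1)" by (simp add: S_def)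
        have bd: "D0 * (1 + w\<^sup>2) / real (n - i) \<le> \<rho> n"
        proof -
          have "\<bar>?m ?\<tau> - y (i + 1)\<bar> \<le> \<bar>?m ?\<tau> - a n\<bar> + (a n + \<bar>y (i + 1)\<bar>)" using a(2) by linarith
          also have "\<dots> \<le> \<psi> (t n) + 2 * a n" using dev \<sigma>(2) yY[OF i] a(3) by linarith
          also have "\<dots> \<le> (3 + 2 * C1) * \<psi> (t n)" using a(1) by (simp add: algebra_simps)
          finally have "\<bar>?m ?\<tau> - y (i + 1)\<bar> \<le> \<bar>(3 + 2 * C1) * \<psi> (t n)\<bar>" by linarith
          then have sq: "(?m ?\<tau> - y (i + 1))\<^sup>2 \<le> ((3 + 2 * C1) * \<psi> (t n))\<^sup>2" by (rule abs_le_square_iff[THEN iffD1])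
          have "\<psi>' (t n) \<le> C * \<psi>' ?\<tau>" using \<tau> tT by (intro D(9)) auto
          then have \<psi>C: "\<psi>' (t n) / C \<le> \<psi>' ?\<tau>" using D(1) by (simp add: divide_le_eq mult.commute)
          have "w\<^sup>2 = (?m ?\<tau> - y (i + 1))\<^sup>2 / \<psi>' ?\<tau>"
            using s\<tau> by (simp add: w_def power_divide)
          also have "\<dots> \<le> ((3 + 2 * C1) * \<psi> (t n))\<^sup>2 / (\<psi>' (t n) / C)"
            using sq \<psi>C \<psi>'0 D(1) by (intro frac_le) auto
          also have "\<dots> = K3 * W n" by (simp add: K3_def W_def power_mult_distrib)
          finally have w2: "w\<^sup>2 \<le> K3 * W n" .
          \<comment> \<open>The sign of \<open>D0\<close> is not known, so its absolute value is
            taken before enlarging w^2.\<close>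
          have "D0 * (1 + w\<^sup>2) \<le> \<bar>D0\<bar> * (1 + w\<^sup>2)"
            by (intro mult_right_mono) auto
          also have "\<dots> \<le> \<bar>D0\<bar> * (1 + K3 * W n)" using w2 by (intro mult_left_mono) auto
          finally have "D0 * (1 + w\<^sup>2) / real (n - i) \<le> \<bar>D0\<bar> * (1 + K3 * W n) / real (n - i)"
            by (intro divide_right_mono) auto
          also have "\<dots> \<le> \<bar>D0\<bar> * (1 + K3 * W n) / (real n / 2)"
          proof (intro divide_left_mono mult_nonneg_nonneg)
            show "0 \<le> 1 + K3 * W n" using w2 zero_le_power2[of w] by linarith
          qed (use in2 n in auto)
          finally show ?thesis by (simp add: \<rho>_def mult_ac)
        qed
        show "F n i \<noteq> 0 \<and> (\<exists>r. \<pi> n i = d n i * (1 + r) \<and> \<bar>r\<bar> \<le> \<rho> n)"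
        proof
          show "F n i \<noteq> 0" using st(1) unfolding e1 F_def by simp
          obtain r where r: "p (y (i + 1)) * conv_power p (n - i - 1) (real (n - i) * ?m ?\<tau> - y (i + 1)) / conv_power p (n - i) (real (n - i) * ?m ?\<tau>) =
             d n i * (1 + r)" "\<bar>r\<bar> \<le> D0 * (1 + w\<^sup>2) / real (n - i)"
            using st(2) by blast
          have "n - i - 1 = n - (i + 1)" by simp
          then have "\<pi> n i = d n i * (1 + r)"
            using r(1) unfolding e1 e2 \<pi>_def F_def by simp
          then show "\<exists>r. \<pi> n i = d n i * (1 + r) \<and> \<bar>r\<bar> \<le> \<rho> n"
            using r(2) bd by (intro exI[of _ r]) simp
        qed
      qed
    qed
    define P where "P n i r \<longleftrightarrow> \<pi> n i = d n i * (1 + r) \<and> \<bar>r\<bar> \<le> \<rho> n" for n i r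
    \<comment> \<open>A choice for all n and i makes \<delta> a single sequence; its values matter
      only for the large n where \<open>P\<close> is satisfiable.\<close>
    define r where "r n i = (SOME r. P n i r)" for n i
    define \<delta> where "\<delta> n = (\<Prod>i<k. 1 + r n i) - 1" for n
    have Pr: "\<forall>\<^sub>F n in sequentially. \<forall>i<k. F n i \<noteq> 0 \<and> P n i (r n i)"
      using main
    proof eventually_elim
      case (elim n)
      show ?case
      proof (intro allI impI conjI)
        fix i assume "i < k"
        with elim have *: "F n i \<noteq> 0" "\<exists>r. P n i r" unfolding P_def by blast+
        show "F n i \<noteq> 0" by fact
        show "P n i (r n i)" unfolding r_def by (rule someI_ex[OF *(2)])
      qed
    qed
    \<comment> \<open>Up to constants the expression is 1 / sqrt n plus W n / sqrt n, and the second
      term is the quantity in the growth assumption.\<close>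
    have \<rho>lim: "(\<lambda>n. sqrt (real n) * \<rho> n) \<longlonglongrightarrow> 0"
    proof -
      have "(\<lambda>n. 1 / sqrt (real n)) \<longlonglongrightarrow> 0" by real_asymp
      then have "(\<lambda>n. 2 * \<bar>D0\<bar> * (1 / sqrt (real n) + K3 * (W n / sqrt (real n)))) \<longlonglongrightarrow> 2 * \<bar>D0\<bar> * (0 + K3 * 0)"
        by (intro tendsto_intros Wlim)
      moreover have "2 * \<bar>D0\<bar> * (1 / sqrt (real n) + K3 * (W n / sqrt (real n))) = sqrt (real n) * \<rho> n" for n
      proof -
        have *: "sqrt (real n) * (d * e / real n) = d * (e / sqrt (real n))" for d e :: real
          using real_div_sqrt[of "real n"] by (cases "n = 0") (auto simp: field_simps)
        show ?thesis unfolding \<rho>_def * by (simp add: add_divide_distrib)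
      qed
      ultimately show ?thesis by simp
    qed
    have \<rho>0: "(\<lambda>n. \<rho> n) \<longlonglongrightarrow> 0"
    proof (rule Lim_null_comparison[OF _ \<rho>lim])
      show "\<forall>\<^sub>F n in sequentially. norm (\<rho> n) \<le> sqrt (real n) * \<rho> n"
        using main eventually_ge_at_top[of 1]
      proof eventually_elim
        case (elim n)
        \<comment> \<open>As k >= 1, the factor i = 0 supplies some r with |r| <= \<rho> n.\<close>
        then have "0 \<le> \<rho> n" using k order_trans[OF abs_ge_zero] by (metis less_eq_Suc_le One_nat_def)
        moreover have "1 \<le> sqrt (real n)" using elim(2) by simp
        ultimately show ?case using mult_right_mono[of 1 "sqrt (real n)" "\<rho> n"] by simp
      qed
    qed
    have ev\<delta>: "\<forall>\<^sub>F n in sequentially. \<bar>\<delta> n\<bar> \<le> 2 ^ k * \<rho> n"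
      using Pr order_tendstoD(2)[OF \<rho>0 zero_less_one]
    proof eventually_elim
      case (elim n)
      have "\<bar>r n i\<bar> \<le> \<rho> n" if "i < k" for i using elim(1) that by (simp add: P_def)
      moreover have "0 \<le> \<rho> n" using calculation[of 0] k by linarith
      ultimately show ?case unfolding \<delta>_def using prod_one_plus_bound[of k "r n" "\<rho> n"] elim(2) by simp
    qed
    show ?thesis
    proof (intro exI[of _ \<delta>] conjI)
      show "\<delta> \<in> o(\<lambda>n. 1 / sqrt (real n))"
      proof (rule smalloI_tendsto)
        show "(\<lambda>n. \<delta> n / (1 / sqrt (real n))) \<longlonglongrightarrow> 0"
        proof (rule Lim_null_comparison)
          show "\<forall>\<^sub>F n in sequentially. norm (\<delta> n / (1 / sqrt (real n))) \<le> 2 ^ k * (sqrt (real n) * \<rho> n)"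
            using ev\<delta>
          proof eventually_elim
            case (elim n)
            show ?case using mult_right_mono[OF elim, of "sqrt (real n)"] by (simp add: abs_mult mult_ac)
          qed
          show "(\<lambda>n. 2 ^ k * (sqrt (real n) * \<rho> n)) \<longlonglongrightarrow> 0"
            using tendsto_mult_left[OF \<rho>lim, of "2 ^ k"] by simp
        qed
        show "\<forall>\<^sub>F n in sequentially. 1 / sqrt (real n) \<noteq> 0"
          using eventually_ge_at_top[of 1] by eventually_elim simp
      qed
      show "\<forall>\<^sub>F n in sequentially. cond_density p n (real n * a n) k y =
          (\<Prod>i<k. tilted_density p (?m (ti n i)) (y (i + 1))) * (1 + \<delta> n)"
        using Pr
      proof eventually_elim
        case (elim n)
        have "cond_density p n (real n * a n) k y = (\<Prod>i=1..k. p (y i)) * F n k / F n 0"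
          by (simp add: cond_density_def F_def S_def)
        also have "\<dots> = (\<Prod>i<k. \<pi> n i)"
          unfolding \<pi>_def by (rule cond_density_telescope) (use elim k in auto)
        also have "\<dots> = (\<Prod>i<k. d n i * (1 + r n i))"
          by (intro prod.cong refl) (use elim in \<open>auto simp: P_def\<close>)
        also have "\<dots> = (\<Prod>i<k. d n i) * (1 + \<delta> n)"
          by (simp add: prod.distrib \<delta>_def d_def)
        finally show ?case unfolding d_def .
      qed
    qed
  qed
qed

end
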